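(* Let $b\ge2$ and let $Y_n:=(W_n,P_n)^T$ be the vector consisting of the Wiener index and the internal path length of a random $b$-ary recursive tree of size $n$ with edge weights $Z$, where $\|Z\|$ is bounded almost surely. Let $$X_n:=\begin{bmatrix}\frac1{n^2}&0\\0&\frac1n\end{bmatrix}\left(Y_n-E[Y_n]\right),$$ which satisfies the recursion $X_n\stackrel{d}{=}\sum_{i=1}^bA_i(I_n)X^{(i)}_{I_{n,i}}+d(I_n,Z)$ ($n\ge2$) specified in the context. Then there exists a constant $D>0$ such that $\|d(I_n,Z)\|\le D$ almost surely for all $n$, and such that, with $\gamma\approx2.0047$ the positive solution of $12/7=e^{2/\gamma}-2/\gamma$, $L_0\approx5.0177$ the largest root of $e^L=6L^2$, and $C:=48D/\gamma+D\sqrt{48(48/\gamma^2-5)}$, for all $t>0$ and $n\in\mathbb{N}$ each of the probabilities $$P\left(\frac{W_n-E[W_n]}{n^2}>t\right),\qquad P\left(\frac{P_n-E[P_n]}{n}>t\right),$$ as well as the corresponding left-tail probabilities $P(X_{n,j}<-t)$ for $j=1,2$, is at most $$\begin{cases} \exp\left(-\frac{t^2}{10\gamma^2D^2}\right),&\text{if }0\le t\le 5\gamma D,\\ \exp\left(\frac52-\frac{t}{\gamma D}\right),&\text{if }5\gamma D<t\le C,\\ \exp\left(-\frac{t^2}{96D^2}\right),&\text{if }C<t\le 48DL_0,\\ \exp\left(24L_0^2-\frac{L_0}{D}t\right),&\text{if }48DL_0<t\le 4De^{L_0},\\ \exp\left(\frac tD-\frac tD\log\left(\frac{t}{4D}\right)\right),&\text{if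 }4De^{L_0}<t. \end{cases}$$
   Context: Random $b$-ary recursive tree: in the infinite complete $b$-ary rooted ordered tree, start with the root as the only internal node and its $b$ children as external nodes. Given the tree with $n$ internal nodes, choose one of the current external nodes uniformly at random, turn it into an internal node, and add its $b$ children to the set of external nodes. The tree $T_n$ of size $n$ consists of the $n$ internal nodes. Edge weights: $Z=(Z_1,\ldots,Z_b)$ is a random vector with non-negative entries which are identically distributed (but may be dependent). To every node $u$ of the infinite $b$-ary tree attach an independent copy $Z^{(u)}$ of $Z$, the family being independent of the $T_n$; the entries of $Z^{(u)}$ are the weights of the edges from $u$ to its $b$ children. The distance between two nodes is the sum of the weights of the edges on the unique path between them; the depth of a node is its distance to the root. The internal path length $P_n$ is the sum of the depths of all $n$ nodes; the Wiener index $W_n$ is the sum of the distances over all unordered pairs of nodes. Put $W_0=P_0=0$ and $X_0=0$. Recursion: for $n\ge 2$, $I_n=(I_{n,1},\ldots,I_{n,b})$ is the vector of the sizes of the $b$ subtrees of the root of $T_n$ (so $\sum_i I_{n,i}=n-1$); the $X^{(i)}_m$ are distributed as $X_m$; the families $(X^{(1)}_m)_m,\ldots,(X^{(b)}_m)_m$, $I_n$, $Z$ are independent; $$A_i(I_n)=\begin{bmatrix}\frac{I_{n,i}^2}{n^2}&\frac{I_{n,i}(n-I_{n,i})}{n^2}\\0&\frac{I_{n,i}}{n}\end{bmatrix},$$ and $d(I_n,Z)=(d_1^{(n)},d_2^{(n)})^T$ is the remaining term, that is, with $w_m=E[W_m]$, $p_m=E[P_m]$, $$d_1^{(n)}=\frac1{n^2}\Big(\sum_{i=1}^b\big(w_{I_{n,i}}+(n-I_{n,i})p_{I_{n,i}}+Z_iI_{n,i}(n-I_{n,i})\big)-w_n\Big),\quad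 d_2^{(n)}=\frac1n\Big(\sum_{i=1}^b\big(p_{I_{n,i}}+Z_iI_{n,i}\big)-p_n\Big).$$ $\|\cdot\|$ is the Euclidean norm; $\mathbb{N}=\{1,2,\ldots\}$. *)

theory Defs
  imports "HOL-Probability.Probability"
begin

section \<open>The random b-ary recursive tree\<close>

text \<open>
  The arity \<open>b\<close> is \<^term>\<open>CARD('b)\<close> for a finite type \<open>'b\<close> of child labels.  A node of the infinite
  complete b-ary tree is the word of labels leading to it from the root \<^term>\<open>[]\<close>, so that
  the children of \<open>u\<close> are the words \<^term>\<open>u @ [i]\<close>.  A tree is identified with its set of
  internal nodes.
\<close>

definition external_nodes :: "'b list set \<Rightarrow> 'b list set" where
  "external_nodes S = {u @ [i] | u i. u \<in> S} - S"

fun bary_tree :: "nat \<Rightarrow> 'b::finite list set pmf" where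
  "bary_tree 0 = return_pmf {}"
| "bary_tree (Suc 0) = return_pmf {[]}"
| "bary_tree (Suc (Suc n)) =
     bind_pmf (bary_tree (Suc n))
       (\<lambda>S. map_pmf (\<lambda>v. insert v S) (pmf_of_set (external_nodes S)))"

definition subtree_sizes :: "'b list set \<Rightarrow> 'b \<Rightarrow> nat" where
  "subtree_sizes S i = card {v. i # v \<in> S}"

section \<open>Weighted distances\<close>

definition adjacent :: "'b list \<Rightarrow> 'b list \<Rightarrow> bool" where
  "adjacent u v \<longleftrightarrow> (\<exists>i. v = u @ [i]) \<or> (\<exists>i. u = v @ [i])"

definition simple_path :: "'b list \<Rightarrow> 'b list \<Rightarrow> 'b list list \<Rightarrow> bool" where
  "simple_path u v xs \<longleftrightarrow>
     xs \<noteq> [] \<and> hd xs = u \<and> last xs = v \<and> distinct xs \<and> successively adjacent xs"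

text \<open>Well-definedness of the path used in the distance below.\<close>

lemma enter_sub:
  assumes "adjacent x y" "\<not> (\<exists>w. x = c @ w)" "y = c @ w" "c = u @ [i]"
  shows "x = u \<and> y = c"
proof -
  from assms(1) consider j where "y = x @ [j]" | j where "x = y @ [j]"
    unfolding adjacent_def by blast
  then show ?thesis
  proof cases
    case 1
    show ?thesis
    proof (cases w rule: rev_cases)
      case Nil then show ?thesis using 1 assms by auto
    next
      case (snoc w' a)
      then have "x = c @ w'" using 1 assms by (metis append_assoc append1_eq_conv)
      then show ?thesis using assms by blast
    qed
  next
    case 2 then show ?thesis using assms by auto
  qed
qed

lemma adjacent_sym: "adjacent x y \<longleftrightarrow> adjacent y x"
  unfolding adjacent_def by blast

lemma path_crosses_in:
  "successively adjacent (x # xs) \<Longrightarrow> \<not> (\<exists>w. x = c @ w) \<Longrightarrow> \<exists>w. last (x # xs) = c @ w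
    \<Longrightarrow> c = u @ [i] \<Longrightarrow> u \<in> set (x # xs) \<and> c \<in> set (x # xs)"
proof (induction xs arbitrary: x)
  case Nil then show ?case by auto
next
  case (Cons y ys)
  show ?case
  proof (cases "\<exists>w. y = c @ w")
    case True
    then obtain w where "y = c @ w" by blast
    moreover have "adjacent x y" using Cons.prems by simp
    ultimately have "x = u \<and> y = c" using enter_sub Cons.prems by metis
    then show ?thesis by auto
  next
    case False
    have "u \<in> set (y # ys) \<and> c \<in> set (y # ys)"
      using Cons.IH[of y] Cons.prems False by simp
    then show ?thesis by auto
  qed
qed

lemma path_crosses_out:
  "successively adjacent (x # xs) \<Longrightarrow> (\<exists>w. x = c @ w) \<Longrightarrow> \<not> (\<exists>w. last (x # xs) = c @ w)
    \<Longrightarrow> c = u @ [i] \<Longrightarrow> u \<in> set (x # xs) \<and> c \<in> set (x # xs)"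
proof (induction xs arbitrary: x)
  case Nil then show ?case by auto
next
  case (Cons y ys)
  show ?case
  proof (cases "\<exists>w. y = c @ w")
    case False
    obtain w where "x = c @ w" using Cons.prems by blast
    moreover have "adjacent y x" using Cons.prems by (simp add: adjacent_sym[of y x])
    ultimately have "y = u \<and> x = c" using enter_sub False Cons.prems by metis
    then show ?thesis by auto
  next
    case True
    have "u \<in> set (y # ys) \<and> c \<in> set (y # ys)"
      using Cons.IH[of y] Cons.prems True by simp
    then show ?thesis by auto
  qed
qed

lemma first_step:
  assumes "simple_path u v (u # y # ys)"
  shows "y = (if \<exists>i w. v = u @ i # w then u @ [v ! length u] else butlast u)"
proof -
  have p: "successively adjacent (y # ys)" "adjacent u y" "u \<notin> set (y # ys)" "last (y # ys) = v"
    using assms by (auto simp: simple_path_def)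
  show ?thesis
  proof (cases "\<exists>i w. v = u @ i # w")
    case True
    then obtain i w where v: "v = u @ i # w" by blast
    have "\<exists>w. y = (u @ [i]) @ w"
      using path_crosses_in[of y ys "u @ [i]" u i] p v by auto
    then obtain w' where w': "y = (u @ [i]) @ w'" by blast
    have "y = u @ [i]"
      using enter_sub[OF p(2) _ w' refl] by auto
    then show ?thesis using v by auto
  next
    case False
    have "y \<noteq> u @ [i]" for i
    proof
      assume y: "y = u @ [i]"
      have "\<not> (\<exists>w. last (y # ys) = (u @ [i]) @ w)" using False p(4) by auto
      then have "u \<in> set (y # ys)"
        using path_crosses_out[of y ys "u @ [i]" u i] p y by auto
      then show False using p by blast
    qed
    then have "y = butlast u" using p(2) unfolding adjacent_def by auto
    then show ?thesis using False by auto
  qed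
qed

lemma simple_path_tl: "simple_path u v (u # y # ys) \<Longrightarrow> simple_path y v (y # ys)"
  by (auto simp: simple_path_def)

lemma simple_path_self: "simple_path u u xs \<Longrightarrow> xs = [u]"
  unfolding simple_path_def
  by (metis distinct.simps(2) last_ConsR last_in_set list.collapse)

lemma simple_path_unique:
  "simple_path u v xs \<Longrightarrow> simple_path u v ys \<Longrightarrow> xs = ys"
proof (induction xs arbitrary: u ys)
  case Nil then show ?case by (simp add: simple_path_def)
next
  case (Cons x xs)
  have x: "x = u" using Cons.prems by (simp add: simple_path_def)
  show ?case
  proof (cases "u = v")
    case True
    then show ?thesis using Cons.prems simple_path_self by metis
  next
    case False
    obtain y xs' where xs: "xs = y # xs'"
      using Cons.prems(1) False x by (cases xs) (auto simp: simple_path_def)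
    obtain y' ys' where ys: "ys = u # y' # ys'"
      using Cons.prems(2) False
      by (cases ys; cases "tl ys") (auto simp: simple_path_def)
    have "y = y'"
      using first_step Cons.prems xs ys x by metis
    then show ?thesis
      using Cons.IH[of y "y' # ys'"] simple_path_tl Cons.prems xs ys x by metis
  qed
qed

lemma simple_path_exists: "\<exists>xs. simple_path u v xs"
proof -
  have conn: "\<exists>xs. xs \<noteq> [] \<and> hd xs = u \<and> last xs = v \<and> successively adjacent xs"
  proof (induction "length u" arbitrary: u)
    case 0
    show ?case
    proof (induction v rule: rev_induct)
      case Nil show ?case using 0 by (intro exI[of _ "[[]]"]) auto
    next
      case (snoc a v)
      then obtain xs where "xs \<noteq> []" "hd xs = u" "last xs = v" "successively adjacent xs" by blast
      then show ?case
        by (intro exI[of _ "xs @ [v @ [a]]"]) (auto simp: successively_append_iff adjacent_def)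
    qed
  next
    case (Suc n)
    then obtain xs where "xs \<noteq> []" "hd xs = butlast u" "last xs = v" "successively adjacent xs"
      by (metis diff_Suc_1 length_butlast)
    moreover have "u \<noteq> []" using Suc by auto
    then have "adjacent u (butlast u)"
      unfolding adjacent_def by (metis append_butlast_last_id)
    ultimately show ?case
      by (intro exI[of _ "u # xs"]) (auto simp: successively_Cons)
  qed
  define Q where "Q = (\<lambda>xs. xs \<noteq> [] \<and> hd xs = u \<and> last xs = v \<and> successively adjacent xs)"
  obtain xs where xs: "Q xs" "\<And>ys. Q ys \<Longrightarrow> length xs \<le> length ys"
    using conn ex_has_least_nat[of Q _ length] unfolding Q_def by metis
  have "distinct xs"
  proof (rule ccontr)
    assume "\<not> distinct xs"
    then obtain as bs cs y where d: "xs = as @ [y] @ bs @ [y] @ cs"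
      using not_distinct_decomp by blast
    have "successively adjacent as" "as \<noteq> [] \<longrightarrow> adjacent (last as) y"
      using xs(1) unfolding Q_def d by (auto simp: successively_append_iff)
    moreover have "successively adjacent ((as @ [y] @ bs) @ (y # cs))"
      using xs(1) unfolding Q_def d by simp
    then have "successively adjacent (y # cs)"
      by (simp only: successively_append_iff)
    ultimately have "successively adjacent (as @ y # cs)"
      by (auto simp: successively_append_iff)
    moreover have "hd (as @ y # cs) = u" "last (as @ y # cs) = v"
      using xs(1) unfolding Q_def d by (cases as; simp)+
    ultimately have "Q (as @ y # cs)"
      by (simp add: Q_def)
    then show False using xs(2) d by fastforce
  qed
  then show ?thesis using xs(1) unfolding Q_def simple_path_def by blast
qed

lemma simple_path_ex1: "\<exists>!xs. simple_path u v xs"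
  using simple_path_exists simple_path_unique by blast

text \<open>
  For adjacent \<open>u\<close> and \<open>v\<close>, the shorter word is the parent, and the last letter of the longer word
  is the entry of the parent's weight vector that belongs to the edge.
\<close>

definition edge_weight :: "('b list \<Rightarrow> real^'b) \<Rightarrow> 'b list \<Rightarrow> 'b list \<Rightarrow> real" where
  "edge_weight z u v = (if length u < length v then z u $ last v else z v $ last u)"

definition path_weight :: "('b list \<Rightarrow> real^'b) \<Rightarrow> 'b list list \<Rightarrow> real" where
  "path_weight z xs = (\<Sum>k<length xs - 1. edge_weight z (xs ! k) (xs ! Suc k))"

definition node_dist :: "('b list \<Rightarrow> real^'b) \<Rightarrow> 'b list \<Rightarrow> 'b list \<Rightarrow> real" where
  "node_dist z u v = path_weight z (THE xs. simple_path u v xs)"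

definition node_depth :: "('b list \<Rightarrow> real^'b) \<Rightarrow> 'b list \<Rightarrow> real" where
  "node_depth z u = node_dist z [] u"

definition internal_path_length :: "('b list \<Rightarrow> real^'b) \<Rightarrow> 'b list set \<Rightarrow> real" where
  "internal_path_length z S = (\<Sum>u\<in>S. node_depth z u)"

text \<open>Every unordered pair is counted twice in the double sum; the diagonal contributes 0.\<close>

definition wiener_index :: "('b list \<Rightarrow> real^'b) \<Rightarrow> 'b list set \<Rightarrow> real" where
  "wiener_index z S = (\<Sum>u\<in>S. \<Sum>v\<in>S. node_dist z u v) / 2"

section \<open>The rescaled vector and its recursion\<close>

text \<open>
  Throughout, \<open>T n\<close> is the random tree of size \<open>n\<close> and \<open>Z u\<close> the random vector of the weights of
  the edges from \<open>u\<close> to its children.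
\<close>

definition wiener_rv :: "(nat \<Rightarrow> 'a \<Rightarrow> 'b list set) \<Rightarrow> ('b list \<Rightarrow> 'a \<Rightarrow> real^'b) \<Rightarrow> nat \<Rightarrow> 'a \<Rightarrow> real" where
  "wiener_rv T Z n \<omega> = wiener_index (\<lambda>u. Z u \<omega>) (T n \<omega>)"

definition path_length_rv :: "(nat \<Rightarrow> 'a \<Rightarrow> 'b list set) \<Rightarrow> ('b list \<Rightarrow> 'a \<Rightarrow> real^'b) \<Rightarrow> nat \<Rightarrow> 'a \<Rightarrow> real" where
  "path_length_rv T Z n \<omega> = internal_path_length (\<lambda>u. Z u \<omega>) (T n \<omega>)"

definition Y_vec :: "(nat \<Rightarrow> 'a \<Rightarrow> 'b list set) \<Rightarrow> ('b list \<Rightarrow> 'a \<Rightarrow> real^'b) \<Rightarrow> nat \<Rightarrow> 'a \<Rightarrow> real^2" where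
  "Y_vec T Z n \<omega> = vector [wiener_rv T Z n \<omega>, path_length_rv T Z n \<omega>]"

text \<open>For \<open>n = 0\<close> the scaling matrix is 0, because \<^prop>\<open>1 / (0::real) = 0\<close>; hence \<open>X 0 = 0\<close>.\<close>

definition X_vec :: "'a measure \<Rightarrow> (nat \<Rightarrow> 'a \<Rightarrow> 'b list set) \<Rightarrow> ('b list \<Rightarrow> 'a \<Rightarrow> real^'b)
    \<Rightarrow> nat \<Rightarrow> 'a \<Rightarrow> real^2" where
  "X_vec M T Z n \<omega> =
     (vector [vector [1 / real n ^ 2, 0], vector [0, 1 / real n]] :: real^2^2)
       *v (Y_vec T Z n \<omega> - (LINT \<omega>'|M. Y_vec T Z n \<omega>'))"

definition sizes_rv :: "(nat \<Rightarrow> 'a \<Rightarrow> 'b list set) \<Rightarrow> nat \<Rightarrow> 'a \<Rightarrow> 'b \<Rightarrow> nat" where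
  "sizes_rv T n \<omega> = subtree_sizes (T n \<omega>)"

definition A_mat :: "nat \<Rightarrow> ('b \<Rightarrow> nat) \<Rightarrow> 'b \<Rightarrow> real^2^2" where
  "A_mat n k i = vector
     [vector [real (k i) ^ 2 / real n ^ 2, real (k i) * (real n - real (k i)) / real n ^ 2],
      vector [0, real (k i) / real n]]"

definition d_vec :: "'a measure \<Rightarrow> (nat \<Rightarrow> 'a \<Rightarrow> 'b::finite list set) \<Rightarrow> ('b list \<Rightarrow> 'a \<Rightarrow> real^'b)
    \<Rightarrow> nat \<Rightarrow> ('b \<Rightarrow> nat) \<Rightarrow> real^'b \<Rightarrow> real^2" where
  "d_vec M T Z n k z =
     (let w = (\<lambda>m. LINT \<omega>|M. wiener_rv T Z m \<omega>);
          p = (\<lambda>m. LINT \<omega>|M. path_length_rv T Z m \<omega>)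
      in vector
        [((\<Sum>i\<in>UNIV. w (k i) + (real n - real (k i)) * p (k i)
              + z $ i * real (k i) * (real n - real (k i))) - w n) / real n ^ 2,
         ((\<Sum>i\<in>UNIV. p (k i) + z $ i * real (k i)) - p n) / real n])"

text \<open>
  The law of the right-hand side of the recursion.  In \<open>(k, z, x)\<close> the components have the laws of
  \<open>I n\<close> and of \<open>Z []\<close>, and \<open>x i m\<close> has the law of \<open>X m\<close>; \<open>k\<close>, \<open>z\<close> and the families \<open>x i\<close> are
  independent.  Only the entries \<open>x i (k i)\<close> enter, so the dependence between \<open>x i m\<close> for different
  \<open>m\<close> is immaterial; the product measure makes them independent.
\<close>

definition recursion_law :: "'a measure \<Rightarrow> (nat \<Rightarrow> 'a \<Rightarrow> 'b::finite list set)
    \<Rightarrow> ('b list \<Rightarrow> 'a \<Rightarrow> real^'b) \<Rightarrow> nat \<Rightarrow> (real^2) measure" where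
  "recursion_law M T Z n =
     distr
       (distr M (count_space UNIV) (sizes_rv T n)
         \<Otimes>\<^sub>M (distr M borel (Z [])
         \<Otimes>\<^sub>M (\<Pi>\<^sub>M i\<in>UNIV. \<Pi>\<^sub>M m\<in>UNIV. distr M borel (X_vec M T Z m))))
       borel
       (\<lambda>(k, z, x). (\<Sum>i\<in>UNIV. A_mat n k i *v x i (k i)) + d_vec M T Z n k z)"

section \<open>Constants and the tail bound\<close>

definition \<gamma>_const :: real where
  "\<gamma>_const = (THE g. 0 < g \<and> 12 / 7 = exp (2 / g) - 2 / g)"

definition L\<^sub>0 :: real where
  "L\<^sub>0 = (GREATEST L. exp L = 6 * L ^ 2)"

definition C_const :: "real \<Rightarrow> real" where
  "C_const D = 48 * D / \<gamma>_const + D * sqrt (48 * (48 / \<gamma>_const ^ 2 - 5))"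

definition tail_bound :: "real \<Rightarrow> real \<Rightarrow> real" where
  "tail_bound D t =
     (if t \<le> 5 * \<gamma>_const * D then exp (- (t ^ 2 / (10 * \<gamma>_const ^ 2 * D ^ 2)))
      else if t \<le> C_const D then exp (5 / 2 - t / (\<gamma>_const * D))
      else if t \<le> 48 * D * L\<^sub>0 then exp (- (t ^ 2 / (96 * D ^ 2)))
      else if t \<le> 4 * D * exp L\<^sub>0 then exp (24 * L\<^sub>0 ^ 2 - L\<^sub>0 / D * t)
      else exp (t / D - t / D * ln (t / (4 * D))))"

end

theory Submission
  imports Defs
begin

text \<open>
  The root splits the tree into subtrees that, given their sizes \<open>k\<close>, are independent random b-ary
  recursive trees: an external node is chosen by first choosing a subtree with probability
  proportional to its number of external nodes, which depends on its size only, and then uniformly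
  inside it (\<open>subtrees_of_bary_tree\<close>).  The weights split in the same way
  (\<open>distr_join_weights\<close>).  With the pathwise decomposition of Wiener index and path length
  (\<open>rescaled_recursion\<close>) this gives the recursion in law.

  The coefficient matrices have common left eigenvectors: the recursion is scalar for the rescaled
  path length \<open>X\<^sub>2\<close>, with coefficients \<open>k i / n\<close>, and for \<open>X\<^sub>2 - X\<^sub>1\<close>, with coefficients
  \<open>(k i / n)\<^sup>2\<close>.  The latter is a rescaling of the centred sum over all edges of the weight times the
  square of the number of nodes below the edge.  The tolls of both scalar recursions are bounded.
  The mean path length is additive over subtrees up to \<open>O(n)\<close>, because its quotient by the number
  of external nodes increases in \<open>n\<close> by increments of order \<open>1 / n\<close> and the numbers of external
  nodes add up (\<open>mean_depth_sum_split\<close>); the mean of the sum over squares is \<open>O(n\<^sup>2)\<close>, because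
  a split decreases the sum of squared sizes by a positive fraction on average
  (\<open>square_mean_bound\<close>).

  For each of the two scalars, \<open>E exp (l X) \<le> exp (K l\<^sup>2)\<close> for \<open>\<bar>l\<bar> \<le> L\<close> follows by induction,
  with \<open>K\<close> depending on \<open>L\<close> (\<open>exponential_moment\<close>).  The step requires
  \<open>E exp (l \<delta> - K l\<^sup>2 G) \<le> 1\<close>, where \<open>\<delta>\<close> is the centred bounded toll and
  \<open>G = 1 - (\<Sum>i. (k i / n)\<^sup>2)\<close>.  It holds with \<open>K\<close> growing exponentially in \<open>L\<close>
  (\<open>toll_compensation\<close>), since \<open>E exp (- y G) = O(1 / sqrt y)\<close> uniformly in \<open>n\<close>
  (\<open>laplace_split_spread\<close>).  The latter comes from a negative moment of the number of nodes
  outside one subtree, which is a product along the growth of the tree.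

  Hence the logarithm of \<open>E exp (l X\<^sub>j)\<close> is at most \<open>c l\<^sup>2 exp (c' l)\<close> for both components and
  both signs.  By Chernoff's inequality the tails are Gaussian for bounded \<open>t\<close> and of the order
  \<open>exp (- const t ln t)\<close> for large \<open>t\<close>; with \<open>D\<close> large enough they lie below the piecewise
  bound, whose linear pieces are tangents to its Gaussian pieces (\<open>tail_bound_dominates\<close>).
\<close>

section \<open>Distances in the infinite tree\<close>

abbreviation (input) subtree_weights :: "('b list \<Rightarrow> 'c) \<Rightarrow> 'b \<Rightarrow> 'b list \<Rightarrow> 'c" where
  "subtree_weights z i \<equiv> \<lambda>u. z (i # u)"

lemma node_dist_path:
  "simple_path u v xs \<Longrightarrow> node_dist z u v = path_weight z xs"
  unfolding node_dist_def
  by (metis simple_path_unique theI)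

lemma path_weight_singleton [simp]: "path_weight z [x] = 0"
  by (simp add: path_weight_def)

lemma path_weight_Cons2 [simp]:
  "path_weight z (x # y # xs) = edge_weight z x y + path_weight z (y # xs)"
proof -
  have "path_weight z (x # y # xs)
      = (\<Sum>k<Suc (length xs). edge_weight z ((x # y # xs) ! k) ((x # y # xs) ! Suc k))"
    by (simp add: path_weight_def)
  also have "\<dots> = edge_weight z x y + path_weight z (y # xs)"
    by (subst sum.lessThan_Suc_shift) (simp add: path_weight_def)
  finally show ?thesis .
qed

text \<open>Both parts keep the node \<open>y\<close> at which the path is cut, as weights belong to edges.\<close>

lemma path_weight_join:
  "path_weight z (xs @ y # ys) = path_weight z (xs @ [y]) + path_weight z (y # ys)"
proof (induction xs)
  case (Cons x xs) then show ?case by (cases xs) auto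
qed simp

lemma edge_weight_sym: "adjacent u v \<Longrightarrow> edge_weight z u v = edge_weight z v u"
  unfolding adjacent_def edge_weight_def by (elim disjE exE) simp_all

lemma path_weight_rev:
  "successively adjacent xs \<Longrightarrow> path_weight z (rev xs) = path_weight z xs"
proof (induction xs)
  case Nil show ?case by (simp add: path_weight_def)
next
  case (Cons x xs)
  show ?case
  proof (cases xs)
    case (Cons y ys)
    have "path_weight z (rev (x # xs)) = path_weight z (rev ys @ y # [x])"
      by (simp add: Cons)
    also have "\<dots> = path_weight z (rev xs) + edge_weight z y x"
      by (subst path_weight_join) (simp add: Cons)
    finally show ?thesis
      using Cons.IH Cons.prems Cons by (simp add: edge_weight_sym[of x y])
  qed simp
qed

lemma simple_path_rev:
  assumes "simple_path u v xs"
  shows "simple_path v u (rev xs)"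
proof -
  have "successively (\<lambda>x y. adjacent y x) xs"
    using assms by (subst adjacent_sym) (simp add: simple_path_def)
  then show ?thesis
    using assms by (simp add: simple_path_def hd_rev last_rev)
qed

lemma node_dist_sym: "node_dist z u v = node_dist z v u"
proof -
  obtain xs where xs: "simple_path u v xs" using simple_path_exists by blast
  then have "path_weight z (rev xs) = path_weight z xs"
    by (intro path_weight_rev) (simp add: simple_path_def)
  then show ?thesis
    using node_dist_path[OF xs, of z] node_dist_path[OF simple_path_rev[OF xs], of z] by simp
qed

lemma adjacent_Cons_label: "adjacent (i # u) (i # v) \<longleftrightarrow> adjacent u v"
  by (simp add: adjacent_def)

lemma simple_path_Cons_label:
  assumes "simple_path u v xs"
  shows "simple_path (i # u) (i # v) (map ((#) i) xs)"
  using assms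
  by (simp add: simple_path_def hd_map last_map distinct_map successively_map adjacent_Cons_label)

lemma path_weight_Cons_label:
  "successively adjacent xs \<Longrightarrow>
     path_weight z (map ((#) i) xs) = path_weight (subtree_weights z i) xs"
proof (induction xs)
  case Nil show ?case by (simp add: path_weight_def)
next
  case (Cons x xs)
  show ?case
  proof (cases xs)
    case (Cons y ys)
    then have "adjacent x y" using Cons.prems by simp
    then have "edge_weight z (i # x) (i # y) = edge_weight (subtree_weights z i) x y"
      unfolding adjacent_def edge_weight_def by (elim disjE exE) simp_all
    then show ?thesis using Cons.IH Cons.prems Cons by simp
  qed simp
qed

lemma node_dist_same_subtree:
  "node_dist z (i # u) (i # v) = node_dist (subtree_weights z i) u v"
proof -
  obtain xs where xs: "simple_path u v xs" using simple_path_exists by blast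
  have "successively adjacent xs" using xs by (simp add: simple_path_def)
  then show ?thesis
    using node_dist_path[OF xs] node_dist_path[OF simple_path_Cons_label[OF xs]]
    by (simp add: path_weight_Cons_label)
qed

lemma simple_path_from_root:
  assumes "simple_path [] u xs"
  shows "simple_path [] (i # u) ([] # map ((#) i) xs)"
  using simple_path_Cons_label[OF assms, of i] assms
  by (auto simp: simple_path_def successively_Cons hd_map adjacent_def)

lemma node_depth_Nil [simp]: "node_depth z [] = 0"
  unfolding node_depth_def
  by (subst node_dist_path[of _ _ "[[]]"]) (auto simp: simple_path_def)

lemma node_depth_Cons:
  "node_depth z (i # u) = z [] $ i + node_depth (subtree_weights z i) u"
proof -
  obtain xs where xs: "simple_path [] u xs" using simple_path_exists by blast
  have s: "successively adjacent xs" using xs by (simp add: simple_path_def)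
  obtain ys where ys: "xs = [] # ys"
    using xs by (cases xs) (auto simp: simple_path_def)
  show ?thesis
    unfolding node_depth_def
    using node_dist_path[OF simple_path_from_root[OF xs], of z i] node_dist_path[OF xs]
      path_weight_Cons_label[OF s, of z i]
    by (simp add: ys edge_weight_def)
qed

lemma node_dist_Nil: "node_dist z [] u = node_depth z u" "node_dist z u [] = node_depth z u"
  by (simp_all add: node_depth_def node_dist_sym)

text \<open>
  The two paths from the root leave it through different children, so that the reverse of one
  followed by the other is simple.
\<close>

lemma node_dist_different_subtrees:
  assumes "i \<noteq> j"
  shows "node_dist z (i # u) (j # v) = node_depth z (i # u) + node_depth z (j # v)"
proof -
  obtain xs where xs: "simple_path [] u xs" using simple_path_exists by blast
  obtain ys where ys: "simple_path [] v ys" using simple_path_exists by blast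
  let ?X = "map ((#) i) xs" and ?Y = "map ((#) j) ys"
  have X: "simple_path [] (i # u) ([] # ?X)" and Y: "simple_path [] (j # v) ([] # ?Y)"
    by (rule simple_path_from_root[OF xs], rule simple_path_from_root[OF ys])
  have R: "simple_path (i # u) [] (rev ([] # ?X))"
    using simple_path_rev[OF X] .
  have ne: "xs \<noteq> []" "ys \<noteq> []"
    using xs ys by (simp_all add: simple_path_def)
  have "successively adjacent (rev ?X @ [[]])" "successively adjacent ([] # ?Y)"
    using R Y by (simp_all only: simple_path_def rev.simps)
  then have "successively adjacent (rev ?X @ [] # ?Y)"
    by (simp only: successively_append_iff list.sel) simp
  moreover have "distinct (rev ?X @ [] # ?Y)"
    using X Y assms by (auto simp only: simple_path_def distinct_append distinct_rev set_rev
        distinct.simps set_map list.set)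
  moreover have "hd (rev ?X @ [] # ?Y) = i # u" "last (rev ?X @ [] # ?Y) = j # v"
    using X Y ne by (simp_all add: simple_path_def hd_rev)
  ultimately have "simple_path (i # u) (j # v) (rev ?X @ [] # ?Y)"
    by (simp add: simple_path_def)
  then have "node_dist z (i # u) (j # v) = path_weight z (rev ([] # ?X)) + path_weight z ([] # ?Y)"
    by (simp only: node_dist_path path_weight_join[of z "rev ?X" "[]" ?Y] rev.simps)
  also have "path_weight z (rev ([] # ?X)) = path_weight z ([] # ?X)"
    using X by (intro path_weight_rev) (simp add: simple_path_def)
  finally show ?thesis
    using node_dist_path[OF X, of z] node_dist_path[OF Y, of z] by (simp add: node_depth_def)
qed

section \<open>Decomposition at the root\<close>

definition subtree :: "'b list set \<Rightarrow> 'b \<Rightarrow> 'b list set" where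
  "subtree S i = {v. i # v \<in> S}"

lemma subtree_sizes_eq: "subtree_sizes S = (\<lambda>i. card (subtree S i))"
  by (auto simp: subtree_sizes_def subtree_def)

lemma finite_subtree [simp]: "finite S \<Longrightarrow> finite (subtree S i)"
  unfolding subtree_def by (rule finite_vimageI[of S "(#) i", unfolded vimage_def]) auto

lemma sum_root_decomposition:
  fixes f :: "'b::finite list \<Rightarrow> 'c::comm_monoid_add"
  assumes "finite S" "[] \<in> S"
  shows "sum f S = f [] + (\<Sum>i\<in>UNIV. \<Sum>v\<in>subtree S i. f (i # v))"
proof -
  have S: "S = insert [] (\<Union>i. (#) i ` subtree S i)"
  proof (intro set_eqI iffI)
    fix v assume "v \<in> S"
    then show "v \<in> insert [] (\<Union>i. (#) i ` subtree S i)"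
      by (cases v) (auto simp: subtree_def)
  qed (use assms in \<open>auto simp: subtree_def\<close>)
  have "sum f S = f [] + sum f (\<Union>i. (#) i ` subtree S i)"
    by (subst S, subst sum.insert) (use assms in auto)
  also have "sum f (\<Union>i. (#) i ` subtree S i) = (\<Sum>i\<in>UNIV. sum f ((#) i ` subtree S i))"
    by (rule sum.UNION_disjoint) (use assms in auto)
  also have "\<dots> = (\<Sum>i\<in>UNIV. \<Sum>v\<in>subtree S i. f (i # v))"
    by (intro sum.cong refl sum.reindex[unfolded o_def]) (auto simp: inj_on_def)
  finally show ?thesis .
qed

lemma card_root_decomposition:
  fixes S :: "'b::finite list set"
  assumes "finite S" "[] \<in> S"
  shows "card S = 1 + (\<Sum>i\<in>UNIV. subtree_sizes S i)"
  using sum_root_decomposition[OF assms, of "\<lambda>_. 1::nat"] by (simp add: subtree_sizes_eq)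

lemma internal_path_length_root:
  fixes S :: "'b::finite list set"
  assumes "finite S" "[] \<in> S"
  shows "internal_path_length z S = (\<Sum>i\<in>UNIV.
    internal_path_length (subtree_weights z i) (subtree S i) + z [] $ i * real (subtree_sizes S i))"
  unfolding internal_path_length_def sum_root_decomposition[OF assms] node_depth_Cons
  by (simp add: sum.distrib subtree_sizes_eq mult.commute)

text \<open>
  A pair of nodes in different subtrees contributes the sum of their depths.  Hence the depth of a
  node of the \<open>i\<close>-th subtree is counted once for each of the \<open>n - k i\<close> nodes outside that subtree;
  the root is one of them.
\<close>

lemma wiener_index_root:
  fixes S :: "'b::finite list set"
  assumes "finite S" "[] \<in> S"
  defines "n \<equiv> real (card S)"
  shows "wiener_index z S = (\<Sum>i\<in>UNIV. wiener_index (subtree_weights z i) (subtree S i)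
    + (n - real (subtree_sizes S i)) * internal_path_length (subtree_weights z i) (subtree S i)
    + z [] $ i * real (subtree_sizes S i) * (n - real (subtree_sizes S i)))"
proof -
  define k where "k i = real (subtree_sizes S i)" for i
  \<comment> \<open>sum of the depths, measured from the root of the whole tree, over the \<open>i\<close>-th subtree\<close>
  define Q where "Q i = (\<Sum>v\<in>subtree S i. node_depth z (i # v))" for i
  have Q: "Q i = internal_path_length (subtree_weights z i) (subtree S i) + z [] $ i * k i" for i
    by (simp add: Q_def internal_path_length_def node_depth_Cons sum.distrib k_def subtree_sizes_eq
        mult.commute)
  have kc: "real (card (subtree S i)) = k i" for i by (simp add: k_def subtree_sizes_eq)
  have k: "(\<Sum>i\<in>UNIV. k i) = n - 1"
    using card_root_decomposition[OF assms(1,2)] by (simp add: n_def k_def)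
  have cross: "(\<Sum>u\<in>subtree S i. \<Sum>v\<in>subtree S j. node_dist z (i # u) (j # v)) =
     k j * Q i + k i * Q j - (if i = j
       then 2 * (k i * Q i - wiener_index (subtree_weights z i) (subtree S i)) else 0)" for i j
  proof (cases "i = j")
    case True
    then show ?thesis
      by (simp add: node_dist_same_subtree wiener_index_def)
  next
    case False
    then show ?thesis
      by (simp add: node_dist_different_subtrees sum.distrib Q_def[symmetric] kc
        sum_distrib_left[symmetric])
  qed
  have "2 * wiener_index z S = (\<Sum>v\<in>S. node_depth z v) + (\<Sum>i\<in>UNIV. \<Sum>u\<in>subtree S i.
      node_depth z (i # u) + (\<Sum>j\<in>UNIV. \<Sum>v\<in>subtree S j. node_dist z (i # u) (j # v)))"
    unfolding wiener_index_def
    by (subst (1 2) sum_root_decomposition[OF assms(1,2)])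
       (simp add: node_dist_Nil sum_root_decomposition[OF assms(1,2)])
  also have "\<dots> = 2 * (\<Sum>i\<in>UNIV. Q i) + (\<Sum>i\<in>UNIV. \<Sum>j\<in>UNIV. \<Sum>u\<in>subtree S i. \<Sum>v\<in>subtree S j.
      node_dist z (i # u) (j # v))"
    by (simp add: sum_root_decomposition[OF assms(1,2)] sum.distrib Q_def sum.swap[of _ _ UNIV])
  also have "\<dots> = 2 * (\<Sum>i\<in>UNIV. Q i) + 2 * ((n - 1) * (\<Sum>i\<in>UNIV. Q i))
     - 2 * (\<Sum>i\<in>UNIV. k i * Q i - wiener_index (subtree_weights z i) (subtree S i))"
  proof -
    have "(\<Sum>i\<in>UNIV. \<Sum>j\<in>UNIV. k j * Q i + k i * Q j) = 2 * ((n - 1) * (\<Sum>i\<in>UNIV. Q i))"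
      by (simp add: sum.distrib sum_distrib_left[symmetric] sum_distrib_right[symmetric] k)
    then show ?thesis
      by (simp add: cross sum_subtractf sum_distrib_left[symmetric])
  qed
  finally have "wiener_index z S
      = (\<Sum>i\<in>UNIV. wiener_index (subtree_weights z i) (subtree S i) + (n - k i) * Q i)"
    by (simp add: sum_subtractf sum.distrib sum_distrib_left[symmetric] algebra_simps)
  then show ?thesis
    by (simp add: Q k_def algebra_simps)
qed

section \<open>The subtrees of the root\<close>

text \<open>
  A node set is tree-like if it is finite and closed under taking parents; a subtree of the root
  may be empty.  The empty tree grows into the tree with one node, so that \<open>grow\<close> is the step of
  the tree process for subtrees as well.
\<close>

definition tree_like :: "'b list set \<Rightarrow> bool" where
  "tree_like S \<longleftrightarrow> finite S \<and> (\<forall>u i. u @ [i] \<in> S \<longrightarrow> u \<in> S)"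

definition insertion_nodes :: "'b list set \<Rightarrow> 'b list set" where
  "insertion_nodes S = (if S = {} then {[]} else external_nodes S)"

definition grow :: "'b::finite list set \<Rightarrow> 'b list set pmf" where
  "grow S = map_pmf (\<lambda>v. insert v S) (pmf_of_set (insertion_nodes S))"

lemma tree_like_root: "tree_like S \<Longrightarrow> [] \<in> S \<longleftrightarrow> S \<noteq> {}"
proof -
  assume S: "tree_like S"
  have "u \<in> S \<Longrightarrow> [] \<in> S" for u
    by (induction u rule: rev_induct) (use S in \<open>auto simp: tree_like_def\<close>)
  then show ?thesis by auto
qed

lemma tree_like_subtree: "tree_like S \<Longrightarrow> tree_like (subtree S i)"
  unfolding tree_like_def by (auto simp: subtree_def[of S i] simp flip: append_Cons)
     (metis finite_subtree subtree_def)

lemma tree_like_insert: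
  assumes "tree_like S" "v \<in> insertion_nodes S"
  shows "tree_like (insert v S)" "v \<notin> S"
  using assms by (auto simp: tree_like_def insertion_nodes_def external_nodes_def split: if_splits)

lemma external_nodes_eq:
  assumes "tree_like S"
  shows "external_nodes S = (\<lambda>(u, i). u @ [i]) ` (S \<times> UNIV) - (S - {[]})"
  using assms by (auto simp: external_nodes_def tree_like_def image_iff)

lemma finite_insertion_nodes: "finite S \<Longrightarrow> finite (insertion_nodes (S :: 'b::finite list set))"
proof -
  assume "finite S"
  then have "finite ((\<lambda>(u, i). u @ [i]) ` (S \<times> (UNIV :: 'b set)))" by simp
  moreover have "external_nodes S \<subseteq> (\<lambda>(u, i). u @ [i]) ` (S \<times> UNIV)"
    by (auto simp: external_nodes_def)
  ultimately show ?thesis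
    by (auto simp: insertion_nodes_def intro: finite_subset)
qed

text \<open>Each node has \<open>b\<close> children, and all nodes but the root are children of nodes.\<close>

lemma sum_external_nodes:
  fixes S :: "'b::finite list set" and f :: "'b list \<Rightarrow> real"
  assumes "tree_like S" "S \<noteq> {}"
  shows "sum f (external_nodes S) = (\<Sum>u\<in>S. \<Sum>i\<in>UNIV. f (u @ [i])) - (sum f S - f [])"
proof -
  have fin: "finite S" and root: "[] \<in> S"
    using assms tree_like_root by (auto simp: tree_like_def)
  have "S - {[]} \<subseteq> (\<lambda>(u, i). u @ [i]) ` (S \<times> UNIV)"
  proof
    fix v assume v: "v \<in> S - {[]}"
    then have "v = butlast v @ [last v]" by simp
    moreover from this v have "butlast v \<in> S"
      using assms(1) unfolding tree_like_def by (metis DiffD1)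
    ultimately show "v \<in> (\<lambda>(u, i). u @ [i]) ` (S \<times> UNIV)" by force
  qed
  then have "sum f (external_nodes S)
      = sum f ((\<lambda>(u, i). u @ [i]) ` (S \<times> UNIV)) - sum f (S - {[]})"
    unfolding external_nodes_eq[OF assms(1)] using fin by (intro sum_diff) auto
  also have "sum f ((\<lambda>(u, i). u @ [i]) ` (S \<times> UNIV)) = (\<Sum>u\<in>S. \<Sum>i\<in>UNIV. f (u @ [i]))"
    by (subst sum.reindex) (auto simp: inj_on_def sum.cartesian_product o_def case_prod_beta)
  finally show ?thesis
    using fin root by (simp add: sum_diff1)
qed

lemma card_insertion_nodes:
  fixes S :: "'b::finite list set"
  assumes "tree_like S"
  shows "real (card (insertion_nodes S)) = (real CARD('b) - 1) * real (card S) + 1"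
  using sum_external_nodes[OF assms, of "\<lambda>_. 1"]
  by (auto simp: insertion_nodes_def algebra_simps)

lemma insertion_nodes_nonempty:
  fixes S :: "'b::finite list set"
  assumes "tree_like S"
  shows "insertion_nodes S \<noteq> {}"
proof -
  have "1 \<le> real CARD('b)" by (simp add: Suc_leI)
  then have "real (card (insertion_nodes S)) \<noteq> 0"
    unfolding card_insertion_nodes[OF assms]
    by (metis add_nonneg_pos diff_ge_0_iff_ge less_irrefl mult_nonneg_nonneg of_nat_0_le_iff zero_less_one)
  then show ?thesis by (metis card.empty of_nat_0)
qed

lemma set_pmf_grow:
  fixes S :: "'b::finite list set"
  assumes "tree_like S"
  shows "set_pmf (grow S) = (\<lambda>v. insert v S) ` insertion_nodes S"
  unfolding grow_def using assms
  by (simp add: set_pmf_of_set insertion_nodes_nonempty finite_insertion_nodes tree_like_def)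

text \<open>
  The two statements need a joint induction: \<open>grow\<close> agrees with the defining step of
  \<^const>\<open>bary_tree\<close> on nonempty sets only.
\<close>

lemma bary_tree_Suc_and_support:
  fixes S :: "'b::finite list set"
  shows "bary_tree (Suc n) = bind_pmf (bary_tree n) (grow :: 'b list set \<Rightarrow> _)
    \<and> (S \<in> set_pmf (bary_tree n) \<longrightarrow> tree_like S \<and> card S = n)"
proof (induction n arbitrary: S)
  case 0
  show ?case
    by (auto simp: bind_return_pmf grow_def insertion_nodes_def tree_like_def pmf_of_set_singleton)
next
  case (Suc n)
  have *: "tree_like S \<and> card S = Suc n" if S: "S \<in> set_pmf (bary_tree (Suc n))"
    for S :: "'b list set"
  proof -
    obtain S' where S': "S' \<in> set_pmf (bary_tree n)" "S \<in> set_pmf (grow S')"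
      using Suc.IH S by auto
    then have t: "tree_like S'" "card S' = n" using Suc.IH by auto
    then obtain v where v: "v \<in> insertion_nodes S'" "S = insert v S'"
      using set_pmf_grow S' by blast
    show ?thesis using tree_like_insert[OF t(1) v(1)] v(2) t by (auto simp: tree_like_def)
  qed
  have "bary_tree (Suc (Suc n)) = bind_pmf (bary_tree (Suc n)) (grow :: 'b list set \<Rightarrow> _)"
    unfolding bary_tree.simps(3)
  proof (rule bind_pmf_cong[OF refl])
    fix S :: "'b list set" assume "S \<in> set_pmf (bary_tree (Suc n))"
    then have "card S = Suc n" using * by blast
    then have "S \<noteq> {}" by auto
    then show "map_pmf (\<lambda>v. insert v S) (pmf_of_set (external_nodes S)) = grow S"
      by (simp add: grow_def insertion_nodes_def)
  qed
  then show ?case using * by blast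
qed

lemma bary_tree_Suc: "bary_tree (Suc n) = bind_pmf (bary_tree n) grow"
  using bary_tree_Suc_and_support by blast

lemma
  assumes "S \<in> set_pmf (bary_tree n)"
  shows bary_tree_tree_like: "tree_like S" and bary_tree_card: "card S = n"
    and bary_tree_finite: "finite S"
  using bary_tree_Suc_and_support assms by (auto simp: tree_like_def)

lemma bary_tree_root: "S \<in> set_pmf (bary_tree n) \<Longrightarrow> n \<ge> 1 \<Longrightarrow> [] \<in> S"
  using bary_tree_tree_like bary_tree_card tree_like_root by fastforce

lemma finite_support_bary_tree: "finite (set_pmf (bary_tree n))"
proof (induction n)
  case (Suc n)
  have "finite (set_pmf (grow S))" if "S \<in> set_pmf (bary_tree n)" for S :: "'a list set"
    unfolding set_pmf_grow[OF bary_tree_tree_like[OF that]]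
    by (intro finite_imageI finite_insertion_nodes bary_tree_finite[OF that])
  then show ?case unfolding bary_tree_Suc using Suc by simp
qed simp

lemma sum_subtree_sizes:
  fixes S :: "'b::finite list set"
  assumes "S \<in> set_pmf (bary_tree (Suc n))"
  shows "(\<Sum>i\<in>UNIV. subtree_sizes S i) = n"
  using card_root_decomposition[of S] bary_tree_finite[OF assms] bary_tree_root[OF assms]
    bary_tree_card[OF assms] by simp

text \<open>
  Uniform choice of an insertion node amounts to a choice of a subtree, with probability
  proportional to its number of insertion nodes, and a uniform choice there.  The former depends
  on the subtree sizes only, which is why the subtrees are independent given their sizes.
\<close>

definition branch_weight :: "('b::finite \<Rightarrow> nat) \<Rightarrow> 'b \<Rightarrow> real" where
  "branch_weight k i = ((real CARD('b) - 1) * real (k i) + 1)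
     / ((real CARD('b) - 1) * (real (\<Sum>j\<in>UNIV. k j) + 1) + 1)"

definition branch :: "('b::finite \<Rightarrow> nat) \<Rightarrow> 'b pmf" where
  "branch k = embed_pmf (branch_weight k)"

lemma card_UNIV_ge_1: "1 \<le> real CARD('b::finite)"
  by (simp add: Suc_leI)

lemma branch_denominator_pos: "0 < (real CARD('b::finite) - 1) * (real n + 1) + 1"
  using card_UNIV_ge_1[where 'b='b]
  by (metis add_nonneg_pos add_nonneg_nonneg diff_ge_0_iff_ge mult_nonneg_nonneg of_nat_0_le_iff
      zero_le_one zero_less_one)

lemma pmf_branch: "pmf (branch (k :: 'b::finite \<Rightarrow> nat)) i = branch_weight k i"
proof -
  have num: "0 \<le> (real CARD('b) - 1) * real m + 1" for m
    using card_UNIV_ge_1[where 'b='b] by simp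
  have nn: "branch_weight k i \<ge> 0" for i
    unfolding branch_weight_def
    using num[of "k i"] branch_denominator_pos[where 'b='b, of "\<Sum>j\<in>UNIV. k j"]
    by (intro divide_nonneg_pos) auto
  have "(\<Sum>i\<in>UNIV. branch_weight k i) = 1"
  proof -
    have "(\<Sum>i\<in>UNIV. (real CARD('b) - 1) * real (k i) + 1)
        = (real CARD('b) - 1) * (real (\<Sum>j\<in>UNIV. k j) + 1) + 1"
      by (simp only: sum.distrib sum_distrib_left[symmetric]) (simp add: algebra_simps)
    then show ?thesis
      unfolding branch_weight_def sum_divide_distrib[symmetric]
      using branch_denominator_pos[where 'b='b, of "\<Sum>j\<in>UNIV. k j"] by simp
  qed
  then have "(\<integral>\<^sup>+ i. ennreal (branch_weight k i) \<partial>count_space UNIV) = 1"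
    by (simp add: nn_integral_count_space_finite sum_ennreal nn)
  then show ?thesis
    unfolding branch_def by (intro pmf_embed_pmf nn)
qed

lemma insertion_nodes_subtree:
  assumes "tree_like S" "[] \<in> S"
  shows "i # v \<in> external_nodes S \<longleftrightarrow> v \<in> insertion_nodes (subtree S i)"
proof -
  have t: "tree_like (subtree S i)" by (rule tree_like_subtree[OF assms(1)])
  have *: "i # v \<in> external_nodes S \<longleftrightarrow>
      (v = [] \<or> (\<exists>w j. v = w @ [j] \<and> w \<in> subtree S i)) \<and> v \<notin> subtree S i"
  proof (cases v rule: rev_cases)
    case Nil
    then show ?thesis using assms(2) by (force simp: external_nodes_def subtree_def)
  next
    case (snoc w j)
    have "(\<exists>u j'. i # w @ [j] = u @ [j'] \<and> u \<in> S) \<longleftrightarrow> i # w \<in> S"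
      by (metis append1_eq_conv append_Cons)
    then show ?thesis by (simp add: snoc external_nodes_def subtree_def)
  qed
  show ?thesis
  proof (cases "subtree S i = {}")
    case True
    then show ?thesis unfolding * by (simp add: insertion_nodes_def)
  next
    case False
    then have "[] \<in> subtree S i" using tree_like_root[OF t] by simp
    then have "i # v \<in> external_nodes S \<longleftrightarrow> v \<in> external_nodes (subtree S i)"
      unfolding * unfolding external_nodes_def by blast
    then show ?thesis using False by (simp add: insertion_nodes_def)
  qed
qed

lemma uniform_external_node:
  fixes S :: "'b::finite list set"
  assumes "tree_like S" "[] \<in> S"
  shows "pmf_of_set (external_nodes S) = bind_pmf (branch (subtree_sizes S))
    (\<lambda>i. map_pmf ((#) i) (pmf_of_set (insertion_nodes (subtree S i))))"
proof (rule pmf_eqI)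
  fix v
  have ne: "S \<noteq> {}" using assms by auto
  have ext: "external_nodes S = insertion_nodes S" using ne by (simp add: insertion_nodes_def)
  have fin: "finite S" using assms by (simp add: tree_like_def)
  have sub: "tree_like (subtree S i)" for i by (rule tree_like_subtree[OF assms(1)])
  have subf: "finite (subtree S i)" for i using fin by simp
  have card: "real (card S) = real (\<Sum>j\<in>UNIV. subtree_sizes S j) + 1"
    using card_root_decomposition[OF fin assms(2)] by simp
  have bind: "pmf (bind_pmf (branch (subtree_sizes S))
      (\<lambda>i. map_pmf ((#) i) (pmf_of_set (insertion_nodes (subtree S i))))) v
    = (\<Sum>i\<in>UNIV. branch_weight (subtree_sizes S) i *
         pmf (map_pmf ((#) i) (pmf_of_set (insertion_nodes (subtree S i)))) v)"
    unfolding pmf_bind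
    by (subst integral_measure_pmf_real[of UNIV]) (auto simp: pmf_branch mult.commute)
  show "pmf (pmf_of_set (external_nodes S)) v = pmf (bind_pmf (branch (subtree_sizes S))
      (\<lambda>i. map_pmf ((#) i) (pmf_of_set (insertion_nodes (subtree S i))))) v"
  proof (cases v)
    case Nil
    have "[] \<notin> external_nodes S" by (simp add: external_nodes_def)
    moreover have "pmf (map_pmf ((#) i) p) [] = 0" for i :: 'b and p
      by (auto simp: pmf_eq_0_set_pmf)
    ultimately show ?thesis
      unfolding bind unfolding Nil
      using insertion_nodes_nonempty[OF assms(1)] finite_insertion_nodes[OF fin]
      by (simp add: ext pmf_of_set)
  next
    case (Cons i w)
    have j: "pmf (map_pmf ((#) j) p) (i # w) = (if j = i then pmf p w else 0)" for j :: 'b and p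
      by (auto simp: pmf_eq_0_set_pmf intro!: pmf_map_inj' inj_onI)
    have "pmf (pmf_of_set (external_nodes S)) v
        = indicator (insertion_nodes (subtree S i)) w / real (card (insertion_nodes S))"
      using insertion_nodes_nonempty[OF assms(1)] finite_insertion_nodes[OF fin]
        insertion_nodes_subtree[OF assms, of i w]
      by (simp add: ext pmf_of_set Cons indicator_def)
    also have "\<dots> = branch_weight (subtree_sizes S) i *
        pmf (pmf_of_set (insertion_nodes (subtree S i))) w"
    proof -
      have "real (card (insertion_nodes (subtree S i)))
          = (real CARD('b) - 1) * real (subtree_sizes S i) + 1"
        using card_insertion_nodes[OF sub] by (simp add: subtree_sizes_eq)
      moreover have "real (card (insertion_nodes (subtree S i))) \<noteq> 0"
        using insertion_nodes_nonempty[OF sub] finite_insertion_nodes[OF subf] by simp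
      ultimately show ?thesis
        using insertion_nodes_nonempty[OF sub] finite_insertion_nodes[OF subf]
        by (simp add: pmf_of_set card_insertion_nodes[OF assms(1)] branch_weight_def card)
    qed
    finally show ?thesis
      unfolding bind unfolding Cons j by (simp add: if_distrib[of "\<lambda>x. _ * x"] cong: if_cong)
  qed
qed

text \<open>Time counts the nodes other than the root, so that at time \<open>n\<close> the tree has size \<open>n + 1\<close>.\<close>

fun sizes_chain :: "nat \<Rightarrow> ('b::finite \<Rightarrow> nat) pmf" where
  "sizes_chain 0 = return_pmf (\<lambda>_. 0)"
| "sizes_chain (Suc n) =
     bind_pmf (sizes_chain n) (\<lambda>k. map_pmf (\<lambda>i. k(i := Suc (k i))) (branch k))"

lemma Pi_pmf_modify_one:
  "Pi_pmf UNIV d (p(i := bind_pmf (p i) q)) =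
     bind_pmf (Pi_pmf UNIV d p) (\<lambda>s. map_pmf (\<lambda>t. s(i := t)) (q (s i)))"
  for p :: "'b::finite \<Rightarrow> 'c pmf"
proof -
  have one: "Pi_pmf UNIV d (\<lambda>j. (if j = i then q else return_pmf) (s j))
      = map_pmf (\<lambda>t. s(i := t)) (q (s i))" for s
  proof -
    have U: "UNIV = insert i (UNIV - {i})" by auto
    have "Pi_pmf (UNIV - {i}) d (\<lambda>j. (if j = i then q else return_pmf) (s j))
        = Pi_pmf (UNIV - {i}) d (\<lambda>j. return_pmf (s j))"
      by (intro Pi_pmf_cong) auto
    then show ?thesis
      by (subst U, subst Pi_pmf_insert')
         (auto simp: bind_return_pmf map_pmf_def fun_upd_def fun_eq_iff intro!: bind_pmf_cong)
  qed
  have "p(i := bind_pmf (p i) q)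
      = (\<lambda>j. bind_pmf (p j) (if j = i then q else return_pmf))"
    by (auto simp: bind_return_pmf')
  then show ?thesis
    by (simp only: Pi_pmf_bind[OF finite, of _ _ _ _ d] one)
qed

lemma subtree_insert: "subtree (insert (i # v) S) = (subtree S)(i := insert v (subtree S i))"
  by (auto simp: subtree_def fun_eq_iff)

text \<open>
  One step of the tree process picks the subtree that grows by a rule depending on the sizes only,
  and then performs a step of the same process there.  This preserves independence given the
  sizes.
\<close>

theorem subtrees_of_bary_tree:
  "map_pmf subtree (bary_tree (Suc n) :: 'b::finite list set pmf) =
     bind_pmf (sizes_chain n) (\<lambda>k. Pi_pmf UNIV {} (\<lambda>i. bary_tree (k i)))"
proof (induction n)
  case 0
  have "subtree {[]} = (\<lambda>_ :: 'b. {})" by (auto simp: subtree_def)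
  then show ?case by (simp add: bind_return_pmf)
next
  case (Suc n)
  define G where "G s = bind_pmf (branch (\<lambda>i. card (s i)))
    (\<lambda>i. map_pmf (\<lambda>t. s(i := t)) (grow (s i)))" for s :: "'b \<Rightarrow> 'b list set"
  have G: "map_pmf subtree (grow S) = G (subtree S)"
    if "S \<in> set_pmf (bary_tree (Suc n))" for S :: "'b list set"
  proof -
    have t: "tree_like S" "[] \<in> S" using bary_tree_tree_like bary_tree_root that by auto
    then have "grow S = map_pmf (\<lambda>v. insert v S) (pmf_of_set (external_nodes S))"
      by (auto simp: grow_def insertion_nodes_def)
    then show ?thesis
      by (simp add: uniform_external_node[OF t] G_def subtree_sizes_eq map_bind_pmf
          pmf.map_comp o_def subtree_insert grow_def)
  qed
  have "map_pmf subtree (bary_tree (Suc (Suc n)) :: 'b list set pmf)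
      = bind_pmf (bary_tree (Suc n)) (\<lambda>S. G (subtree S))"
    unfolding bary_tree_Suc[of "Suc n"] map_bind_pmf by (intro bind_pmf_cong refl G)
  also have "\<dots> = bind_pmf (map_pmf subtree (bary_tree (Suc n))) G"
    by (simp add: bind_map_pmf)
  also have "\<dots> = bind_pmf (sizes_chain n)
      (\<lambda>k. bind_pmf (Pi_pmf UNIV {} (\<lambda>i. bary_tree (k i))) G)"
    unfolding Suc by (simp add: bind_assoc_pmf)
  also have "\<dots> = bind_pmf (sizes_chain n) (\<lambda>k. bind_pmf (branch k)
      (\<lambda>i. Pi_pmf UNIV {} (\<lambda>j. bary_tree ((k(i := Suc (k i))) j))))"
  proof (rule bind_pmf_cong[OF refl])
    fix k :: "'b \<Rightarrow> nat"
    let ?Pi = "Pi_pmf UNIV {} (\<lambda>i. bary_tree (k i) :: 'b list set pmf)"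
    have "bind_pmf ?Pi G = bind_pmf ?Pi (\<lambda>s. bind_pmf (branch k)
        (\<lambda>i. map_pmf (\<lambda>t. s(i := t)) (grow (s i))))"
    proof (rule bind_pmf_cong[OF refl])
      fix s assume "s \<in> set_pmf ?Pi"
      then have "s i \<in> set_pmf (bary_tree (k i))" for i
        by (auto simp: set_Pi_pmf PiE_dflt_def)
      then have "(\<lambda>i. card (s i)) = k" using bary_tree_card by fastforce
      then show "G s = bind_pmf (branch k) (\<lambda>i. map_pmf (\<lambda>t. s(i := t)) (grow (s i)))"
        by (simp add: G_def)
    qed
    also have "\<dots> = bind_pmf (branch k)
        (\<lambda>i. bind_pmf ?Pi (\<lambda>s. map_pmf (\<lambda>t. s(i := t)) (grow (s i))))"
      by (rule bind_commute_pmf)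
    also have "\<dots> = bind_pmf (branch k)
        (\<lambda>i. Pi_pmf UNIV {} (\<lambda>j. bary_tree ((k(i := Suc (k i))) j)))"
    proof (rule bind_pmf_cong[OF refl])
      fix i
      have "(\<lambda>j. bary_tree ((k(i := Suc (k i))) j) :: 'b list set pmf)
          = (\<lambda>j. bary_tree (k j))(i := bind_pmf (bary_tree (k i)) grow)"
        by (auto simp: bary_tree_Suc)
      then show "bind_pmf ?Pi (\<lambda>s. map_pmf (\<lambda>t. s(i := t)) (grow (s i)))
          = Pi_pmf UNIV {} (\<lambda>j. bary_tree ((k(i := Suc (k i))) j))"
        by (simp only: Pi_pmf_modify_one[where p = "\<lambda>j. bary_tree (k j)"])
    qed
    finally show "bind_pmf ?Pi G = \<dots>" .
  qed
  also have "\<dots> = bind_pmf (sizes_chain (Suc n)) (\<lambda>k. Pi_pmf UNIV {} (\<lambda>i. bary_tree (k i)))"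
    by (simp add: bind_assoc_pmf bind_map_pmf)
  finally show ?case .
qed

lemma subtree_sizes_bary_tree:
  "map_pmf subtree_sizes (bary_tree (Suc n)) = (sizes_chain n :: ('b::finite \<Rightarrow> nat) pmf)"
proof -
  have "map_pmf subtree_sizes (bary_tree (Suc n))
      = map_pmf (\<lambda>s i. card (s i)) (map_pmf subtree (bary_tree (Suc n) :: 'b list set pmf))"
    by (simp add: pmf.map_comp o_def subtree_sizes_eq[abs_def])
  also have "\<dots> = bind_pmf (sizes_chain n)
      (\<lambda>k. map_pmf (\<lambda>s i. card (s i)) (Pi_pmf UNIV {} (\<lambda>i. bary_tree (k i) :: 'b list set pmf)))"
    by (simp add: subtrees_of_bary_tree map_bind_pmf)
  also have "\<dots> = bind_pmf (sizes_chain n) (\<lambda>k. map_pmf (\<lambda>_. k)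
      (Pi_pmf UNIV {} (\<lambda>i. bary_tree (k i) :: 'b list set pmf)))"
    by (intro bind_pmf_cong refl map_pmf_cong ext)
       (auto simp: set_Pi_pmf PiE_dflt_def bary_tree_card)
  also have "\<dots> = sizes_chain n"
    by (simp add: map_pmf_const bind_return_pmf')
  finally show ?thesis .
qed

lemma finite_support_sizes_chain: "finite (set_pmf (sizes_chain n))"
  unfolding subtree_sizes_bary_tree[symmetric] by (simp add: finite_support_bary_tree)

lemma sum_sizes_chain: "k \<in> set_pmf (sizes_chain n) \<Longrightarrow> (\<Sum>i\<in>UNIV. k i) = n"
  unfolding subtree_sizes_bary_tree[symmetric] using sum_subtree_sizes by fastforce

lemma sizes_chain_le: "k \<in> set_pmf (sizes_chain n) \<Longrightarrow> k i \<le> n"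
  using sum_sizes_chain[of k n] member_le_sum[of i UNIV k] by simp

section \<open>Negative moments of the split\<close>

text \<open>
  Let \<open>j\<close> be the number of nodes outside the \<open>i\<close>-th subtree of the root.  It grows by one with
  probability proportional to \<open>j\<close>.  The function below behaves like \<open>j\<close> to the power \<open>-1/2\<close> and
  is an eigenfunction of this growth, so that its mean is an explicit product.
\<close>

definition inv_sqrt_approx :: "nat \<Rightarrow> real" where
  "inv_sqrt_approx j = (\<Prod>m\<in>{1..<j}. 1 - 1 / (2 * real m))"

lemma inv_sqrt_approx_1 [simp]: "inv_sqrt_approx (Suc 0) = 1"
  by (simp add: inv_sqrt_approx_def)

lemma inv_sqrt_approx_Suc:
  "j \<ge> 1 \<Longrightarrow> inv_sqrt_approx (Suc j) = inv_sqrt_approx j * (1 - 1 / (2 * real j))"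
  by (simp add: inv_sqrt_approx_def)

lemma inv_sqrt_approx_nonneg: "inv_sqrt_approx j \<ge> 0"
  unfolding inv_sqrt_approx_def by (intro prod_nonneg) (auto simp: field_simps)

text \<open>
  With \<open>h\<close> for the product, \<open>(4 j - 3) (h j)\<^sup>2\<close> is increasing in \<open>j\<close> and equals 1 at \<open>j = 1\<close>.
\<close>

lemma inv_sqrt_approx_lower:
  assumes "j \<ge> 1"
  shows "1 / (2 * sqrt (real j)) \<le> inv_sqrt_approx j"
proof -
  have *: "1 \<le> (4 * real j - 3) * (inv_sqrt_approx j)\<^sup>2"
    using assms
  proof (induction j rule: dec_induct)
    case base show ?case by simp
  next
    case (step j)
    define x where "x = real j"
    have x: "x \<ge> 1" using step by (simp add: x_def)
    have "(4 * x - 3) * 1 \<le> (4 * x + 1) * (1 - 1 / (2 * x))\<^sup>2"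
    proof -
      have "(4 * x + 1) * (1 - 1 / (2 * x))\<^sup>2 - (4 * x - 3) = 1 / (4 * x\<^sup>2)"
        using x by (simp add: power2_eq_square field_simps)
      then show ?thesis by (smt (verit) divide_nonneg_nonneg zero_le_power2)
    qed
    then have "(4 * x - 3) * (inv_sqrt_approx j)\<^sup>2
        \<le> (4 * x + 1) * (1 - 1 / (2 * x))\<^sup>2 * (inv_sqrt_approx j)\<^sup>2"
      by (intro mult_right_mono) auto
    also have "\<dots> = (4 * real (Suc j) - 3) * (inv_sqrt_approx (Suc j))\<^sup>2"
    proof -
      have "4 * real (Suc j) - 3 = 4 * x + 1" by (simp add: x_def)
      moreover have "inv_sqrt_approx (Suc j) = inv_sqrt_approx j * (1 - 1 / (2 * x))"
        using step by (simp add: inv_sqrt_approx_Suc x_def)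
      ultimately show ?thesis by (simp only: power_mult_distrib mult_ac)
    qed
    finally show ?case using step by (simp add: x_def)
  qed
  then have "1 \<le> (2 * sqrt (real j) * inv_sqrt_approx j)\<^sup>2"
    by (simp add: power_mult_distrib algebra_simps)
       (smt (verit) zero_le_power2)
  then have "1 \<le> 2 * sqrt (real j) * inv_sqrt_approx j"
    by (intro power2_le_imp_le[of 1]) (simp_all add: inv_sqrt_approx_nonneg)
  then show ?thesis
    using assms by (simp add: field_simps)
qed

lemma sum_branch_weight: "(\<Sum>i\<in>UNIV. branch_weight k i) = 1" for k :: "'b::finite \<Rightarrow> nat"
  using sum_pmf_eq_1[of UNIV "branch k"] by (simp add: pmf_branch)

text \<open>
  A step of the chain multiplies the mean by
  \<open>1 - (b - 1) / (2 ((b - 1) (n + 1) + 1)) \<le> 1 - 1 / (2 (n + 2))\<close>, where \<open>b \<ge> 2\<close> is the arity.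
\<close>

lemma mean_inv_sqrt_approx:
  fixes i :: "'b::finite"
  assumes "CARD('b) \<ge> 2"
  shows "measure_pmf.expectation (sizes_chain n) (\<lambda>k. inv_sqrt_approx (Suc n - k i))
    \<le> sqrt (2 / (real n + 2))"
proof (induction n)
  case 0 then show ?case by simp
next
  case (Suc n)
  define B where "B = real CARD('b)"
  define r where "r = 1 - (B - 1) / (2 * ((B - 1) * (real n + 1) + 1))"
  have B: "B \<ge> 2" using assms by (simp add: B_def)
  have den: "(B - 1) * (real n + 1) + 1 > 0" using B by (simp add: add_nonneg_pos)
  let ?g = "\<lambda>k :: 'b \<Rightarrow> nat. inv_sqrt_approx (Suc n - k i)"
  have step: "measure_pmf.expectation
      (map_pmf (\<lambda>i'. k(i' := Suc (k i'))) (branch k)) (\<lambda>k. inv_sqrt_approx (Suc (Suc n) - k i))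
    = r * ?g k" if k: "k \<in> set_pmf (sizes_chain n)" for k :: "'b \<Rightarrow> nat"
  proof -
    define j where "j = Suc n - k i"
    have kle: "k i \<le> n" using sizes_chain_le[OF k] .
    then have j: "j \<ge> 1" "real j = real n + 1 - real (k i)" by (auto simp: j_def)
    have bw: "branch_weight k i = 1 - (B - 1) * real j / ((B - 1) * (real n + 1) + 1)"
      using den sum_sizes_chain[OF k] unfolding branch_weight_def
      by (simp add: B_def[symmetric] j field_simps)
    have "measure_pmf.expectation
        (map_pmf (\<lambda>i'. k(i' := Suc (k i'))) (branch k)) (\<lambda>k. inv_sqrt_approx (Suc (Suc n) - k i))
      = (\<Sum>i'\<in>UNIV. branch_weight k i' * inv_sqrt_approx (if i' = i then j else Suc j))"
      unfolding integral_map_pmf using kle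
      by (subst integral_measure_pmf_real[of UNIV])
         (auto simp: pmf_branch j_def mult.commute Suc_diff_le intro!: sum.cong)
    also have "\<dots> = (\<Sum>i'\<in>UNIV. branch_weight k i' * inv_sqrt_approx (Suc j)
        + (if i' = i then branch_weight k i * (inv_sqrt_approx j - inv_sqrt_approx (Suc j)) else 0))"
      by (intro sum.cong) (auto simp: algebra_simps)
    also have "\<dots> = inv_sqrt_approx (Suc j)
        + branch_weight k i * (inv_sqrt_approx j - inv_sqrt_approx (Suc j))"
      by (simp add: sum.distrib sum_distrib_right[symmetric] sum_branch_weight)
    also have "\<dots> = inv_sqrt_approx j * (1 - 1 / (2 * real j) * (1 - branch_weight k i))"
      using j by (simp add: inv_sqrt_approx_Suc algebra_simps diff_divide_distrib)
    also have "1 / (2 * real j) * (1 - branch_weight k i)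
        = (B - 1) / (2 * ((B - 1) * (real n + 1) + 1))"
    proof -
      have "1 / (2 * real j) * ((B - 1) * real j / D) = (B - 1) / (2 * D)" for D
        using j(1) by simp
      then show ?thesis by (simp add: bw)
    qed
    finally show ?thesis by (simp add: r_def j_def)
  qed
  have "measure_pmf.expectation (sizes_chain (Suc n)) (\<lambda>k. inv_sqrt_approx (Suc (Suc n) - k i))
      = (\<Sum>k\<in>set_pmf (sizes_chain n). pmf (sizes_chain n) k * (r * ?g k))"
    unfolding sizes_chain.simps
    by (subst pmf_expectation_bind[of "set_pmf (sizes_chain n)"])
       (auto simp: finite_support_sizes_chain step simp del: integral_map_pmf intro!: sum.cong)
  also have "\<dots> = r * measure_pmf.expectation (sizes_chain n) ?g"
    by (subst integral_measure_pmf_real[of "set_pmf (sizes_chain n)"])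
       (auto simp: finite_support_sizes_chain sum_distrib_left algebra_simps)
  also have "\<dots> \<le> r * sqrt (2 / (real n + 2))"
  proof (rule mult_left_mono[OF Suc])
    have "(B - 1) * 1 \<le> (B - 1) * (real n + 1)"
      using B by (intro mult_left_mono) auto
    then have "(B - 1) / (2 * ((B - 1) * (real n + 1) + 1)) \<le> 1"
      using den by (subst pos_divide_le_eq) (auto simp del: mult_Suc)
    then show "r \<ge> 0" by (simp add: r_def)
  qed
  also have "\<dots> \<le> (1 - 1 / (2 * (real n + 2))) * sqrt (2 / (real n + 2))"
  proof (rule mult_right_mono)
    have "1 / (real n + 2) \<le> (B - 1) / ((B - 1) * (real n + 1) + 1)"
      using B den by (simp add: field_simps)
    then have "1 / (real n + 2) / 2 \<le> (B - 1) / ((B - 1) * (real n + 1) + 1) / 2"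
      by (rule divide_right_mono) simp
    then show "r \<le> 1 - 1 / (2 * (real n + 2))" by (simp add: r_def mult.commute)
  qed simp
  also have "\<dots> \<le> sqrt (2 / (real (Suc n) + 2))"
  proof (rule real_le_rsqrt)
    define x where "x = real n + 2"
    have x: "x \<ge> 2" by (simp add: x_def)
    have "((1 - 1 / (2 * x)) * sqrt (2 / x))\<^sup>2 = (1 - 1 / (2 * x))\<^sup>2 * (2 / x)"
      using x by (simp add: power_mult_distrib)
    also have "\<dots> \<le> 2 / (x + 1)"
    proof -
      have "(2 * x - 1)\<^sup>2 * (x + 1) \<le> 4 * x\<^sup>2 * x"
        using x by (simp add: power2_eq_square algebra_simps)
      then show ?thesis using x by (simp add: power2_eq_square field_simps)
    qed
    finally show "((1 - 1 / (2 * (real n + 2))) * sqrt (2 / (real n + 2)))\<^sup>2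
        \<le> 2 / (real (Suc n) + 2)" by (simp add: x_def add.commute)
  qed
  finally show ?case .
qed

text \<open>The relative loss in the square of the size when a tree is replaced by its subtrees.\<close>

definition split_spread :: "nat \<Rightarrow> ('b::finite \<Rightarrow> nat) \<Rightarrow> real" where
  "split_spread n k = 1 - (\<Sum>i\<in>UNIV. (real (k i) / real n)\<^sup>2)"

lemma split_spread_le_1: "split_spread n k \<le> 1"
  by (simp add: split_spread_def sum_nonneg)

lemma sum_squares_split: "(\<Sum>i\<in>UNIV. real (k i) ^ 2) = real (Suc n) ^ 2 * (1 - split_spread (Suc n) k)"
  for k :: "'b::finite \<Rightarrow> nat"
proof -
  have "(\<Sum>i\<in>UNIV. (real (k i) / real (Suc n))\<^sup>2) = (\<Sum>i\<in>UNIV. real (k i) ^ 2) / real (Suc n) ^ 2"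
    by (simp only: power_divide sum_divide_distrib)
  then show ?thesis by (simp add: split_spread_def)
qed

text \<open>
  The sum of the squares of the fractions \<open>k i / n\<close> is at most the largest of them, since they
  sum to at most 1.
\<close>

lemma split_spread_lower:
  fixes k :: "'b::finite \<Rightarrow> nat"
  assumes "(\<Sum>i\<in>UNIV. k i) = n"
  shows "\<exists>i. real (Suc n - k i) / real (Suc n) \<le> split_spread (Suc n) k"
proof -
  have "Max (range k) \<in> range k" by (rule Max_in) auto
  then obtain i where "Max (range k) = k i" by (elim rangeE)
  then have i: "k j \<le> k i" for j by (metis Max_ge finite finite_imageI rangeI)
  have le: "k i \<le> n" using assms member_le_sum[of i UNIV k] by simp
  have "(\<Sum>j\<in>UNIV. (real (k j) / real (Suc n))\<^sup>2)
      \<le> (\<Sum>j\<in>UNIV. real (k i) / real (Suc n) * (real (k j) / real (Suc n)))"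
    unfolding power2_eq_square
    by (intro sum_mono mult_right_mono divide_right_mono) (use i in auto)
  also have "\<dots> = real (k i) / real (Suc n) * (real n / real (Suc n))"
    using assms by (simp add: sum_distrib_left[symmetric] sum_divide_distrib[symmetric] flip: of_nat_sum)
  also have "\<dots> \<le> real (k i) / real (Suc n) * 1"
    by (intro mult_left_mono) auto
  finally have "real (Suc n - k i) / real (Suc n) \<le> split_spread (Suc n) k"
    using le by (simp add: split_spread_def of_nat_diff diff_divide_distrib add_divide_distrib)
  then show ?thesis by blast
qed

lemma split_spread_nonneg:
  "(\<Sum>i\<in>UNIV. k i) = n \<Longrightarrow> 0 \<le> split_spread (Suc n) (k :: 'b::finite \<Rightarrow> nat)"
  using split_spread_lower[of k n] by (smt (verit) divide_nonneg_nonneg of_nat_0_le_iff)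

lemma exp_minus_le_inv_sqrt:
  assumes "v > 0" shows "exp (- v) \<le> 1 / sqrt v"
proof -
  have "v \<le> exp (2 * v)" using exp_ge_add_one_self[of "2 * v"] assms by linarith
  also have "\<dots> = (exp v)\<^sup>2" by (simp add: exp_double)
  finally have "sqrt v \<le> exp v" by (intro real_le_lsqrt) auto
  then show ?thesis using assms by (simp add: exp_minus field_simps)
qed

text \<open>
  The spread is small only if some subtree contains almost all nodes; the negative moments above
  make this improbable, uniformly in the size.
\<close>

theorem laplace_split_spread:
  assumes "CARD('b::finite) \<ge> 2" "y > 0"
  shows "measure_pmf.expectation (sizes_chain n :: ('b \<Rightarrow> nat) pmf)
      (\<lambda>k. exp (- y * split_spread (Suc n) k)) \<le> 2 * sqrt 2 * real CARD('b) / sqrt y"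
proof -
  define N where "N = real (Suc n)"
  have N: "N > 0" by (simp add: N_def)
  have int: "integrable (measure_pmf (sizes_chain n)) f" for f :: "('b \<Rightarrow> nat) \<Rightarrow> real"
    by (intro integrable_measure_pmf_finite finite_support_sizes_chain)
  have le: "exp (- y * split_spread (Suc n) k)
      \<le> (\<Sum>i\<in>UNIV. 2 * sqrt (N / y) * inv_sqrt_approx (Suc n - k i))"
    if k: "k \<in> set_pmf (sizes_chain n)" for k :: "'b \<Rightarrow> nat"
  proof -
    obtain i where i: "real (Suc n - k i) / N \<le> split_spread (Suc n) k"
      using split_spread_lower[OF sum_sizes_chain[OF k]] by (auto simp: N_def)
    define j where "j = Suc n - k i"
    have j: "j \<ge> 1" using sizes_chain_le[OF k, of i] by (simp add: j_def)
    have pos: "y * (real j / N) > 0" using assms(2) j N by simp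
    have "exp (- y * split_spread (Suc n) k) \<le> exp (- (y * (real j / N)))"
      using mult_left_mono[OF i, of y] assms(2) by (simp add: j_def)
    also have "\<dots> \<le> 1 / sqrt (y * (real j / N))"
      by (rule exp_minus_le_inv_sqrt[OF pos])
    also have "\<dots> = 2 * sqrt (N / y) * (1 / (2 * sqrt (real j)))"
      using assms(2) N j by (simp add: real_sqrt_mult real_sqrt_divide field_simps)
    also have "\<dots> \<le> 2 * sqrt (N / y) * inv_sqrt_approx j"
      using inv_sqrt_approx_lower[OF j] assms(2) N by (intro mult_left_mono) auto
    also have "\<dots> \<le> (\<Sum>i\<in>UNIV. 2 * sqrt (N / y) * inv_sqrt_approx (Suc n - k i))"
      unfolding j_def
      by (rule member_le_sum) (use assms(2) N in \<open>auto intro!: mult_nonneg_nonneg inv_sqrt_approx_nonneg\<close>)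
    finally show ?thesis .
  qed
  have "measure_pmf.expectation (sizes_chain n :: ('b \<Rightarrow> nat) pmf)
      (\<lambda>k. exp (- y * split_spread (Suc n) k))
    \<le> measure_pmf.expectation (sizes_chain n)
      (\<lambda>k :: 'b \<Rightarrow> nat. \<Sum>i\<in>UNIV. 2 * sqrt (N / y) * inv_sqrt_approx (Suc n - k i))"
    by (intro integral_mono_AE int AE_pmfI le)
  also have "\<dots> = (\<Sum>i\<in>UNIV. 2 * sqrt (N / y) *
      measure_pmf.expectation (sizes_chain n :: ('b \<Rightarrow> nat) pmf) (\<lambda>k. inv_sqrt_approx (Suc n - k i)))"
    by (simp add: int)
  also have "\<dots> \<le> (\<Sum>i\<in>(UNIV :: 'b set). 2 * sqrt (N / y) * sqrt (2 / (real n + 2)))"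
    using assms N by (intro sum_mono mult_left_mono mean_inv_sqrt_approx) auto
  also have "\<dots> = 2 * real CARD('b) * sqrt (N / y * (2 / (real n + 2)))"
    by (simp only: sum_constant real_sqrt_mult)
  also have "\<dots> \<le> 2 * real CARD('b) * sqrt (2 / y)"
  proof (intro mult_left_mono real_sqrt_le_mono)
    have "N / (real n + 2) \<le> 1" by (simp add: N_def)
    then have "2 / y * (N / (real n + 2)) \<le> 2 / y * 1"
      using assms(2) by (intro mult_left_mono) auto
    then show "N / y * (2 / (real n + 2)) \<le> 2 / y" by (simp add: mult_ac)
  qed auto
  also have "\<dots> = 2 * sqrt 2 * real CARD('b) / sqrt y"
    by (simp add: real_sqrt_divide)
  finally show ?thesis .
qed

section \<open>The mean number of edges on the paths from the root\<close>

definition mean_depth_sum :: "'b::finite itself \<Rightarrow> nat \<Rightarrow> real" where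
  "mean_depth_sum _ n =
     measure_pmf.expectation (bary_tree n :: 'b list set pmf) (\<lambda>S. \<Sum>u\<in>S. real (length u))"

text \<open>
  The depths of the external nodes sum to \<open>b - 1\<close> times the depths of the internal nodes plus
  \<open>b n\<close>, because each child lies one level below its parent.
\<close>

lemma mean_depth_sum_Suc:
  fixes n :: nat
  defines "B \<equiv> real CARD('b::finite)"
  defines "p \<equiv> mean_depth_sum TYPE('b)"
  shows "p (Suc n) = p n + ((B - 1) * p n + B * real n) / ((B - 1) * real n + 1)"
proof -
  let ?f = "\<lambda>S :: 'b list set. \<Sum>u\<in>S. real (length u)"
  let ?d = "(B - 1) * real n + 1"
  have "measure_pmf.expectation (grow S) ?f = ?f S + ((B - 1) * ?f S + B * real n) / ?d"
    if S: "S \<in> set_pmf (bary_tree n)" for S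
  proof -
    have t: "tree_like S" "card S = n" "finite S"
      using bary_tree_tree_like[OF S] bary_tree_card[OF S] bary_tree_finite[OF S] by auto
    have ne: "insertion_nodes S \<noteq> {}" and fin: "finite (insertion_nodes S)"
      and c: "real (card (insertion_nodes S)) = ?d"
      using insertion_nodes_nonempty[OF t(1)] finite_insertion_nodes[OF t(3)]
        card_insertion_nodes[OF t(1)] t(2) by (auto simp: B_def)
    have "real (card (insertion_nodes S)) \<noteq> 0" using ne fin by simp
    then have d: "?d \<noteq> 0" using c by simp
    have ext: "(\<Sum>v\<in>insertion_nodes S. real (length v)) = (B - 1) * ?f S + B * real n"
    proof (cases "S = {}")
      case True
      then show ?thesis using t(2) by (simp add: insertion_nodes_def)
    next
      case False
      then show ?thesis
        using sum_external_nodes[OF t(1) False, of "\<lambda>v. real (length v)"] t(2)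
        by (simp add: insertion_nodes_def B_def sum.distrib sum_distrib_left[symmetric] algebra_simps)
    qed
    have "measure_pmf.expectation (grow S) ?f
        = (\<Sum>v\<in>insertion_nodes S. ?f S + real (length v)) / ?d"
      unfolding grow_def integral_map_pmf integral_pmf_of_set[OF ne fin] c[symmetric]
      using tree_like_insert(2)[OF t(1)] t(3) by (intro arg_cong2[of _ _ _ _ "(/)"] sum.cong) auto
    also have "\<dots> = (?d * ?f S + ((B - 1) * ?f S + B * real n)) / ?d"
      by (simp add: sum.distrib ext c)
    finally show ?thesis using d by (simp add: add_divide_distrib)
  qed
  moreover have "finite (set_pmf (grow S))" if "S \<in> set_pmf (bary_tree n)" for S :: "'b list set"
    unfolding set_pmf_grow[OF bary_tree_tree_like[OF that]]
    by (intro finite_imageI finite_insertion_nodes bary_tree_finite[OF that])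
  ultimately have "p (Suc n) = (\<Sum>S\<in>set_pmf (bary_tree n). pmf (bary_tree n) S *
      (?f S + ((B - 1) * ?f S + B * real n) / ?d))"
    unfolding p_def mean_depth_sum_def bary_tree_Suc
    by (subst pmf_expectation_bind[of "set_pmf (bary_tree n)"])
       (auto simp: finite_support_bary_tree)
  also have "\<dots> = measure_pmf.expectation (bary_tree n)
      (\<lambda>S. ?f S + ((B - 1) * ?f S + B * real n) / ?d)"
    by (subst integral_measure_pmf_real[of "set_pmf (bary_tree n)"])
       (auto simp: finite_support_bary_tree algebra_simps)
  also have "\<dots> = p n + ((B - 1) * p n + B * real n) / ?d"
    by (simp add: p_def mean_depth_sum_def integrable_measure_pmf_finite finite_support_bary_tree)
  finally show ?thesis .
qed

text \<open>
  The mean divided by the number of external nodes is increasing with increments of order \<open>1/n\<close>.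
  Since the numbers of external nodes of the subtrees of the root add up to that of the whole
  tree, the mean is additive over the subtrees up to a linear error.
\<close>

theorem mean_depth_sum_split:
  fixes k :: "'b::finite \<Rightarrow> nat"
  assumes "CARD('b) \<ge> 2" and "(\<Sum>i\<in>UNIV. k i) = n"
  defines "p \<equiv> mean_depth_sum TYPE('b)"
  shows "\<bar>(\<Sum>i\<in>UNIV. p (k i)) - p (Suc n)\<bar> \<le> (real CARD('b))\<^sup>2 * real (Suc n)"
proof -
  define B where "B = real CARD('b)"
  define e where "e m = (B - 1) * real m + 1" for m
  define q where "q m = p m / e m" for m
  have B: "B \<ge> 2" using assms by (simp add: B_def)
  have e: "e m > 0" for m using B by (simp add: e_def add_nonneg_pos)
  have e_mono: "e m \<le> e m'" if "m \<le> m'" for m m'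
    using B that by (simp add: e_def mult_left_mono)
  have p: "p m = e m * q m" for m using e[of m] by (simp add: q_def)
  have q_Suc: "q (Suc m) = q m + B * real m / (e m * e (Suc m))" for m
  proof -
    have "p (Suc m) = (p m * e m + (B - 1) * p m + B * real m) / e m"
      using mean_depth_sum_Suc[where 'b='b, of m] e[of m]
      by (simp add: p_def B_def e_def field_simps)
    also have "p m * e m + (B - 1) * p m = p m * e (Suc m)"
      by (simp add: e_def algebra_simps)
    finally show ?thesis using e[of m] e[of "Suc m"] by (simp add: q_def field_simps)
  qed
  have inc: "0 \<le> e a * (q c - q a) \<and> e a * (q c - q a) \<le> B * (real c - real a)" if "a \<le> c" for a c
    using that
  proof (induction c rule: dec_induct)
    case base show ?case by simp
  next
    case (step c)
    have "e a * (q (Suc c) - q a)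
        = e a * (q c - q a) + B * ((e a / e c) * (real c / e (Suc c)))"
      using e[of c] e[of "Suc c"] by (simp add: q_Suc field_simps)
    moreover have "0 \<le> (e a / e c) * (real c / e (Suc c))"
      using e[of a] e[of c] e[of "Suc c"] by simp
    moreover have "(e a / e c) * (real c / e (Suc c)) \<le> 1 * 1"
    proof (rule mult_mono)
      show "e a / e c \<le> 1" using e_mono[OF step(1)] e[of c] by simp
      have "1 * real c \<le> (B - 1) * real (Suc c) + 1"
        using B by (intro order_trans[OF mult_mono[of 1 "B - 1" "real c" "real (Suc c)"]]) auto
      then show "real c / e (Suc c) \<le> 1" using e[of "Suc c"] by (simp add: e_def[of "Suc c"])
    qed (use e[of "Suc c"] in auto)
    ultimately show ?case
      using step B mult_left_mono[of "(e a / e c) * (real c / e (Suc c))" 1 B]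
        mult_nonneg_nonneg[of B "(e a / e c) * (real c / e (Suc c))"]
      by (simp add: algebra_simps)
  qed
  have k: "k i \<le> Suc n" for i using assms(2) member_le_sum[of i UNIV k] by simp
  have "(\<Sum>i\<in>UNIV. e (k i)) = e (Suc n)"
  proof -
    have "(\<Sum>i\<in>UNIV. e (k i)) = (B - 1) * real (\<Sum>i\<in>UNIV. k i) + B"
      by (simp add: e_def sum.distrib sum_distrib_left B_def)
    then show ?thesis unfolding assms(2) by (simp add: e_def algebra_simps)
  qed
  then have "p (Suc n) = (\<Sum>i\<in>UNIV. e (k i) * q (Suc n))"
    by (simp add: p sum_distrib_right[symmetric])
  then have *: "p (Suc n) - (\<Sum>i\<in>UNIV. p (k i)) = (\<Sum>i\<in>UNIV. e (k i) * (q (Suc n) - q (k i)))"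
    by (simp add: p sum_subtractf algebra_simps)
  have "(\<Sum>i\<in>UNIV. e (k i) * (q (Suc n) - q (k i))) \<le> (\<Sum>i\<in>(UNIV :: 'b set). B * real (Suc n))"
  proof (rule sum_mono)
    fix i
    have "e (k i) * (q (Suc n) - q (k i)) \<le> B * (real (Suc n) - real (k i))"
      using inc[OF k] by blast
    also have "\<dots> \<le> B * real (Suc n)" using B by (intro mult_left_mono) auto
    finally show "e (k i) * (q (Suc n) - q (k i)) \<le> B * real (Suc n)" .
  qed
  moreover have "0 \<le> (\<Sum>i\<in>UNIV. e (k i) * (q (Suc n) - q (k i)))"
    using inc[OF k] by (intro sum_nonneg) blast
  ultimately show ?thesis
    unfolding *[symmetric] by (simp add: B_def power2_eq_square algebra_simps)
qed

section \<open>Product measures\<close>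

lemma distr_PiM_componentwise:
  fixes M :: "'i::finite \<Rightarrow> 'c measure" and K :: "'i \<Rightarrow> 'd measure"
  assumes M: "\<And>i. prob_space (M i)" and f: "\<And>i. f i \<in> measurable (M i) (K i)"
  shows "distr (PiM UNIV M) (PiM UNIV K) (\<lambda>x i. f i (x i)) = PiM UNIV (\<lambda>i. distr (M i) (K i) (f i))"
proof -
  interpret M: product_sigma_finite M
    using M by (simp add: product_sigma_finite_def prob_space_imp_sigma_finite)
  interpret K: product_sigma_finite "\<lambda>i. distr (M i) (K i) (f i)"
    using M f by (simp add: product_sigma_finite_def prob_space_imp_sigma_finite
        prob_space.prob_space_distr)
  have meas: "(\<lambda>x i. f i (x i)) \<in> measurable (PiM UNIV M) (PiM UNIV K)"
    by (intro measurable_abs_UNIV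
        measurable_compose[where f = "\<lambda>x. x i" and g = "f i" for i, OF measurable_component_singleton[OF UNIV_I] f])
  show ?thesis
  proof (rule K.PiM_eqI)
    show "sets (distr (PiM UNIV M) (PiM UNIV K) (\<lambda>x i. f i (x i)))
        = sets (PiM UNIV (\<lambda>i. distr (M i) (K i) (f i)))"
      by (simp cong: sets_PiM_cong)
    fix A assume A: "\<And>i. i \<in> UNIV \<Longrightarrow> A i \<in> sets (distr (M i) (K i) (f i))"
    then have A': "A i \<in> sets (K i)" for i by simp
    have "(\<lambda>x i. f i (x i)) -` Pi\<^sub>E UNIV A \<inter> space (PiM UNIV M)
        = Pi\<^sub>E UNIV (\<lambda>i. f i -` A i \<inter> space (M i))"
      by (auto simp: space_PiM PiE_iff)
    moreover have "Pi\<^sub>E UNIV A \<in> sets (PiM UNIV K)"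
      using A' by (intro sets_PiM_I_finite) auto
    moreover have "f i -` A i \<inter> space (M i) \<in> sets (M i)" for i
      using measurable_sets[OF f A'] .
    ultimately show "emeasure (distr (PiM UNIV M) (PiM UNIV K) (\<lambda>x i. f i (x i))) (Pi\<^sub>E UNIV A)
        = (\<Prod>i\<in>UNIV. emeasure (distr (M i) (K i) (f i)) (A i))"
      using meas A' f by (simp add: emeasure_distr M.emeasure_PiM)
  qed simp
qed

definition join_weights :: "'c \<times> ('b \<Rightarrow> 'b list \<Rightarrow> 'c) \<Rightarrow> 'b list \<Rightarrow> 'c" where
  "join_weights = (\<lambda>(w, y) u. case u of [] \<Rightarrow> w | i # v \<Rightarrow> y i v)"

lemma join_weights_simps [simp]:
  "join_weights (w, y) [] = w" "join_weights (w, y) (i # v) = y i v"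
  by (simp_all add: join_weights_def)

lemma measurable_join_weights:
  "join_weights \<in> measurable (K \<Otimes>\<^sub>M PiM (UNIV :: 'b set) (\<lambda>_. PiM UNIV (\<lambda>_. K))) (PiM UNIV (\<lambda>_. K))"
proof -
  let ?P = "K \<Otimes>\<^sub>M PiM (UNIV :: 'b set) (\<lambda>_. PiM UNIV (\<lambda>_. K))"
  have "(\<lambda>x. join_weights x u) \<in> measurable ?P K" for u :: "'b list"
  proof (cases u)
    case Nil
    then show ?thesis by (simp add: join_weights_def case_prod_beta)
  next
    case (Cons i v)
    have "(\<lambda>x. snd x i v) \<in> measurable ?P K"
      by (rule measurable_compose[OF measurable_compose[OF measurable_snd
            measurable_component_singleton[of i]] measurable_component_singleton[of v]]) auto
    then show ?thesis by (simp add: join_weights_def case_prod_beta Cons)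
  qed
  then show ?thesis
    by (intro measurable_abs_UNIV[of "\<lambda>u x. join_weights x u"]) auto
qed

text \<open>
  Independent weight vectors at all nodes consist of the one at the root and of independent
  families in the subtrees of the root.  It suffices to compare the measures on cylinder sets;
  a cylinder restricts finitely many nodes, and these are distributed among the root and the
  subtrees.
\<close>

lemma distr_join_weights:
  fixes K :: "'c measure"
  assumes "prob_space K"
  shows "distr (K \<Otimes>\<^sub>M PiM (UNIV :: 'b::finite set) (\<lambda>_. PiM UNIV (\<lambda>_. K))) (PiM UNIV (\<lambda>_. K)) join_weights
    = PiM UNIV (\<lambda>_. K)"
proof -
  interpret K: prob_space K by fact
  interpret KP: product_prob_space "\<lambda>_ :: 'b list. K" UNIV ..
  define Q where "Q = PiM (UNIV :: 'b list set) (\<lambda>_. K)"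
  interpret Q: prob_space Q unfolding Q_def by (rule KP.prob_space_axioms)
  interpret QP: product_prob_space "\<lambda>_ :: 'b. Q" UNIV ..
  have [simp]: "sets Q = sets (PiM UNIV (\<lambda>_. K))" by (simp add: Q_def)
  have spQ: "space Q = UNIV \<rightarrow>\<^sub>E space K" by (simp add: Q_def space_PiM)
  show ?thesis
    unfolding Q_def[symmetric]
  proof (rule KP.PiM_eq[folded Q_def])
    show "sets (distr (K \<Otimes>\<^sub>M PiM (UNIV :: 'b set) (\<lambda>_. Q)) Q join_weights) = sets Q"
      by simp
    fix J F assume J: "finite J" "J \<subseteq> (UNIV :: 'b list set)" and F: "\<And>j. j \<in> J \<Longrightarrow> F j \<in> sets K"
    define A where "A u = (if u \<in> J then F u else space K)" for u
    define J' where "J' i = {v. i # v \<in> J}" for i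
    have A: "A u \<in> sets K" "A u \<subseteq> space K" for u
      using F sets.sets_into_space by (auto simp: A_def)
    have J': "finite (J' i)" for i
      unfolding J'_def by (rule finite_vimageI[of J "(#) i", unfolded vimage_def]) (use J in auto)
    define E where "E i = prod_emb UNIV (\<lambda>_. K) (J' i) (Pi\<^sub>E (J' i) (\<lambda>v. A (i # v)))" for i
    have E: "E i \<in> sets Q" "emeasure Q (E i) = (\<Prod>v\<in>J' i. emeasure K (A (i # v)))" for i
      unfolding E_def Q_def using A J' K.prob_space_axioms
      by (auto intro!: sets_PiM_I emeasure_PiM_emb)
    have mem: "join_weights (w, y) \<in> prod_emb UNIV (\<lambda>_. K) J (Pi\<^sub>E J F)
        \<longleftrightarrow> w \<in> A [] \<and> (\<forall>i. y i \<in> E i)" if "w \<in> space K" "\<And>i. y i \<in> space Q" for w y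
    proof -
      have y_E: "(\<forall>v. y i v \<in> A (i # v)) \<longleftrightarrow> y i \<in> E i" for i
        using that(2)[of i] by (auto simp: E_def prod_emb_iff J'_def spQ PiE_iff A_def)
      have "join_weights (w, y) u \<in> space K" for u
        using that by (cases u) (auto simp: spQ PiE_iff)
      then have "join_weights (w, y) \<in> prod_emb UNIV (\<lambda>_. K) J (Pi\<^sub>E J F)
          \<longleftrightarrow> (\<forall>u. join_weights (w, y) u \<in> A u)"
        by (auto simp: prod_emb_iff A_def)
      also have "\<dots> \<longleftrightarrow> w \<in> A [] \<and> (\<forall>i v. y i v \<in> A (i # v))"
        by (metis join_weights_simps list.exhaust)
      finally show ?thesis by (simp only: y_E)
    qed
    have "join_weights -` prod_emb UNIV (\<lambda>_. K) J (Pi\<^sub>E J F) \<inter> space (K \<Otimes>\<^sub>M PiM UNIV (\<lambda>_. Q))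
        = A [] \<times> Pi\<^sub>E UNIV E"
    proof (intro set_eqI iffI)
      fix x assume "x \<in> join_weights -` prod_emb UNIV (\<lambda>_. K) J (Pi\<^sub>E J F)
        \<inter> space (K \<Otimes>\<^sub>M PiM UNIV (\<lambda>_. Q))"
      moreover from this have "fst x \<in> space K" "\<And>i. snd x i \<in> space Q"
        by (auto simp: space_pair_measure space_PiM PiE_iff)
      ultimately show "x \<in> A [] \<times> Pi\<^sub>E UNIV E"
        using mem[of "fst x" "snd x"] by (simp add: mem_Times_iff PiE_iff)
    next
      fix x assume x: "x \<in> A [] \<times> Pi\<^sub>E UNIV E"
      then have "fst x \<in> space K" "\<And>i. snd x i \<in> space Q"
        using A(2)[of "[]"] sets.sets_into_space[OF E(1)]
        by (auto simp: mem_Times_iff PiE_iff subset_iff)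
      then show "x \<in> join_weights -` prod_emb UNIV (\<lambda>_. K) J (Pi\<^sub>E J F)
        \<inter> space (K \<Otimes>\<^sub>M PiM UNIV (\<lambda>_. Q))"
        using mem[of "fst x" "snd x"] x
        by (simp add: mem_Times_iff PiE_iff space_pair_measure space_PiM)
    qed
    moreover have "prod_emb UNIV (\<lambda>_. K) J (Pi\<^sub>E J F) \<in> sets Q"
      unfolding Q_def using J F by (intro sets_PiM_I) auto
    ultimately have "emeasure (distr (K \<Otimes>\<^sub>M PiM UNIV (\<lambda>_. Q)) Q join_weights)
        (prod_emb UNIV (\<lambda>_. K) J (Pi\<^sub>E J F)) = emeasure (K \<Otimes>\<^sub>M PiM UNIV (\<lambda>_. Q)) (A [] \<times> Pi\<^sub>E UNIV E)"
      using measurable_join_weights[where K=K and 'b='b, folded Q_def]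
      by (simp only: emeasure_distr)
    also have "\<dots> = emeasure K (A []) * (\<Prod>i\<in>UNIV. emeasure Q (E i))"
    proof -
      have "Pi\<^sub>E UNIV E \<in> sets (PiM UNIV (\<lambda>_. Q))"
        by (rule sets_PiM_I_finite) (simp_all add: E(1)[unfolded \<open>sets Q = _\<close>])
      then have "emeasure (K \<Otimes>\<^sub>M PiM UNIV (\<lambda>_. Q)) (A [] \<times> Pi\<^sub>E UNIV E)
          = emeasure K (A []) * emeasure (PiM UNIV (\<lambda>_. Q)) (Pi\<^sub>E UNIV E)"
        by (rule QP.P.emeasure_pair_measure_Times[OF A(1)])
      also have "emeasure (PiM UNIV (\<lambda>_. Q)) (Pi\<^sub>E UNIV E) = (\<Prod>i\<in>UNIV. emeasure Q (E i))"
        by (rule QP.emeasure_PiM) (simp_all only: E(1) finite)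
      finally show ?thesis .
    qed
    also have "\<dots> = (\<Prod>j\<in>J. emeasure K (F j))"
    proof -
      have JJ: "J = (if [] \<in> J then {[]} else {}) \<union> (\<Union>i. (#) i ` J' i)"
      proof (intro set_eqI iffI)
        fix u assume "u \<in> J"
        then show "u \<in> (if [] \<in> J then {[]} else {}) \<union> (\<Union>i. (#) i ` J' i)"
          by (cases u) (auto simp: J'_def)
      qed (auto simp: J'_def split: if_splits)
      have "(\<Prod>j\<in>J. emeasure K (F j)) = (\<Prod>j\<in>J. emeasure K (A j))"
        by (simp add: A_def)
      also have "\<dots> = (\<Prod>j\<in>(if [] \<in> J then {[]} else {}). emeasure K (A j)) *
          (\<Prod>j\<in>(\<Union>i. (#) i ` J' i). emeasure K (A j))"
        by (subst JJ, subst prod.union_disjoint) (use J' in auto)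
      also have "(\<Prod>j\<in>(if [] \<in> J then {[]} else {}). emeasure K (A j)) = emeasure K (A [])"
        by (simp add: A_def K.emeasure_space_1)
      also have "(\<Prod>j\<in>(\<Union>i. (#) i ` J' i). emeasure K (A j))
          = (\<Prod>i\<in>UNIV. \<Prod>j\<in>(#) i ` J' i. emeasure K (A j))"
        by (rule prod.UNION_disjoint) (use J' in auto)
      also have "\<dots> = (\<Prod>i\<in>UNIV. \<Prod>v\<in>J' i. emeasure K (A (i # v)))"
        by (rule prod.cong[OF refl], subst prod.reindex) (auto simp: inj_on_def)
      finally show ?thesis by (simp add: E(2))
    qed
    finally show "emeasure (distr (K \<Otimes>\<^sub>M PiM UNIV (\<lambda>_. Q)) Q join_weights)
        (prod_emb UNIV (\<lambda>_. K) J (Pi\<^sub>E J F)) = (\<Prod>j\<in>J. emeasure K (F j))" .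
  qed
qed

section \<open>The functionals as measurable functions of tree and weights\<close>

lemma borel_measurable_edge_weight:
  "(\<lambda>z. edge_weight z u v) \<in> borel_measurable (PiM UNIV (\<lambda>_ :: 'b list. borel :: (real^'b::finite) measure))"
proof -
  have "(\<lambda>z. z w $ i) \<in> borel_measurable (PiM UNIV (\<lambda>_ :: 'b list. borel :: (real^'b) measure))"
    for w :: "'b list" and i
    by (rule measurable_compose[where f = "\<lambda>z. z w" and g = "\<lambda>x. x $ i",
        OF measurable_component_singleton[OF UNIV_I] borel_measurable_nth])
  then show ?thesis unfolding edge_weight_def by simp
qed

lemma borel_measurable_node_dist:
  "(\<lambda>z. node_dist z u v) \<in> borel_measurable (PiM UNIV (\<lambda>_ :: 'b list. borel :: (real^'b::finite) measure))"
  unfolding node_dist_def path_weight_def by (intro borel_measurable_sum borel_measurable_edge_weight)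

definition tree_vec :: "('b list \<Rightarrow> real^'b) \<Rightarrow> 'b list set \<Rightarrow> real^2" where
  "tree_vec z S = vector [wiener_index z S, internal_path_length z S]"

lemma tree_vec_nth [simp]:
  "tree_vec z S $ 1 = wiener_index z S" "tree_vec z S $ 2 = internal_path_length z S"
  by (simp_all add: tree_vec_def)

lemma vec2_eq_iff: "(x :: real^2) = y \<longleftrightarrow> x $ 1 = y $ 1 \<and> x $ 2 = y $ 2"
  by (simp add: vec_eq_iff forall_2)

lemma vec2_eq_axis: "(x :: real^2) = (x $ 1) *\<^sub>R axis 1 1 + (x $ 2) *\<^sub>R axis 2 1"
  by (simp add: vec2_eq_iff axis_def)

lemma mat2_mult_nth:
  "((vector [vector [a, b], vector [c, d]] :: real^2^2) *v x) $ 1 = a * x $ 1 + b * x $ 2"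
  "((vector [vector [a, b], vector [c, d]] :: real^2^2) *v x) $ 2 = c * x $ 1 + d * x $ 2"
  by (simp_all add: matrix_vector_mult_def sum_2)

lemma borel_measurable_vec2:
  fixes f :: "'c \<Rightarrow> real^2"
  assumes "(\<lambda>x. f x $ 1) \<in> borel_measurable N" "(\<lambda>x. f x $ 2) \<in> borel_measurable N"
  shows "f \<in> borel_measurable N"
proof -
  have "f = (\<lambda>x. (f x $ 1) *\<^sub>R axis 1 1 + (f x $ 2) *\<^sub>R axis 2 1)"
    by (intro ext vec2_eq_axis)
  moreover have "(\<lambda>x. (f x $ 1) *\<^sub>R axis 1 1 + (f x $ 2) *\<^sub>R (axis 2 1 :: real^2)) \<in> borel_measurable N"
    using assms by (intro borel_measurable_add borel_measurable_scaleR) auto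
  ultimately show ?thesis by simp
qed

lemma borel_measurable_matrix_vector_mult:
  "(\<lambda>x. (A :: real^2^2) *v x) \<in> borel_measurable borel"
  by (intro borel_measurable_continuous_onI linear_continuous_on)
     (simp flip: linear_conv_bounded_linear)

text \<open>
  There are uncountably many node sets, but only countably many finite ones, and on the infinite
  ones all sums are 0 by convention.
\<close>

lemma borel_measurable_tree_vec:
  "(\<lambda>(S, z). tree_vec z S) \<in> borel_measurable
     (count_space UNIV \<Otimes>\<^sub>M PiM UNIV (\<lambda>_ :: 'b list. borel :: (real^'b::finite) measure))"
proof -
  let ?N = "count_space (UNIV :: 'b list set set) \<Otimes>\<^sub>M PiM UNIV (\<lambda>_ :: 'b list. borel :: (real^'b) measure)"
  define g where "g S = (if finite S then S else {})" for S :: "'b list set"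
  have g: "tree_vec z S = tree_vec z (g S)" for z :: "'b list \<Rightarrow> real^'b" and S
    by (simp add: g_def tree_vec_def wiener_index_def internal_path_length_def)
  have "(\<lambda>x. tree_vec (snd x) (g (fst x))) \<in> borel_measurable ?N"
  proof (rule measurable_compose_countable'[where I = "{S. finite S}"])
    fix S :: "'b list set"
    have "(\<lambda>z. tree_vec z S) \<in> borel_measurable (PiM UNIV (\<lambda>_ :: 'b list. borel :: (real^'b) measure))"
      unfolding wiener_index_def internal_path_length_def node_depth_def
      by (intro borel_measurable_vec2)
         (auto simp: wiener_index_def internal_path_length_def node_depth_def
           intro!: borel_measurable_sum borel_measurable_node_dist borel_measurable_divide)
    then show "(\<lambda>x. tree_vec (snd x) S) \<in> borel_measurable ?N" by measurable
    show "(\<lambda>x. g (fst x)) \<in> measurable ?N (count_space {S. finite S})"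
      by (rule measurable_compose[OF measurable_fst]) (auto simp: g_def)
    show "countable {S :: 'b list set. finite S}"
      by (rule countable_Collect_finite)
  qed
  then show ?thesis by (simp add: case_prod_beta flip: g)
qed

section \<open>From exponential moments to the tail bound\<close>

text \<open>
  On a bounded range of \<open>\<tau> = t / D\<close> all regimes dominate a Gaussian tail, the linear ones by
  completing the square and the last one because \<open>ln x \<le> x - 1\<close>.  Beyond that range only the
  last one, with the exponent of a Poisson tail, remains.  A cumulant bound \<open>\<epsilon> l\<^sup>2 exp (\<epsilon> l)\<close>
  with \<open>\<epsilon>\<close> small yields both by Chernoff's inequality, with \<open>l\<close> proportional to \<open>\<tau>\<close> and
  \<open>l = ln \<tau>\<close>.
\<close>

lemma tail_bound_dominates:
  "\<exists>\<epsilon>>0. \<forall>D>0. \<forall>t>0. \<exists>l>0. exp (\<epsilon> * l\<^sup>2 * exp (\<epsilon> * l) - l * (t / D)) \<le> tail_bound D t"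
proof -
  define g where "g = \<gamma>_const"
  \<comment> \<open>beyond \<open>m\<close> only the last regime remains, and \<open>ln \<tau>\<close> is positive\<close>
  define m where "m = max (max (5 * g) (C_const 1)) (max (48 * L\<^sub>0) (max (4 * exp L\<^sub>0) 1))"
  \<comment> \<open>half of this dominates both Gaussian coefficients \<open>1 / (10 g\<^sup>2)\<close> and \<open>1 / 96\<close>\<close>
  define a where "a = 1 / (5 * g\<^sup>2) + 1"
  define \<epsilon> where "\<epsilon> = min (1 / 16) (min (1 / (a * m)) (1 / (6 * a)))"
  have m: "m > 0" by (simp add: m_def less_max_iff_disj)
  have a: "a \<ge> 1" by (simp add: a_def)
  have \<epsilon>: "\<epsilon> > 0" "\<epsilon> \<le> 1 / 16" "\<epsilon> \<le> 1 / (a * m)" "\<epsilon> \<le> 1 / (6 * a)"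
    using m a by (auto simp: \<epsilon>_def)
  have "\<exists>l>0. exp (\<epsilon> * l\<^sup>2 * exp (\<epsilon> * l) - l * (t / D)) \<le> tail_bound D t"
    if D: "D > 0" and t: "t > 0" for D t
  proof -
    define \<tau> where "\<tau> = t / D"
    have \<tau>: "\<tau> > 0" and t\<tau>: "t = D * \<tau>" using D t by (auto simp: \<tau>_def)
    have C: "C_const D = D * C_const 1" by (simp add: C_const_def algebra_simps)
    have tail: "tail_bound D t =
      (if \<tau> \<le> 5 * g then exp (- (\<tau>\<^sup>2 / (10 * g\<^sup>2)))
       else if \<tau> \<le> C_const 1 then exp (5 / 2 - \<tau> / g)
       else if \<tau> \<le> 48 * L\<^sub>0 then exp (- (\<tau>\<^sup>2 / 96))
       else if \<tau> \<le> 4 * exp L\<^sub>0 then exp (24 * L\<^sub>0\<^sup>2 - L\<^sub>0 * \<tau>)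
       else exp (\<tau> - \<tau> * ln (\<tau> / 4)))"
    proof -
      have "t \<le> 5 * \<gamma>_const * D \<longleftrightarrow> \<tau> \<le> 5 * g" "t \<le> C_const D \<longleftrightarrow> \<tau> \<le> C_const 1"
        "t \<le> 48 * D * L\<^sub>0 \<longleftrightarrow> \<tau> \<le> 48 * L\<^sub>0" "t \<le> 4 * D * exp L\<^sub>0 \<longleftrightarrow> \<tau> \<le> 4 * exp L\<^sub>0"
        using D unfolding C by (simp_all add: \<tau>_def g_def field_simps)
      moreover have "t\<^sup>2 / (10 * \<gamma>_const\<^sup>2 * D\<^sup>2) = \<tau>\<^sup>2 / (10 * g\<^sup>2)" "t / (\<gamma>_const * D) = \<tau> / g"
        "t\<^sup>2 / (96 * D\<^sup>2) = \<tau>\<^sup>2 / 96" "L\<^sub>0 / D * t = L\<^sub>0 * \<tau>" "t / (4 * D) = \<tau> / 4"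
        "t / D = \<tau>"
        using D by (simp_all add: t\<tau> g_def power_mult_distrib)
      ultimately show ?thesis by (simp only: tail_bound_def)
    qed
    show ?thesis
    proof (cases "\<tau> \<le> m")
      case True
      have "\<epsilon> * (a * \<tau>) \<le> 1 / (a * m) * (a * m)"
        using \<epsilon> True a \<tau> m by (intro mult_mono) auto
      then have "exp (\<epsilon> * (a * \<tau>)) \<le> exp 1" using a m by simp
      then have e3: "exp (\<epsilon> * (a * \<tau>)) \<le> 3" using exp_le by linarith
      have "\<epsilon> * a \<le> 1 / (6 * a) * a" using \<epsilon> a by (intro mult_right_mono) auto
      then have "\<epsilon> * a * exp (\<epsilon> * (a * \<tau>)) \<le> 1 / 6 * 3"
        using e3 a \<epsilon> by (intro mult_mono) auto
      then have "a * \<tau>\<^sup>2 * (\<epsilon> * a * exp (\<epsilon> * (a * \<tau>))) \<le> a * \<tau>\<^sup>2 * (1 / 2)"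
        using a by (intro mult_left_mono) auto
      then have exponent: "\<epsilon> * (a * \<tau>)\<^sup>2 * exp (\<epsilon> * (a * \<tau>)) - a * \<tau> * \<tau> \<le> - (a / 2 * \<tau>\<^sup>2)"
        by (simp add: power2_eq_square algebra_simps)
      have gauss1: "- (a / 2 * \<tau>\<^sup>2) \<le> - (\<tau>\<^sup>2 / (10 * g\<^sup>2))"
      proof -
        have "1 / (10 * g\<^sup>2) * \<tau>\<^sup>2 \<le> a / 2 * \<tau>\<^sup>2"
          by (intro mult_right_mono) (auto simp: a_def)
        then show ?thesis by simp
      qed
      have gauss2: "- (a / 2 * \<tau>\<^sup>2) \<le> - (\<tau>\<^sup>2 / 96)"
      proof -
        have "1 / 96 * \<tau>\<^sup>2 \<le> a / 2 * \<tau>\<^sup>2" using a by (intro mult_right_mono) auto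
        then show ?thesis by simp
      qed
      have square1: "- (\<tau>\<^sup>2 / (10 * g\<^sup>2)) \<le> 5 / 2 - \<tau> / g"
      proof -
        have "0 \<le> (\<tau> / g - 5)\<^sup>2 / 10" by simp
        also have "\<dots> = \<tau>\<^sup>2 / (10 * g\<^sup>2) - \<tau> / g + 5 / 2"
          by (simp add: power2_eq_square algebra_simps add_divide_distrib diff_divide_distrib)
        finally show ?thesis by linarith
      qed
      have square2: "- (\<tau>\<^sup>2 / 96) \<le> 24 * L\<^sub>0\<^sup>2 - L\<^sub>0 * \<tau>"
      proof -
        have "0 \<le> (\<tau> - 48 * L\<^sub>0)\<^sup>2" by simp
        then show ?thesis by (simp add: power2_eq_square algebra_simps)
      qed
      have poisson: "- (a / 2 * \<tau>\<^sup>2) \<le> \<tau> - \<tau> * ln (\<tau> / 4)"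
      proof -
        have "\<tau> * ln (\<tau> / 4) \<le> \<tau> * (\<tau> / 4 - 1)"
          using \<tau> by (intro mult_left_mono ln_le_minus_one) auto
        also have "\<dots> = 1 / 4 * \<tau>\<^sup>2 - \<tau>" by (simp add: power2_eq_square algebra_simps)
        finally have "\<tau> * ln (\<tau> / 4) \<le> 1 / 4 * \<tau>\<^sup>2 - \<tau>" .
        moreover have "1 / 4 * \<tau>\<^sup>2 \<le> a / 2 * \<tau>\<^sup>2" using a by (intro mult_right_mono) auto
        ultimately show ?thesis using \<tau> by linarith
      qed
      have "exp (\<epsilon> * (a * \<tau>)\<^sup>2 * exp (\<epsilon> * (a * \<tau>)) - a * \<tau> * \<tau>) \<le> tail_bound D t"
        unfolding tail using exponent gauss1 gauss2 square1 square2 poisson by auto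
      then show ?thesis
        using a \<tau> unfolding \<tau>_def[symmetric] by (intro exI[of _ "a * \<tau>"]) auto
    next
      case False
      then have tail5: "tail_bound D t = exp (\<tau> - \<tau> * ln (\<tau> / 4))"
        unfolding tail m_def by auto
      define l where "l = ln \<tau>"
      have "1 < \<tau>" using False by (simp add: m_def)
      then have l: "l > 0" "exp l = \<tau>" by (auto simp: l_def)
      have "l\<^sup>2 \<le> 8 * exp (l / 2)"
        using exp_lower_Taylor_quadratic[of "l / 2"] l by (simp add: power2_eq_square field_simps)
      then have "\<epsilon> * l\<^sup>2 \<le> 1 / 16 * (8 * exp (l / 2))"
        using \<epsilon> by (intro mult_mono) auto
      moreover have "exp (\<epsilon> * l) \<le> exp (l / 2)"
        using \<epsilon>(2) l by (subst exp_le_cancel_iff) (auto intro: order_trans[OF mult_right_mono[of \<epsilon> "1/16" l]])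
      ultimately have "\<epsilon> * l\<^sup>2 * exp (\<epsilon> * l) \<le> 1 / 16 * (8 * exp (l / 2)) * exp (l / 2)"
        by (rule mult_mono) simp_all
      also have "\<dots> = \<tau> / 2"
        using l by (simp flip: exp_add)
      finally have half: "\<epsilon> * l\<^sup>2 * exp (\<epsilon> * l) \<le> \<tau> / 2" .
      have "\<epsilon> * l\<^sup>2 * exp (\<epsilon> * l) - l * \<tau> \<le> \<tau> - \<tau> * ln (\<tau> / 4)"
      proof -
        have "ln (\<tau> / 4) = l - ln 4" using \<tau> by (simp add: l_def ln_div)
        then have "\<tau> * ln (\<tau> / 4) = l * \<tau> - \<tau> * ln 4"
          by (simp only: right_diff_distrib mult.commute)
        moreover have "0 \<le> \<tau> * ln 4" using \<tau> by simp
        ultimately show ?thesis using half \<tau> by linarith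
      qed
      then show ?thesis
        using l unfolding tail5 \<tau>_def[symmetric] by (intro exI[of _ l]) auto
    qed
  qed
  then show ?thesis using \<epsilon>(1) by blast
qed

section \<open>One step of the recursion for exponential moments\<close>

text \<open>
  A centred toll \<open>\<delta>\<close> is compensated by the decrease \<open>G\<close> of the sum of squares.  The
  arithmetic-geometric mean inequality separates the two; the moment of \<open>\<delta>\<close> is at most
  \<open>exp (2 l\<^sup>2 D\<^sup>2)\<close> by Hoeffding's lemma and at most \<open>exp (2 \<bar>l\<bar> D)\<close> trivially.  For the Laplace
  transform of \<open>G\<close>, log-convexity gives the decay needed for small \<open>l\<close> from its value at one point.
\<close>

lemma toll_compensation:
  fixes \<delta> G :: "'c \<Rightarrow> real"
  assumes "prob_space N"
    and [measurable]: "\<delta> \<in> borel_measurable N" "G \<in> borel_measurable N"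
    and bound: "AE x in N. \<bar>\<delta> x\<bar> \<le> D" and mean: "(\<integral>x. \<delta> x \<partial>N) = 0"
    and G_nonneg: "AE x in N. 0 \<le> G x"
    and laplace: "\<And>y. y > 0 \<Longrightarrow> (\<integral>x. exp (- y * G x) \<partial>N) \<le> c / sqrt y"
    and "D > 0" "c > 0" "L > 0" "\<bar>l\<bar> \<le> L"
  defines "K \<equiv> c\<^sup>2 * exp (4 * L * D) * D / (2 * L)"
  shows "(\<integral>\<^sup>+x. ennreal (exp (l * \<delta> x - K * l\<^sup>2 * G x)) \<partial>N) \<le> 1"
proof -
  interpret N: prob_space N by fact
  \<comment> \<open>at this point the Laplace transform of \<open>G\<close> is at most \<open>exp (- 2 L D)\<close>\<close>
  define Y where "Y = c\<^sup>2 * exp (4 * L * D)"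
  define y where "y = 2 * K * l\<^sup>2"
  define m where "m = min (2 * l\<^sup>2 * D\<^sup>2) (2 * \<bar>l\<bar> * D)"
  have Y: "Y > 0" using assms by (simp add: Y_def)
  have K: "K > 0" "2 * L * K = Y * D" using assms Y by (simp_all add: K_def Y_def)
  have y: "y \<ge> 0" using K by (simp add: y_def)
  have int_G: "integrable N (\<lambda>x. exp (- s * G x))" if "s \<ge> 0" for s
  proof (rule N.integrable_const_bound[where B = 1])
    show "AE x in N. norm (exp (- s * G x)) \<le> 1"
      using G_nonneg by eventually_elim (use that in auto)
  qed measurable
  have int_\<delta>: "integrable N (\<lambda>x. exp (s * \<delta> x))" for s
  proof (rule N.integrable_const_bound[where B = "exp (\<bar>s\<bar> * D)"])
    show "AE x in N. norm (exp (s * \<delta> x)) \<le> exp (\<bar>s\<bar> * D)"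
      using bound
    proof eventually_elim
      case (elim x)
      have "s * \<delta> x \<le> \<bar>s\<bar> * \<bar>\<delta> x\<bar>" by (metis abs_ge_self abs_mult)
      also have "\<dots> \<le> \<bar>s\<bar> * D" using elim by (intro mult_left_mono) auto
      finally show ?case by simp
    qed
  qed measurable
  have toll: "(\<integral>x. exp (2 * l * \<delta> x) \<partial>N) \<le> exp m"
  proof -
    have "(\<integral>x. exp (2 * l * \<delta> x) \<partial>N) \<le> exp (2 * \<bar>l\<bar> * D)"
    proof -
      have "(\<integral>x. exp (2 * l * \<delta> x) \<partial>N) \<le> (\<integral>x. exp (2 * \<bar>l\<bar> * D) \<partial>N)"
      proof (intro integral_mono_AE int_\<delta>)
        show "AE x in N. exp (2 * l * \<delta> x) \<le> exp (2 * \<bar>l\<bar> * D)"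
          using bound
        proof eventually_elim
          case (elim x)
          have "l * \<delta> x \<le> \<bar>l\<bar> * \<bar>\<delta> x\<bar>" by (metis abs_ge_self abs_mult)
          also have "\<dots> \<le> \<bar>l\<bar> * D" using elim by (intro mult_left_mono) auto
          finally show ?case by simp
        qed
      qed simp
      then show ?thesis by (simp add: N.prob_space)
    qed
    moreover have "(\<integral>x. exp (2 * l * \<delta> x) \<partial>N) \<le> exp (2 * l\<^sup>2 * D\<^sup>2)"
    proof -
      have pos: "(\<integral>x. exp (s * f x) \<partial>N) \<le> exp (s\<^sup>2 * D\<^sup>2 / 2)"
        if s: "s > 0" and f[measurable]: "f \<in> borel_measurable N"
          and fb: "AE x in N. f x \<in> {- D..D}" and fm: "(\<integral>x. f x \<partial>N) = 0" for s f
      proof -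
        interpret interval_bounded_random_variable N f "- D" D
          by unfold_locales (use fb in auto)
        have "(\<integral>\<^sup>+x. ennreal (exp (s * f x)) \<partial>N) \<le> ennreal (exp (s\<^sup>2 * (D - - D)\<^sup>2 / 8))"
          by (rule Hoeffdings_lemma_nn_integral_0[OF s fm])
        also have "s\<^sup>2 * (D - - D)\<^sup>2 / 8 = s\<^sup>2 * D\<^sup>2 / 2" by (simp add: power2_eq_square)
        finally show ?thesis
          by (intro integral_real_bounded) auto
      qed
      have b: "AE x in N. \<delta> x \<in> {- D..D}" "AE x in N. - \<delta> x \<in> {- D..D}"
        using bound by (auto elim!: eventually_mono)
      consider "l = 0" | "l > 0" | "l < 0" by linarith
      then show ?thesis
      proof cases
        case 1 then show ?thesis by (simp add: N.prob_space)
      next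
        case 2 then show ?thesis using pos[of "2 * l" \<delta>] b mean by (simp add: power_mult_distrib mult_ac)
      next
        case 3
        then show ?thesis
          using pos[of "- 2 * l" "\<lambda>x. - \<delta> x"] b mean by (simp add: power_mult_distrib mult_ac)
      qed
    qed
    ultimately show ?thesis by (simp add: m_def min_def)
  qed
  have "(\<integral>x. exp (- Y * G x) \<partial>N) \<le> c / sqrt Y" by (rule laplace[OF Y])
  also have "sqrt Y = c * exp (2 * L * D)"
    unfolding Y_def using assms
    by (intro real_sqrt_unique) (auto simp: power_mult_distrib simp flip: exp_double)
  also have "c / (c * exp (2 * L * D)) = exp (- (2 * L * D))"
    using assms by (simp add: exp_minus field_simps)
  finally have at_Y: "(\<integral>x. exp (- Y * G x) \<partial>N) \<le> exp (- (2 * L * D))" .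
  have spread: "(\<integral>x. exp (- y * G x) \<partial>N) \<le> exp (- m)"
  proof (cases "y \<le> Y")
    case True
    define \<theta> where "\<theta> = y / Y"
    have \<theta>: "0 \<le> \<theta>" "\<theta> \<le> 1" "y = \<theta> * Y" using y Y True by (auto simp: \<theta>_def)
    have "exp (- y * G x + (1 - \<theta>) * (- (2 * L * D)))
        \<le> \<theta> * exp (- Y * G x) + (1 - \<theta>) * exp (- (2 * L * D))" for x
      using convex_onD[OF exp_convex, of "1 - \<theta>" "- Y * G x" "- (2 * L * D)"] \<theta>
      by (simp add: mult.assoc)
    then have "(\<integral>x. exp (- y * G x + (1 - \<theta>) * (- (2 * L * D))) \<partial>N)
        \<le> (\<integral>x. \<theta> * exp (- Y * G x) + (1 - \<theta>) * exp (- (2 * L * D)) \<partial>N)"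
    proof (intro integral_mono)
      show "integrable N (\<lambda>x. exp (- y * G x + (1 - \<theta>) * (- (2 * L * D))))"
        using int_G[OF y] by (simp only: exp_add integrable_mult_left_iff) simp
      show "integrable N (\<lambda>x. \<theta> * exp (- Y * G x) + (1 - \<theta>) * exp (- (2 * L * D)))"
        using int_G[of Y] Y by (intro Bochner_Integration.integrable_add integrable_mult_right) auto
    qed
    also have "\<dots> = \<theta> * (\<integral>x. exp (- Y * G x) \<partial>N) + (1 - \<theta>) * exp (- (2 * L * D))"
      using Y int_G[of Y] by (simp add: N.prob_space)
    also have "\<dots> \<le> \<theta> * exp (- (2 * L * D)) + (1 - \<theta>) * exp (- (2 * L * D))"
      using at_Y \<theta> by (intro add_right_mono mult_left_mono) auto
    also have "\<dots> = exp (- (2 * L * D))" by (simp add: algebra_simps)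
    finally have "(\<integral>x. exp (- y * G x) \<partial>N) * exp ((1 - \<theta>) * (- (2 * L * D))) \<le> exp (- (2 * L * D))"
      by (simp only: exp_add integral_mult_left_zero)
    then have "(\<integral>x. exp (- y * G x) \<partial>N)
        \<le> exp (- (2 * L * D)) / exp ((1 - \<theta>) * (- (2 * L * D)))"
      by (subst pos_le_divide_eq) auto
    also have "\<dots> = exp (- (2 * L * D * \<theta>))"
      by (simp add: algebra_simps flip: exp_diff)
    also have "2 * L * D * \<theta> = 2 * l\<^sup>2 * D\<^sup>2"
    proof -
      have "2 * L * D * \<theta> * Y = 2 * l\<^sup>2 * D * (2 * L * K)"
        using \<theta> by (simp add: y_def algebra_simps)
      also have "\<dots> = 2 * l\<^sup>2 * D * (Y * D)" by (simp only: K(2))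
      also have "\<dots> = 2 * l\<^sup>2 * D\<^sup>2 * Y" by (simp add: power2_eq_square)
      finally show ?thesis using Y by simp
    qed
    finally show ?thesis by (rule order_trans) (simp add: m_def)
  next
    case False
    have "(\<integral>x. exp (- y * G x) \<partial>N) \<le> (\<integral>x. exp (- Y * G x) \<partial>N)"
      using False Y y G_nonneg by (intro integral_mono_AE int_G) (auto elim!: eventually_mono intro!: mult_right_mono)
    also note at_Y
    also have "exp (- (2 * L * D)) \<le> exp (- m)"
    proof -
      have "\<bar>l\<bar> * D \<le> L * D" using assms by (intro mult_right_mono) auto
      then show ?thesis by (simp add: m_def)
    qed
    finally show ?thesis .
  qed
  have amgm: "exp (l * \<delta> x - K * l\<^sup>2 * G x)
      \<le> exp (2 * l * \<delta> x) * exp (- m) / 2 + exp (- y * G x) * exp m / 2" for x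
  proof -
    have "0 \<le> (exp (l * \<delta> x - m / 2) - exp (- y * G x / 2 + m / 2))\<^sup>2" by simp
    also have "\<dots> = exp (2 * (l * \<delta> x - m / 2)) + exp (2 * (- y * G x / 2 + m / 2))
        - 2 * exp ((l * \<delta> x - m / 2) + (- y * G x / 2 + m / 2))"
    proof -
      have "(exp u - exp v)\<^sup>2 = exp (2 * u) + exp (2 * v) - 2 * exp (u + v)" for u v :: real
        by (simp add: power2_diff exp_double exp_add)
      then show ?thesis by blast
    qed
    also have "(l * \<delta> x - m / 2) + (- y * G x / 2 + m / 2) = l * \<delta> x - K * l\<^sup>2 * G x"
      by (simp add: y_def)
    also have "exp (2 * (l * \<delta> x - m / 2)) = exp (2 * l * \<delta> x) * exp (- m)"
      by (simp add: algebra_simps flip: exp_add)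
    also have "exp (2 * (- y * G x / 2 + m / 2)) = exp (- y * G x) * exp m"
      by (simp add: algebra_simps flip: exp_add)
    finally show ?thesis by simp
  qed
  have "(\<integral>\<^sup>+x. ennreal (exp (l * \<delta> x - K * l\<^sup>2 * G x)) \<partial>N)
      \<le> (\<integral>\<^sup>+x. ennreal (exp (2 * l * \<delta> x) * exp (- m) / 2 + exp (- y * G x) * exp m / 2) \<partial>N)"
    by (intro nn_integral_mono ennreal_leI amgm)
  also have "\<dots> = ennreal (\<integral>x. exp (2 * l * \<delta> x) * exp (- m) / 2 + exp (- y * G x) * exp m / 2 \<partial>N)"
    using int_\<delta>[of "2 * l"] int_G[OF y] by (intro nn_integral_eq_integral) auto
  also have "\<dots> \<le> ennreal 1"
  proof (rule ennreal_leI)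
    have "(\<integral>x. exp (2 * l * \<delta> x) * exp (- m) / 2 + exp (- y * G x) * exp m / 2 \<partial>N)
        = (\<integral>x. exp (2 * l * \<delta> x) \<partial>N) * exp (- m) / 2 + (\<integral>x. exp (- y * G x) \<partial>N) * exp m / 2"
      using int_\<delta>[of "2 * l"] int_G[OF y] by simp
    also have "\<dots> \<le> exp m * exp (- m) / 2 + exp (- m) * exp m / 2"
      using toll spread by (intro add_mono divide_right_mono mult_right_mono) auto
    also have "\<dots> = 1" by (simp flip: exp_add)
    finally show "(\<integral>x. exp (2 * l * \<delta> x) * exp (- m) / 2 + exp (- y * G x) * exp m / 2 \<partial>N) \<le> 1" .
  qed
  finally show ?thesis by simp
qed

section \<open>The recursion for the rescaled vector\<close>

text \<open>
  The arity occurs as a number \<open>B\<close> among the parameters, so that constants depending on it can be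
  defined without reference to the type of labels; \<open>\<kappa>\<close> bounds the weights.
\<close>

locale random_weighted_tree = prob_space M for M :: "'a measure" +
  fixes T :: "nat \<Rightarrow> 'a \<Rightarrow> 'b::finite list set" and Z :: "'b list \<Rightarrow> 'a \<Rightarrow> real^'b" and \<kappa> B :: real
  assumes B_eq: "B = real CARD('b)" and arity: "CARD('b) \<ge> 2"
    and tree_law: "\<And>n. distr M (count_space UNIV) (T n) = measure_pmf (bary_tree n)"
    and weights_indep: "indep_vars (\<lambda>_. borel) Z UNIV"
    and weights_law: "\<And>u. distr M borel (Z u) = distr M borel (Z [])"
    and tree_weights_indep: "\<And>n. indep_set
      (sets (vimage_algebra (space M) (T n) (count_space UNIV)))
      (sets (vimage_algebra (space M) (\<lambda>\<omega> u. Z u \<omega>) (\<Pi>\<^sub>M u\<in>UNIV. borel)))"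
    and entries_law: "\<And>i j. distr M borel (\<lambda>\<omega>. Z [] \<omega> $ i) = distr M borel (\<lambda>\<omega>. Z [] \<omega> $ j)"
    and weights_nonneg: "AE \<omega> in M. \<forall>i. 0 \<le> Z [] \<omega> $ i"
    and weights_bounded: "AE \<omega> in M. norm (Z [] \<omega>) \<le> \<kappa>"
begin

abbreviation weight_space :: "('b list \<Rightarrow> real^'b) measure" where
  "weight_space \<equiv> PiM UNIV (\<lambda>_. distr M borel (Z []))"

abbreviation Y_mean :: "nat \<Rightarrow> real^2" where "Y_mean n \<equiv> (LINT \<omega>|M. Y_vec T Z n \<omega>)"
abbreviation wiener_mean :: "nat \<Rightarrow> real" where "wiener_mean n \<equiv> (LINT \<omega>|M. wiener_rv T Z n \<omega>)"
abbreviation path_length_mean :: "nat \<Rightarrow> real" where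
  "path_length_mean n \<equiv> (LINT \<omega>|M. path_length_rv T Z n \<omega>)"

text \<open>
  Measurability of \<open>T n\<close> is a consequence of its law: an event of positive probability has
  a measurable preimage, since otherwise its measure would be 0 by convention, and every set of
  trees is an event of positive probability up to adding or removing one tree.
\<close>

lemma measurable_T [measurable]: "T n \<in> measurable M (count_space UNIV)"
proof -
  have pos: "T n -` A \<inter> space M \<in> sets M" if "emeasure (measure_pmf (bary_tree n)) A \<noteq> 0" for A
  proof (rule ccontr)
    assume "T n -` A \<inter> space M \<notin> sets M"
    then have "emeasure (distr M (count_space UNIV) (T n)) A = 0"
      by (simp add: distr_def emeasure_measure_of_conv emeasure_notin_sets)
    then show False using that tree_law by simp
  qed
  obtain S :: "'b list set" where S: "S \<in> set_pmf (bary_tree n)"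
    using set_pmf_not_empty[of "bary_tree n :: 'b list set pmf"] by (meson ex_in_conv)
  have *: "emeasure (measure_pmf (bary_tree n)) A \<noteq> 0" if "S \<in> A" for A
    using S that emeasure_pmf_single_eq_zero_iff emeasure_mono[of "{S}" A "measure_pmf (bary_tree n)"]
    by fastforce
  have "T n -` A \<inter> space M \<in> sets M" for A
  proof (cases "S \<in> A")
    case True
    then show ?thesis using pos * by blast
  next
    case False
    then have "T n -` A \<inter> space M = (T n -` insert S A \<inter> space M) - (T n -` {S} \<inter> space M)"
      by auto
    then show ?thesis using pos[OF *] by (metis insertI1 sets.Diff)
  qed
  then show ?thesis by (simp add: measurable_def)
qed

lemma measurable_Z [measurable]: "Z u \<in> borel_measurable M"
  using weights_indep by (simp add: indep_vars_def)

lemma measurable_Z_family: "(\<lambda>\<omega> u. Z u \<omega>) \<in> measurable M (PiM UNIV (\<lambda>_. borel))"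
  by (intro measurable_abs_UNIV) measurable

lemma prob_space_weight: "prob_space (distr M borel (Z u))"
  by (intro prob_space_distr) measurable

lemma prob_space_weight_space: "prob_space weight_space"
  by (intro prob_space_PiM prob_space_weight)

lemma sets_weight_space: "sets weight_space = sets (PiM UNIV (\<lambda>_. borel))"
  by (simp cong: sets_PiM_cong)

lemma Z_family_law: "distr M (PiM UNIV (\<lambda>_. borel)) (\<lambda>\<omega> u. Z u \<omega>) = weight_space"
proof -
  have "distr M (PiM UNIV (\<lambda>_. borel)) (\<lambda>\<omega>. \<lambda>u\<in>UNIV. Z u \<omega>) = PiM UNIV (\<lambda>u. distr M borel (Z u))"
    using indep_vars_iff_distr_eq_PiM[where I = UNIV and M' = "\<lambda>_. borel" and X = Z] weights_indep measurable_Z by simp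
  also have "(\<lambda>u. distr M borel (Z u)) = (\<lambda>_. distr M borel (Z []))"
    by (intro ext weights_law)
  finally show ?thesis by (simp add: restrict_UNIV)
qed

lemma joint_law:
  "distr M (count_space UNIV \<Otimes>\<^sub>M PiM UNIV (\<lambda>_. borel)) (\<lambda>\<omega>. (T n \<omega>, \<lambda>u. Z u \<omega>))
     = measure_pmf (bary_tree n) \<Otimes>\<^sub>M weight_space"
proof (rule pair_measure_eqI[symmetric])
  show "sigma_finite_measure (measure_pmf (bary_tree n :: 'b list set pmf))" by unfold_locales
  show "sigma_finite_measure weight_space"
    by (rule prob_space_imp_sigma_finite[OF prob_space_weight_space])
  let ?J = "distr M (count_space UNIV \<Otimes>\<^sub>M PiM UNIV (\<lambda>_. borel)) (\<lambda>\<omega>. (T n \<omega>, \<lambda>u. Z u \<omega>))"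
  show "sets (measure_pmf (bary_tree n) \<Otimes>\<^sub>M weight_space) = sets ?J"
    using sets_pair_measure_cong[OF _ sets_weight_space, of "measure_pmf (bary_tree n :: 'b list set pmf)" "count_space UNIV"]
    by simp
  fix A :: "'b list set set" and B assume A: "A \<in> sets (measure_pmf (bary_tree n))" and B: "B \<in> sets weight_space"
  let ?A = "T n -` A \<inter> space M" and ?B = "(\<lambda>\<omega> u. Z u \<omega>) -` B \<inter> space M"
  have B': "B \<in> sets (PiM UNIV (\<lambda>_. borel))" using B sets_weight_space by simp
  have "?A \<in> sets (vimage_algebra (space M) (T n) (count_space UNIV))"
    "?B \<in> sets (vimage_algebra (space M) (\<lambda>\<omega> u. Z u \<omega>) (PiM UNIV (\<lambda>_. borel)))"
    using B' by (auto intro: in_vimage_algebra)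
  then have "prob (?A \<inter> ?B) = prob ?A * prob ?B"
    by (rule indep_setD[OF tree_weights_indep])
  then have "emeasure M (?A \<inter> ?B) = emeasure M ?A * emeasure M ?B"
    by (simp add: emeasure_eq_measure ennreal_mult)
  moreover have "emeasure M ?A = emeasure (measure_pmf (bary_tree n)) A"
    by (subst emeasure_distr[OF measurable_T, of A n, symmetric]) (simp_all add: tree_law)
  moreover have "emeasure M ?B = emeasure weight_space B"
    by (subst emeasure_distr[OF measurable_Z_family B', symmetric]) (simp add: Z_family_law)
  moreover have "emeasure ?J (A \<times> B) = emeasure M (?A \<inter> ?B)"
    using B' measurable_Pair[OF measurable_T measurable_Z_family]
    by (subst emeasure_distr) (auto intro!: arg_cong[of _ _ "emeasure M"])
  ultimately show "emeasure (measure_pmf (bary_tree n)) A * emeasure weight_space B = emeasure ?J (A \<times> B)"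
    by simp
qed

lemma nn_integral_tree_weights:
  assumes f: "f \<in> borel_measurable (count_space UNIV \<Otimes>\<^sub>M PiM UNIV (\<lambda>_. borel))"
  shows "(\<integral>\<^sup>+\<omega>. f (T n \<omega>, \<lambda>u. Z u \<omega>) \<partial>M)
    = (\<integral>\<^sup>+S. \<integral>\<^sup>+z. f (S, z) \<partial>weight_space \<partial>measure_pmf (bary_tree n))"
proof -
  interpret N: prob_space weight_space by (rule prob_space_weight_space)
  have "(\<integral>\<^sup>+\<omega>. f (T n \<omega>, \<lambda>u. Z u \<omega>) \<partial>M)
      = integral\<^sup>N (distr M (count_space UNIV \<Otimes>\<^sub>M PiM UNIV (\<lambda>_. borel)) (\<lambda>\<omega>. (T n \<omega>, \<lambda>u. Z u \<omega>))) f"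
    by (subst nn_integral_distr) (auto intro: f measurable_Pair measurable_T measurable_Z_family)
  also have "\<dots> = (\<integral>\<^sup>+S. \<integral>\<^sup>+z. f (S, z) \<partial>weight_space \<partial>measure_pmf (bary_tree n))"
    unfolding joint_law
  proof (rule N.nn_integral_fst[symmetric])
    have "sets (measure_pmf (bary_tree n) \<Otimes>\<^sub>M weight_space)
        = sets (count_space UNIV \<Otimes>\<^sub>M PiM UNIV (\<lambda>_. borel))"
      by (intro sets_pair_measure_cong sets_weight_space) simp
    then show "f \<in> borel_measurable (measure_pmf (bary_tree n) \<Otimes>\<^sub>M weight_space)"
      using f by (subst measurable_cong_sets) auto
  qed
  finally show ?thesis .
qed

lemma AE_T: "AE \<omega> in M. T n \<omega> \<in> set_pmf (bary_tree n)"
proof -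
  have "AE S in distr M (count_space UNIV) (T n). S \<in> set_pmf (bary_tree n)"
    unfolding tree_law by (simp add: AE_measure_pmf)
  then show ?thesis by (subst (asm) AE_distr_iff) (auto intro: measurable_T)
qed

lemma sizes_law:
  "distr M (count_space UNIV) (sizes_rv T (Suc n)) = measure_pmf (sizes_chain n)"
proof -
  have "distr M (count_space UNIV) (sizes_rv T (Suc n))
      = distr (distr M (count_space UNIV) (T (Suc n))) (count_space UNIV) subtree_sizes"
    by (subst distr_distr) (auto intro: measurable_T simp: sizes_rv_def[abs_def] o_def)
  then show ?thesis
    by (simp add: tree_law subtree_sizes_bary_tree flip: map_pmf_rep_eq)
qed

section \<open>Bounds and integrability\<close>

definition good_weights :: "('b list \<Rightarrow> real^'b) \<Rightarrow> bool" where
  "good_weights z \<longleftrightarrow> (\<forall>u i. 0 \<le> z u $ i \<and> z u $ i \<le> \<kappa>)"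

lemma AE_entry: "AE x in distr M borel (Z []). \<forall>i. 0 \<le> x $ i \<and> x $ i \<le> \<kappa>"
proof (subst AE_distr_iff)
  show "AE \<omega> in M. \<forall>i. 0 \<le> Z [] \<omega> $ i \<and> Z [] \<omega> $ i \<le> \<kappa>"
    using weights_nonneg weights_bounded
  proof eventually_elim
    case (elim \<omega>)
    then show ?case using component_le_norm_cart[of "Z [] \<omega>"] by (meson abs_le_D1 order_trans)
  qed
  show "{x \<in> space borel. \<forall>i. 0 \<le> x $ i \<and> x $ i \<le> \<kappa>} \<in> sets (borel :: (real^'b) measure)"
    by measurable
qed measurable

lemma AE_good_weights: "AE \<omega> in M. good_weights (\<lambda>u. Z u \<omega>)"
  unfolding good_weights_def
proof (rule AE_all_countable[THEN iffD2, rule_format])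
  fix u
  have "AE x in distr M borel (Z u). \<forall>i. 0 \<le> x $ i \<and> x $ i \<le> \<kappa>"
    by (subst weights_law) (rule AE_entry)
  then show "AE \<omega> in M. \<forall>i. 0 \<le> Z u \<omega> $ i \<and> Z u \<omega> $ i \<le> \<kappa>"
    by (rule AE_distrD[rotated]) measurable
qed

lemma node_dist_bound: "\<exists>c. \<forall>z. good_weights z \<longrightarrow> 0 \<le> node_dist z u v \<and> node_dist z u v \<le> c"
proof -
  obtain xs where xs: "simple_path u v xs" using simple_path_exists by blast
  have "0 \<le> path_weight z xs \<and> path_weight z xs \<le> (\<Sum>k<length xs - 1. \<kappa>)" if "good_weights z" for z
  proof -
    have "0 \<le> edge_weight z x y" "edge_weight z x y \<le> \<kappa>" for x y
      using that by (simp_all add: edge_weight_def good_weights_def)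
    then show ?thesis unfolding path_weight_def by (intro conjI sum_nonneg sum_mono)
  qed
  then show ?thesis using node_dist_path[OF xs] by metis
qed

lemma tree_vec_bound:
  "\<exists>c. \<forall>z. good_weights z \<longrightarrow> \<bar>wiener_index z S\<bar> \<le> c \<and> \<bar>internal_path_length z S\<bar> \<le> c"
proof -
  obtain c where c: "\<And>u v z. good_weights z \<Longrightarrow> 0 \<le> node_dist z u v \<and> node_dist z u v \<le> c u v"
    using node_dist_bound by metis
  have "\<bar>wiener_index z S\<bar> \<le> (\<Sum>u\<in>S. \<Sum>v\<in>S. c u v) / 2
      \<and> \<bar>internal_path_length z S\<bar> \<le> (\<Sum>u\<in>S. c [] u)" if z: "good_weights z" for z
  proof -
    have "(\<Sum>u\<in>S. \<Sum>v\<in>S. node_dist z u v) \<le> (\<Sum>u\<in>S. \<Sum>v\<in>S. c u v)"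
      using c[OF z] by (intro sum_mono) blast
    moreover have "0 \<le> (\<Sum>u\<in>S. \<Sum>v\<in>S. node_dist z u v)"
      using c[OF z] by (intro sum_nonneg) blast
    moreover have "(\<Sum>u\<in>S. node_dist z [] u) \<le> (\<Sum>u\<in>S. c [] u)"
      using c[OF z] by (intro sum_mono) blast
    moreover have "0 \<le> (\<Sum>u\<in>S. node_dist z [] u)"
      using c[OF z] by (intro sum_nonneg) blast
    ultimately show ?thesis
      by (auto simp: wiener_index_def internal_path_length_def node_depth_def)
  qed
  then show ?thesis
    by (intro exI[of _ "max ((\<Sum>u\<in>S. \<Sum>v\<in>S. c u v) / 2) (\<Sum>u\<in>S. c [] u)"])
       (metis max.coboundedI1 max.coboundedI2)
qed

lemma AE_tree_vec_bound:
  "\<exists>c. AE \<omega> in M. \<bar>wiener_rv T Z n \<omega>\<bar> \<le> c \<and> \<bar>path_length_rv T Z n \<omega>\<bar> \<le> c"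
proof -
  obtain c where c: "\<And>S z. good_weights z \<Longrightarrow> \<bar>wiener_index z S\<bar> \<le> c S \<and> \<bar>internal_path_length z S\<bar> \<le> c S"
    using tree_vec_bound by metis
  define C where "C = Max (c ` set_pmf (bary_tree n))"
  have "AE \<omega> in M. \<bar>wiener_rv T Z n \<omega>\<bar> \<le> C \<and> \<bar>path_length_rv T Z n \<omega>\<bar> \<le> C"
    using AE_T[of n] AE_good_weights
  proof eventually_elim
    case (elim \<omega>)
    then have "c (T n \<omega>) \<le> C"
      unfolding C_def by (intro Max_ge) (auto simp: finite_support_bary_tree)
    then show ?case
      using c[OF elim(2), of "T n \<omega>"] by (auto simp: wiener_rv_def path_length_rv_def)
  qed
  then show ?thesis by blast
qed

lemma measurable_tree_vec_T:
  "(\<lambda>\<omega>. tree_vec (\<lambda>u. Z u \<omega>) (T n \<omega>)) \<in> borel_measurable M"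
  using measurable_compose[OF measurable_Pair[OF measurable_T measurable_Z_family]
      borel_measurable_tree_vec] by simp

lemma Y_vec_eq: "Y_vec T Z n \<omega> = tree_vec (\<lambda>u. Z u \<omega>) (T n \<omega>)"
  by (simp add: Y_vec_def tree_vec_def wiener_rv_def path_length_rv_def)

lemma
  shows integrable_wiener_rv: "integrable M (wiener_rv T Z n)"
    and integrable_path_length_rv: "integrable M (path_length_rv T Z n)"
proof -
  obtain c where c: "AE \<omega> in M. \<bar>wiener_rv T Z n \<omega>\<bar> \<le> c \<and> \<bar>path_length_rv T Z n \<omega>\<bar> \<le> c"
    using AE_tree_vec_bound by blast
  have nth: "(\<lambda>\<omega>. tree_vec (\<lambda>u. Z u \<omega>) (T n \<omega>) $ j) \<in> borel_measurable M" for j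
    by (rule measurable_compose[OF measurable_tree_vec_T borel_measurable_nth])
  have m: "wiener_rv T Z n \<in> borel_measurable M" "path_length_rv T Z n \<in> borel_measurable M"
    using nth[of 1] nth[of 2] by (simp_all add: wiener_rv_def[abs_def] path_length_rv_def[abs_def])
  show "integrable M (wiener_rv T Z n)" "integrable M (path_length_rv T Z n)"
    using c by (auto intro!: integrable_const_bound[where B = c] m simp: AE_conj_iff)
qed

lemma Y_mean_nth: "Y_mean n $ 1 = wiener_mean n" "Y_mean n $ 2 = path_length_mean n"
proof -
  have int: "integrable M (Y_vec T Z n)"
  proof -
    have "Y_vec T Z n = (\<lambda>\<omega>. wiener_rv T Z n \<omega> *\<^sub>R axis 1 1 + path_length_rv T Z n \<omega> *\<^sub>R axis 2 1)"
      by (intro ext, subst vec2_eq_axis) (simp add: Y_vec_def)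
    then show ?thesis
      by (simp only:) (intro Bochner_Integration.integrable_add integrable_scaleR_left
          integrable_wiener_rv integrable_path_length_rv)
  qed
  have "Y_mean n $ j = (LINT \<omega>|M. Y_vec T Z n \<omega> $ j)" for j
    by (rule integral_bounded_linear[OF bounded_linear_vec_nth int, symmetric])
  then show "Y_mean n $ 1 = wiener_mean n" "Y_mean n $ 2 = path_length_mean n"
    by (simp_all add: Y_vec_def)
qed

section \<open>The pathwise recursion\<close>

text \<open>
  \<^const>\<open>X_vec\<close> as a function of the tree and the weights, which has to be evaluated at
  the subtrees.
\<close>

definition rescaled :: "nat \<Rightarrow> 'b list set \<Rightarrow> ('b list \<Rightarrow> real^'b) \<Rightarrow> real^2" where
  "rescaled n S z = (vector [vector [1 / real n ^ 2, 0], vector [0, 1 / real n]] :: real^2^2)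
     *v (tree_vec z S - Y_mean n)"

lemma X_vec_eq: "X_vec M T Z n \<omega> = rescaled n (T n \<omega>) (\<lambda>u. Z u \<omega>)"
  by (simp add: X_vec_def rescaled_def Y_vec_eq)

lemma rescaled_nth:
  "rescaled n S z $ 1 = (wiener_index z S - wiener_mean n) / real n ^ 2"
  "rescaled n S z $ 2 = (internal_path_length z S - path_length_mean n) / real n"
  by (simp_all add: rescaled_def mat2_mult_nth Y_mean_nth)

lemma X_vec_nth:
  "X_vec M T Z n \<omega> $ 1 = (wiener_rv T Z n \<omega> - wiener_mean n) / real n ^ 2"
  "X_vec M T Z n \<omega> $ 2 = (path_length_rv T Z n \<omega> - path_length_mean n) / real n"
  by (simp_all add: X_vec_eq rescaled_nth wiener_rv_def path_length_rv_def)

lemma means_0: "wiener_mean 0 = 0" "path_length_mean 0 = 0"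
proof -
  have "AE \<omega> in M. T 0 \<omega> = {}" using AE_T[of 0] by simp
  then have "AE \<omega> in M. wiener_rv T Z 0 \<omega> = 0" "AE \<omega> in M. path_length_rv T Z 0 \<omega> = 0"
    by (auto elim!: eventually_mono
        simp: wiener_rv_def path_length_rv_def wiener_index_def internal_path_length_def)
  then show "wiener_mean 0 = 0" "path_length_mean 0 = 0"
    by (simp_all add: integral_eq_zero_AE)
qed

text \<open>
  An empty subtree has scaling factor \<open>1 / 0 = 0\<close>; its entries in the coefficient matrix
  vanish as well, as do its path length and Wiener index and their means.
\<close>

lemma rescaled_recursion:
  assumes "finite S" "[] \<in> S" "card S = n"
  defines "k \<equiv> subtree_sizes S"
  shows "rescaled n S z = (\<Sum>i\<in>UNIV. A_mat n k i *v rescaled (k i) (subtree S i) (subtree_weights z i))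
    + d_vec M T Z n k (z [])"
proof -
  let ?W = "\<lambda>i. wiener_index (subtree_weights z i) (subtree S i)"
  let ?P = "\<lambda>i. internal_path_length (subtree_weights z i) (subtree S i)"
  have n: "real n > 0" using assms by (auto simp: card_gt_0_iff)
  have unscale: "k i = 0 \<Longrightarrow> ?W i = wiener_mean (k i)" "k i = 0 \<Longrightarrow> ?P i = path_length_mean (k i)" for i
    using assms(1)
    by (auto simp: k_def subtree_sizes_eq means_0 wiener_index_def internal_path_length_def)
  have W: "real (k i) ^ 2 / real n ^ 2 * ((?W i - wiener_mean (k i)) / real (k i) ^ 2)
      = (?W i - wiener_mean (k i)) / real n ^ 2" for i
    using unscale[of i] by (cases "k i = 0") auto
  have P1: "real (k i) * (real n - real (k i)) / real n ^ 2 * ((?P i - path_length_mean (k i)) / real (k i))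
      = (real n - real (k i)) * (?P i - path_length_mean (k i)) / real n ^ 2" for i
    using unscale[of i] by (cases "k i = 0") auto
  have P2: "real (k i) / real n * ((?P i - path_length_mean (k i)) / real (k i))
      = (?P i - path_length_mean (k i)) / real n" for i
    using unscale[of i] by (cases "k i = 0") auto
  have "rescaled n S z $ 1 = ((\<Sum>i\<in>UNIV. ?W i + (real n - real (k i)) * ?P i
      + z [] $ i * real (k i) * (real n - real (k i))) - wiener_mean n) / real n ^ 2"
    by (simp add: rescaled_nth wiener_index_root[OF assms(1,2)] assms(3) k_def)
  also have "\<dots> = ((\<Sum>i\<in>UNIV. A_mat n k i *v rescaled (k i) (subtree S i) (subtree_weights z i))
      + d_vec M T Z n k (z [])) $ 1"
    unfolding vector_add_component sum_component A_mat_def mat2_mult_nth rescaled_nth W P1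
    by (simp add: d_vec_def Let_def sum.distrib sum_subtractf right_diff_distrib diff_divide_distrib
        add_divide_distrib flip: sum_divide_distrib)
  finally have 1: "rescaled n S z $ 1 = \<dots>" .
  have "rescaled n S z $ 2 = ((\<Sum>i\<in>UNIV. ?P i + z [] $ i * real (k i)) - path_length_mean n) / real n"
    by (simp add: rescaled_nth internal_path_length_root[OF assms(1,2)] k_def)
  also have "\<dots> = ((\<Sum>i\<in>UNIV. A_mat n k i *v rescaled (k i) (subtree S i) (subtree_weights z i))
      + d_vec M T Z n k (z [])) $ 2"
    unfolding vector_add_component sum_component A_mat_def mat2_mult_nth rescaled_nth P2
    by (simp add: d_vec_def Let_def sum.distrib sum_subtractf diff_divide_distrib
        add_divide_distrib flip: sum_divide_distrib)
  finally show ?thesis using 1 by (simp add: vec2_eq_iff)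
qed

section \<open>The recursion in law\<close>

abbreviation X_law :: "nat \<Rightarrow> (real^2) measure" where
  "X_law n \<equiv> distr M borel (X_vec M T Z n)"

abbreviation subtrees_X_law :: "('b \<Rightarrow> nat) \<Rightarrow> ('b \<Rightarrow> real^2) measure" where
  "subtrees_X_law k \<equiv> PiM UNIV (\<lambda>i. X_law (k i))"

lemma measurable_rescaled:
  "(\<lambda>(S, z). rescaled n S z) \<in> borel_measurable (count_space UNIV \<Otimes>\<^sub>M PiM UNIV (\<lambda>_. borel))"
proof -
  have "(\<lambda>x. (\<lambda>(S, z). tree_vec z S) x - Y_mean n)
      \<in> borel_measurable (count_space UNIV \<Otimes>\<^sub>M PiM UNIV (\<lambda>_ :: 'b list. borel :: (real^'b) measure))"
    by (intro borel_measurable_diff borel_measurable_tree_vec) simp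
  from measurable_compose[OF this borel_measurable_matrix_vector_mult] show ?thesis
    by (simp add: rescaled_def case_prod_beta)
qed

lemma measurable_rescaled_tree: "rescaled n S \<in> borel_measurable (PiM UNIV (\<lambda>_. borel))"
  using measurable_compose[OF measurable_Pair1' measurable_rescaled, of S n] by simp

lemma measurable_X_vec [measurable]: "X_vec M T Z n \<in> borel_measurable M"
  using measurable_compose[OF measurable_Pair[OF measurable_T measurable_Z_family] measurable_rescaled]
  by (simp add: X_vec_eq[abs_def])

lemma prob_space_X_law: "prob_space (X_law n)"
  by (intro prob_space_distr) measurable

lemma nn_integral_X_law:
  assumes [measurable]: "f \<in> borel_measurable borel"
  shows "(\<integral>\<^sup>+x. f x \<partial>X_law n)
    = (\<integral>\<^sup>+S. \<integral>\<^sup>+z. f (rescaled n S z) \<partial>weight_space \<partial>measure_pmf (bary_tree n))"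
proof -
  have "(\<integral>\<^sup>+x. f x \<partial>X_law n) = (\<integral>\<^sup>+\<omega>. f (rescaled n (T n \<omega>) (\<lambda>u. Z u \<omega>)) \<partial>M)"
    by (subst nn_integral_distr) (simp_all add: X_vec_eq)
  also have "\<dots> = (\<integral>\<^sup>+S. \<integral>\<^sup>+z. f (rescaled n S z) \<partial>weight_space \<partial>measure_pmf (bary_tree n))"
    using nn_integral_tree_weights[of "\<lambda>(S, z). f (rescaled n S z)" n]
      measurable_compose[OF measurable_rescaled assms] by (simp add: case_prod_beta)
  finally show ?thesis .
qed

text \<open>
  Independent pairs of a tree and a weight family, one for each label, give independent rescaled
  vectors.
\<close>

lemma subtrees_law:
  assumes f: "f \<in> borel_measurable (PiM UNIV (\<lambda>_ :: 'b. borel))"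
  shows "(\<integral>\<^sup>+s. \<integral>\<^sup>+y. f (\<lambda>i. rescaled (k i) (s i) (y i)) \<partial>PiM UNIV (\<lambda>_ :: 'b. weight_space)
      \<partial>measure_pmf (Pi_pmf UNIV {} (\<lambda>i. bary_tree (k i))))
    = (\<integral>\<^sup>+x. f x \<partial>subtrees_X_law k)"
proof -
  let ?S = "measure_pmf (Pi_pmf UNIV {} (\<lambda>i. bary_tree (k i) :: 'b list set pmf))"
  let ?Y = "PiM UNIV (\<lambda>_ :: 'b. weight_space)"
  define F where "F = (\<lambda>(s :: 'b \<Rightarrow> 'b list set, y) i. rescaled (k i) (s i) (y i))"
  interpret N: prob_space weight_space by (rule prob_space_weight_space)
  interpret Y: product_prob_space "\<lambda>_ :: 'b. weight_space" UNIV ..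
  interpret X: prob_space "X_law n" for n by (rule prob_space_X_law)
  interpret XP: product_prob_space "\<lambda>i. X_law (k i)" UNIV ..
  have comp: "(\<lambda>x. F x i) \<in> borel_measurable (?S \<Otimes>\<^sub>M ?Y)" for i
  proof -
    have "(\<lambda>x. fst x i) \<in> measurable (?S \<Otimes>\<^sub>M ?Y) (count_space UNIV)"
      by (rule measurable_compose[OF measurable_fst]) simp
    moreover have "(\<lambda>x. snd x i) \<in> measurable (?S \<Otimes>\<^sub>M ?Y) (PiM UNIV (\<lambda>_. borel))"
      using measurable_compose[OF measurable_snd measurable_component_singleton[of i]]
      by (simp add: measurable_cong_sets[OF refl sets_weight_space])
    ultimately have "(\<lambda>x. (fst x i, snd x i)) \<in> measurable (?S \<Otimes>\<^sub>M ?Y)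
        (count_space UNIV \<Otimes>\<^sub>M PiM UNIV (\<lambda>_. borel))"
      by (rule measurable_Pair)
    from measurable_compose[OF this measurable_rescaled] show ?thesis
      by (simp add: F_def case_prod_beta)
  qed
  have F: "F \<in> measurable (?S \<Otimes>\<^sub>M ?Y) (PiM UNIV (\<lambda>_. borel))"
    using measurable_abs_UNIV[of "\<lambda>i x. F x i", OF comp] by simp
  have law: "distr (?S \<Otimes>\<^sub>M ?Y) (PiM UNIV (\<lambda>_. borel)) F = subtrees_X_law k"
  proof (rule XP.PiM_eqI)
    show "sets (distr (?S \<Otimes>\<^sub>M ?Y) (PiM UNIV (\<lambda>_. borel)) F) = sets (subtrees_X_law k)"
      by (simp cong: sets_PiM_cong)
    fix A assume "\<And>i. i \<in> UNIV \<Longrightarrow> A i \<in> sets (X_law (k i))"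
    then have A [measurable]: "A i \<in> sets borel" for i by simp
    have A': "Pi\<^sub>E UNIV A \<in> sets (PiM UNIV (\<lambda>_ :: 'b. borel :: (real^2) measure))"
      using A by (intro sets_PiM_I_finite) auto
    have ind: "(\<lambda>y. indicator (A i) (rescaled (k i) S y)) \<in> borel_measurable weight_space" for i S
      using measurable_compose[OF measurable_rescaled_tree borel_measurable_indicator[OF A]]
      by (simp add: measurable_cong_sets[OF sets_weight_space refl])
    have "emeasure (distr (?S \<Otimes>\<^sub>M ?Y) (PiM UNIV (\<lambda>_. borel)) F) (Pi\<^sub>E UNIV A)
        = (\<integral>\<^sup>+x. indicator (Pi\<^sub>E UNIV A) (F x) \<partial>(?S \<Otimes>\<^sub>M ?Y))"
      using A' F by (simp flip: nn_integral_indicator add: nn_integral_distr)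
    also have "\<dots> = (\<integral>\<^sup>+s. \<integral>\<^sup>+y. indicator (Pi\<^sub>E UNIV A) (F (s, y)) \<partial>?Y \<partial>?S)"
      by (rule Y.P.nn_integral_fst[symmetric])
         (rule measurable_compose[OF F borel_measurable_indicator[OF A']])
    also have "\<dots> = (\<integral>\<^sup>+s. \<integral>\<^sup>+y. (\<Prod>i\<in>UNIV. indicator (A i) (rescaled (k i) (s i) (y i))) \<partial>?Y \<partial>?S)"
      by (intro nn_integral_cong) (auto simp: F_def indicator_def PiE_iff prod_eq_1_iff intro!: prod_zero)
    also have "\<dots> = (\<integral>\<^sup>+s. (\<Prod>i\<in>UNIV. \<integral>\<^sup>+y. indicator (A i) (rescaled (k i) (s i) y) \<partial>weight_space) \<partial>?S)"
      by (intro nn_integral_cong Y.product_nn_integral_prod) (simp_all add: ind)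
    also have "\<dots> = (\<Prod>i\<in>UNIV. \<integral>\<^sup>+S. \<integral>\<^sup>+y. indicator (A i) (rescaled (k i) S y) \<partial>weight_space
        \<partial>measure_pmf (bary_tree (k i)))"
      by (rule nn_integral_prod_Pi_pmf) simp
    also have "\<dots> = (\<Prod>i\<in>UNIV. \<integral>\<^sup>+x. indicator (A i) x \<partial>X_law (k i))"
      by (intro prod.cong refl nn_integral_X_law[symmetric]) measurable
    finally show "emeasure (distr (?S \<Otimes>\<^sub>M ?Y) (PiM UNIV (\<lambda>_. borel)) F) (Pi\<^sub>E UNIV A)
        = (\<Prod>i\<in>UNIV. emeasure (X_law (k i)) (A i))"
      by simp
  qed simp
  have "(\<integral>\<^sup>+x. f x \<partial>subtrees_X_law k) = (\<integral>\<^sup>+x. f (F x) \<partial>(?S \<Otimes>\<^sub>M ?Y))"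
    unfolding law[symmetric] by (rule nn_integral_distr[OF F]) (simp add: f)
  also have "\<dots> = (\<integral>\<^sup>+s. \<integral>\<^sup>+y. f (F (s, y)) \<partial>?Y \<partial>?S)"
    by (rule Y.P.nn_integral_fst[symmetric]) (rule measurable_compose[OF F f])
  finally show ?thesis by (simp add: F_def)
qed

lemma d_vec_nth:
  "d_vec M T Z n k w $ 1 = ((\<Sum>i\<in>UNIV. wiener_mean (k i) + (real n - real (k i)) * path_length_mean (k i)
     + w $ i * real (k i) * (real n - real (k i))) - wiener_mean n) / real n ^ 2"
  "d_vec M T Z n k w $ 2 =
     ((\<Sum>i\<in>UNIV. path_length_mean (k i) + w $ i * real (k i)) - path_length_mean n) / real n"
  by (simp_all add: d_vec_def Let_def)

lemma continuous_d_vec: "continuous_on A (d_vec M T Z n k)"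
proof -
  have expand: "d_vec M T Z n k = (\<lambda>w. d_vec M T Z n k w $ 1 *\<^sub>R axis 1 1 + d_vec M T Z n k w $ 2 *\<^sub>R axis 2 1)"
    by (intro ext vec2_eq_axis)
  show ?thesis
    by (subst expand, unfold d_vec_nth divide_inverse) (intro continuous_intros)
qed

lemma measurable_d_vec: "d_vec M T Z n k \<in> borel_measurable borel"
  by (intro borel_measurable_continuous_onI continuous_d_vec)

definition combine :: "nat \<Rightarrow> ('b \<Rightarrow> nat) \<Rightarrow> real^'b \<Rightarrow> ('b \<Rightarrow> real^2) \<Rightarrow> real^2" where
  "combine n k w x = (\<Sum>i\<in>UNIV. A_mat n k i *v x i) + d_vec M T Z n k w"

lemma measurable_combine:
  assumes "g \<in> borel_measurable N" "\<And>i. (\<lambda>y. h y i) \<in> borel_measurable N"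
  shows "(\<lambda>y. combine n k (g y) (h y)) \<in> borel_measurable N"
  unfolding combine_def using assms
  by (intro borel_measurable_add borel_measurable_sum
      measurable_compose[OF _ borel_measurable_matrix_vector_mult]
      measurable_compose[OF _ measurable_d_vec])

lemma measurable_combine_PiM:
  "combine n k w \<in> borel_measurable (PiM UNIV (\<lambda>_. borel))"
  using measurable_combine[of "\<lambda>_. w" "PiM UNIV (\<lambda>_. borel)" "\<lambda>x. x" n k] by simp

text \<open>
  The pathwise recursion is integrated over the weights, which split into those at the root and
  those in the subtrees, and over the tree, which splits into its subtree sizes and, given these,
  independent trees.
\<close>

theorem X_law_recursion:
  assumes f [measurable]: "f \<in> borel_measurable borel"
  shows "(\<integral>\<^sup>+x. f x \<partial>X_law (Suc n)) = (\<integral>\<^sup>+k. \<integral>\<^sup>+w. \<integral>\<^sup>+x. f (combine (Suc n) k w x)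
    \<partial>subtrees_X_law k \<partial>distr M borel (Z []) \<partial>measure_pmf (sizes_chain n))"
proof -
  let ?w = "distr M borel (Z [])" and ?Y = "PiM UNIV (\<lambda>_ :: 'b. weight_space)"
  interpret N: prob_space weight_space by (rule prob_space_weight_space)
  interpret W: prob_space ?w by (rule prob_space_weight)
  interpret Y: product_prob_space "\<lambda>_ :: 'b. weight_space" UNIV ..
  interpret WY: pair_sigma_finite ?w ?Y ..
  define H where "H s = (\<integral>\<^sup>+y. \<integral>\<^sup>+w. f (combine (Suc n) (\<lambda>i. card (s i)) w
      (\<lambda>i. rescaled (card (s i)) (s i) (y i))) \<partial>?w \<partial>?Y)" for s :: "'b \<Rightarrow> 'b list set"
  have split_tree: "(\<integral>\<^sup>+z. f (rescaled (Suc n) S z) \<partial>weight_space) = H (subtree S)"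
    if S: "S \<in> set_pmf (bary_tree (Suc n))" for S :: "'b list set"
  proof -
    have j: "join_weights \<in> measurable (?w \<Otimes>\<^sub>M ?Y) weight_space"
      by (rule measurable_join_weights)
    have r: "(\<lambda>z. f (rescaled (Suc n) S z)) \<in> borel_measurable weight_space"
      using measurable_compose[OF measurable_rescaled_tree f]
      by (simp add: measurable_cong_sets[OF sets_weight_space refl])
    have "(\<integral>\<^sup>+z. f (rescaled (Suc n) S z) \<partial>weight_space)
        = (\<integral>\<^sup>+x. f (rescaled (Suc n) S (join_weights x)) \<partial>(?w \<Otimes>\<^sub>M ?Y))"
      by (subst distr_join_weights[OF prob_space_weight, symmetric], rule nn_integral_distr[OF j])
         (simp add: r)
    also have "\<dots> = (\<integral>\<^sup>+y. \<integral>\<^sup>+w. f (rescaled (Suc n) S (join_weights (w, y))) \<partial>?w \<partial>?Y)"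
      by (rule WY.nn_integral_snd[symmetric]) (rule measurable_compose[OF j r])
    also have "\<dots> = H (subtree S)"
      unfolding H_def combine_def
      using rescaled_recursion[OF bary_tree_finite[OF S] bary_tree_root[OF S] bary_tree_card[OF S]]
      by (simp add: subtree_sizes_eq)
    finally show ?thesis .
  qed
  have "(\<integral>\<^sup>+x. f x \<partial>X_law (Suc n)) = (\<integral>\<^sup>+S. H (subtree S) \<partial>measure_pmf (bary_tree (Suc n)))"
    unfolding nn_integral_X_law[OF f]
    by (intro nn_integral_cong_AE AE_pmfI split_tree)
  also have "\<dots> = (\<integral>\<^sup>+k. \<integral>\<^sup>+s. H s \<partial>measure_pmf (Pi_pmf UNIV {} (\<lambda>i. bary_tree (k i)))
      \<partial>measure_pmf (sizes_chain n))"
    by (simp flip: nn_integral_map_pmf add: subtrees_of_bary_tree nn_integral_bind_pmf)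
  also have "\<dots> = (\<integral>\<^sup>+k. \<integral>\<^sup>+w. \<integral>\<^sup>+x. f (combine (Suc n) k w x)
    \<partial>subtrees_X_law k \<partial>?w \<partial>measure_pmf (sizes_chain n))"
  proof (rule nn_integral_cong)
    fix k :: "'b \<Rightarrow> nat"
    interpret X: prob_space "X_law m" for m by (rule prob_space_X_law)
    interpret XP: product_prob_space "\<lambda>i. X_law (k i)" UNIV ..
    interpret WX: pair_sigma_finite ?w "subtrees_X_law k" ..
    have sets_X: "sets (subtrees_X_law k) = sets (PiM UNIV (\<lambda>_. borel))"
      by (simp cong: sets_PiM_cong)
    have joint: "(\<lambda>(w, x). f (combine (Suc n) k w x))
        \<in> borel_measurable (?w \<Otimes>\<^sub>M subtrees_X_law k)"
      unfolding case_prod_beta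
    proof (intro measurable_compose[OF _ f] measurable_combine)
      show "fst \<in> borel_measurable (?w \<Otimes>\<^sub>M subtrees_X_law k)" by simp
      show "(\<lambda>y. snd y i) \<in> borel_measurable (?w \<Otimes>\<^sub>M subtrees_X_law k)" for i
        using measurable_compose[OF measurable_snd measurable_component_singleton[of i UNIV "\<lambda>i. X_law (k i)"]]
        by simp
    qed
    have g: "(\<lambda>x. \<integral>\<^sup>+w. f (combine (Suc n) k w x) \<partial>?w) \<in> borel_measurable (PiM UNIV (\<lambda>_. borel))"
      using W.borel_measurable_nn_integral_fst[OF measurable_compose[OF measurable_pair_swap' joint]]
      by (simp add: measurable_cong_sets[OF sets_X refl] case_prod_beta)
    have "(\<integral>\<^sup>+s. H s \<partial>measure_pmf (Pi_pmf UNIV {} (\<lambda>i. bary_tree (k i))))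
      = (\<integral>\<^sup>+s. \<integral>\<^sup>+y. \<integral>\<^sup>+w. f (combine (Suc n) k w (\<lambda>i. rescaled (k i) (s i) (y i))) \<partial>?w \<partial>?Y
          \<partial>measure_pmf (Pi_pmf UNIV {} (\<lambda>i. bary_tree (k i))))"
    proof (intro nn_integral_cong_AE AE_pmfI)
      fix s :: "'b \<Rightarrow> 'b list set" assume "s \<in> set_pmf (Pi_pmf UNIV {} (\<lambda>i. bary_tree (k i)))"
      then have "card (s i) = k i" for i
        by (intro bary_tree_card) (auto simp: set_Pi_pmf PiE_dflt_def)
      then show "H s = (\<integral>\<^sup>+y. \<integral>\<^sup>+w. f (combine (Suc n) k w (\<lambda>i. rescaled (k i) (s i) (y i))) \<partial>?w \<partial>?Y)"
        by (simp add: H_def)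
    qed
    also have "\<dots> = (\<integral>\<^sup>+x. \<integral>\<^sup>+w. f (combine (Suc n) k w x) \<partial>?w \<partial>subtrees_X_law k)"
      by (rule subtrees_law[OF g])
    also have "\<dots> = (\<integral>\<^sup>+w. \<integral>\<^sup>+x. f (combine (Suc n) k w x) \<partial>subtrees_X_law k \<partial>?w)"
      by (rule WX.Fubini'[OF joint])
    finally show "(\<integral>\<^sup>+s. H s \<partial>measure_pmf (Pi_pmf UNIV {} (\<lambda>i. bary_tree (k i)))) = \<dots>" .
  qed
  finally show ?thesis .
qed

theorem X_law_eq_recursion_law: "X_law (Suc n) = recursion_law M T Z (Suc n)"
proof -
  let ?w = "distr M borel (Z [])" and ?XX = "PiM UNIV (\<lambda>_ :: 'b. PiM UNIV X_law)"
  let ?k = "measure_pmf (sizes_chain n :: ('b \<Rightarrow> nat) pmf)"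
  interpret W: prob_space ?w by (rule prob_space_weight)
  interpret X: prob_space "X_law m" for m by (rule prob_space_X_law)
  have XF: "prob_space (PiM UNIV X_law)" by (intro prob_space_PiM prob_space_X_law)
  interpret XX: prob_space ?XX by (intro prob_space_PiM XF)
  interpret WX: pair_sigma_finite ?w ?XX ..
  define F where "F = (\<lambda>(k, w, x). combine (Suc n) k w (\<lambda>i. x i (k i)))"
  have law: "recursion_law M T Z (Suc n) = distr (?k \<Otimes>\<^sub>M (?w \<Otimes>\<^sub>M ?XX)) borel F"
    by (simp add: recursion_law_def sizes_law F_def combine_def)
  have comp: "(\<lambda>x. x i m) \<in> borel_measurable ?XX" for i m
    using measurable_compose[OF measurable_component_singleton[of i UNIV "\<lambda>_. PiM UNIV X_law"]
        measurable_component_singleton[of m UNIV X_law]] by simp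
  have Fk: "(\<lambda>x. F (k, x)) \<in> borel_measurable (?w \<Otimes>\<^sub>M ?XX)" for k
    unfolding F_def case_prod_beta fst_conv snd_conv
    by (rule measurable_combine) (simp_all add: measurable_compose[OF measurable_snd comp])
  have F: "F \<in> borel_measurable (?k \<Otimes>\<^sub>M (?w \<Otimes>\<^sub>M ?XX))"
  proof -
    have "(\<lambda>x. F (fst x, snd x)) \<in> borel_measurable (?k \<Otimes>\<^sub>M (?w \<Otimes>\<^sub>M ?XX))"
    proof (rule measurable_compose_countable'[where I = UNIV and g = fst
          and f = "\<lambda>k x. F (k, snd x)"])
      show "(\<lambda>x. F (k, snd x)) \<in> borel_measurable (?k \<Otimes>\<^sub>M (?w \<Otimes>\<^sub>M ?XX))" for k
        by (rule measurable_compose[OF measurable_snd Fk])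
      show "fst \<in> measurable (?k \<Otimes>\<^sub>M (?w \<Otimes>\<^sub>M ?XX)) (count_space UNIV)"
        using measurable_fst[of ?k "?w \<Otimes>\<^sub>M ?XX"] by simp
    qed simp
    then show ?thesis by simp
  qed
  have WXX: "prob_space (?w \<Otimes>\<^sub>M ?XX)"
    by (intro prob_space_pair W.prob_space_axioms XX.prob_space_axioms)
  show ?thesis
  proof (rule measure_eqI)
    show "sets (X_law (Suc n)) = sets (recursion_law M T Z (Suc n))"
      by (simp add: law)
    fix A assume "A \<in> sets (X_law (Suc n))"
    then have A [measurable]: "A \<in> sets borel" by simp
    have "emeasure (recursion_law M T Z (Suc n)) A
        = (\<integral>\<^sup>+x. indicator A (F x) \<partial>(?k \<Otimes>\<^sub>M (?w \<Otimes>\<^sub>M ?XX)))"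
      unfolding law using F by (simp flip: nn_integral_indicator add: nn_integral_distr)
    also have "\<dots> = (\<integral>\<^sup>+k. \<integral>\<^sup>+x. indicator A (F (k, x)) \<partial>(?w \<Otimes>\<^sub>M ?XX) \<partial>?k)"
      by (rule sigma_finite_measure.nn_integral_fst[OF prob_space_imp_sigma_finite[OF WXX], symmetric])
         (rule measurable_compose[OF F borel_measurable_indicator[OF A]])
    also have "\<dots> = (\<integral>\<^sup>+k. \<integral>\<^sup>+w. \<integral>\<^sup>+x. indicator A (F (k, w, x)) \<partial>?XX \<partial>?w \<partial>?k)"
      by (intro nn_integral_cong XX.nn_integral_fst[symmetric])
         (rule measurable_compose[OF Fk borel_measurable_indicator[OF A]])
    also have "\<dots> = (\<integral>\<^sup>+k. \<integral>\<^sup>+w. \<integral>\<^sup>+x. indicator A (combine (Suc n) k w x)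
        \<partial>subtrees_X_law k \<partial>?w \<partial>?k)"
    proof (intro nn_integral_cong)
      fix k :: "'b \<Rightarrow> nat" and w
      have c: "(\<lambda>x. x (k i)) \<in> borel_measurable (PiM UNIV X_law)" for i
        using measurable_component_singleton[of "k i" UNIV X_law] by simp
      have "distr (PiM UNIV X_law) borel (\<lambda>x. x (k i)) = X_law (k i)" for i
        using distr_PiM_component[of UNIV X_law "k i"] prob_space_X_law
        by (metis UNIV_I distr_cong sets_distr)
      then have law_k: "subtrees_X_law k = distr ?XX (PiM UNIV (\<lambda>_. borel)) (\<lambda>x i. x i (k i))"
        using distr_PiM_componentwise[of "\<lambda>_. PiM UNIV X_law" "\<lambda>i x. x (k i)" "\<lambda>_. borel", OF XF c]
        by simp
      have "(\<lambda>x i. x i (k i)) \<in> measurable ?XX (PiM UNIV (\<lambda>_. borel))"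
        by (intro measurable_abs_UNIV comp)
      then have "(\<integral>\<^sup>+x. indicator A (combine (Suc n) k w x) \<partial>subtrees_X_law k)
          = (\<integral>\<^sup>+x. indicator A (combine (Suc n) k w (\<lambda>i. x i (k i))) \<partial>?XX)"
        unfolding law_k
        by (rule nn_integral_distr)
           (simp add: measurable_compose[OF measurable_combine_PiM borel_measurable_indicator[OF A]])
      then show "(\<integral>\<^sup>+x. indicator A (F (k, w, x)) \<partial>?XX)
          = (\<integral>\<^sup>+x. indicator A (combine (Suc n) k w x) \<partial>subtrees_X_law k)"
        by (simp add: F_def)
    qed
    also have "\<dots> = (\<integral>\<^sup>+x. indicator A x \<partial>X_law (Suc n))"
      by (rule X_law_recursion[symmetric]) measurable
    finally show "emeasure (X_law (Suc n)) A = emeasure (recursion_law M T Z (Suc n)) A"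
      by simp
  qed
qed

section \<open>Mean path length\<close>

definition entry_mean :: real where "entry_mean = (LINT \<omega>|M. Z [] \<omega> $ undefined)"

lemma AE_entry_Z: "AE \<omega> in M. 0 \<le> Z u \<omega> $ i \<and> Z u \<omega> $ i \<le> \<kappa>"
  using AE_good_weights by eventually_elim (simp add: good_weights_def)

lemma measurable_Z_nth [measurable]: "(\<lambda>\<omega>. Z u \<omega> $ i) \<in> borel_measurable M"
  by (rule measurable_compose[OF measurable_Z borel_measurable_nth])

lemma integrable_Z_nth: "integrable M (\<lambda>\<omega>. Z u \<omega> $ i)"
proof (rule integrable_const_bound[where B = \<kappa>])
  show "AE \<omega> in M. norm (Z u \<omega> $ i) \<le> \<kappa>"
    using AE_entry_Z[of u i] by eventually_elim simp
qed measurable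

lemma integral_Z_nth: "(LINT \<omega>|M. Z u \<omega> $ i) = entry_mean"
proof -
  have "(LINT \<omega>|M. Z u \<omega> $ i) = (LINT x|distr M borel (Z u). x $ i)"
    by (subst integral_distr) (auto intro: borel_measurable_nth)
  also have "\<dots> = (LINT x|distr M borel (Z []). x $ i)" by (subst weights_law) simp
  also have "\<dots> = (LINT \<omega>|M. Z [] \<omega> $ i)"
    by (subst integral_distr) (auto intro: borel_measurable_nth)
  also have "\<dots> = (LINT x|distr M borel (\<lambda>\<omega>. Z [] \<omega> $ i). x)"
    by (subst integral_distr) auto
  also have "\<dots> = (LINT x|distr M borel (\<lambda>\<omega>. Z [] \<omega> $ undefined). x)"
    by (subst entries_law[of i undefined]) simp
  also have "\<dots> = entry_mean"
    by (subst integral_distr) (auto simp: entry_mean_def)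
  finally show ?thesis .
qed

lemma kappa_nonneg: "0 \<le> \<kappa>"
proof -
  have "AE \<omega> in M. 0 \<le> \<kappa>" using AE_entry_Z[of "[]" undefined] by eventually_elim linarith
  then show ?thesis by simp
qed

lemma entry_mean_nonneg: "0 \<le> entry_mean"
  unfolding entry_mean_def
  by (rule integral_nonneg_AE) (use AE_entry_Z[of "[]" undefined] in \<open>auto elim!: eventually_mono\<close>)

lemma
  shows integrable_node_depth: "integrable M (\<lambda>\<omega>. node_depth (\<lambda>w. Z (v @ w) \<omega>) u)" (is ?int)
    and integral_node_depth:
      "(LINT \<omega>|M. node_depth (\<lambda>w. Z (v @ w) \<omega>) u) = entry_mean * real (length u)" (is ?eq)
proof -
  have "?int \<and> ?eq"
  proof (induction u arbitrary: v)
    case Nil then show ?case by simp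
  next
    case (Cons i u)
    have "node_depth (\<lambda>w. Z (v @ w) \<omega>) (i # u)
        = Z v \<omega> $ i + node_depth (\<lambda>w. Z ((v @ [i]) @ w) \<omega>) u" for \<omega>
      by (simp add: node_depth_Cons)
    then show ?case
      using Cons.IH[of "v @ [i]"] integrable_Z_nth[of v i] integral_Z_nth[of v i]
      by (simp add: algebra_simps)
  qed
  then show ?int ?eq by auto
qed

lemma path_length_mean_eq: "path_length_mean n = entry_mean * mean_depth_sum TYPE('b) n"
proof -
  let ?S = "measure_pmf (bary_tree n :: 'b list set pmf)"
  interpret N: prob_space weight_space by (rule prob_space_weight_space)
  interpret SN: pair_sigma_finite ?S weight_space ..
  define f where "f = (\<lambda>(S, z :: 'b list \<Rightarrow> real^'b). internal_path_length z S)"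
  have f: "f \<in> borel_measurable (count_space UNIV \<Otimes>\<^sub>M PiM UNIV (\<lambda>_. borel))"
    using measurable_compose[OF borel_measurable_tree_vec borel_measurable_nth[of 2]]
    by (simp add: f_def case_prod_unfold)
  have TZ: "(\<lambda>\<omega>. (T n \<omega>, \<lambda>u. Z u \<omega>)) \<in> measurable M (count_space UNIV \<Otimes>\<^sub>M PiM UNIV (\<lambda>_. borel))"
    by (rule measurable_Pair[OF measurable_T measurable_Z_family])
  have P: "path_length_rv T Z n \<omega> = f (T n \<omega>, \<lambda>u. Z u \<omega>)" for \<omega>
    by (simp add: f_def path_length_rv_def)
  have "integrable (?S \<Otimes>\<^sub>M weight_space) f"
    unfolding joint_law[symmetric] using integrable_path_length_rv[of n]
    by (subst integrable_distr_eq[OF TZ f]) (simp add: P[abs_def])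
  moreover have "path_length_mean n = integral\<^sup>L (?S \<Otimes>\<^sub>M weight_space) f"
    unfolding joint_law[symmetric] by (subst integral_distr[OF TZ f]) (simp add: P[abs_def])
  ultimately have "path_length_mean n = (LINT S|?S. LINT z|weight_space. f (S, z))"
    by (simp add: SN.integral_fst')
  also have "\<dots> = (LINT S|?S. entry_mean * (\<Sum>u\<in>S. real (length u)))"
  proof (intro integral_cong_AE AE_pmfI)
    fix S :: "'b list set" assume "S \<in> set_pmf (bary_tree n)"
    have fS: "(\<lambda>z. f (S, z)) \<in> borel_measurable (PiM UNIV (\<lambda>_. borel))"
      using measurable_compose[OF measurable_Pair1' f, of S] by simp
    have "(LINT z|weight_space. f (S, z)) = (LINT \<omega>|M. (\<Sum>u\<in>S. node_depth (\<lambda>w. Z ([] @ w) \<omega>) u))"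
      unfolding Z_family_law[symmetric]
      by (subst integral_distr[OF measurable_Z_family fS]) (simp add: f_def internal_path_length_def)
    also have "\<dots> = (\<Sum>u\<in>S. entry_mean * real (length u))"
      by (subst Bochner_Integration.integral_sum[OF integrable_node_depth])
         (simp only: integral_node_depth)
    finally show "(LINT z|weight_space. f (S, z)) = entry_mean * (\<Sum>u\<in>S. real (length u))"
      by (simp add: sum_distrib_left)
  qed simp_all
  also have "\<dots> = entry_mean * mean_depth_sum TYPE('b) n"
    by (simp add: mean_depth_sum_def)
  finally show ?thesis .
qed

section \<open>Eigenfunctionals of the coefficient matrices\<close>

text \<open>
  All coefficient matrices have the row vectors \<open>(0, 1)\<close> and \<open>(-1, 1)\<close> as common left
  eigenvectors, with eigenvalues \<open>k i / n\<close> and its square.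
\<close>

definition eigenfunctional :: "nat \<Rightarrow> (real^2 \<Rightarrow> real) \<Rightarrow> bool" where
  "eigenfunctional e \<phi> \<longleftrightarrow> bounded_linear \<phi> \<and>
     (\<forall>n (k :: 'b \<Rightarrow> nat) i x. \<phi> (A_mat n k i *v x) = (real (k i) / real n) ^ e * \<phi> x)"

lemma eigenfunctional_1: "eigenfunctional 1 (\<lambda>x. x $ 2)"
  by (simp add: eigenfunctional_def bounded_linear_vec_nth A_mat_def mat2_mult_nth)

lemma eigenfunctional_2: "eigenfunctional 2 (\<lambda>x. x $ 2 - x $ 1)"
proof -
  have "real (k i) / real n * x $ 2 - (real (k i) ^ 2 / real n ^ 2 * x $ 1
      + real (k i) * (real n - real (k i)) / real n ^ 2 * x $ 2)
    = (real (k i) / real n) ^ 2 * (x $ 2 - x $ 1)" for n :: nat and k :: "'b \<Rightarrow> nat" and i and x :: "real^2"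
    by (cases "n = 0") (simp_all add: power2_eq_square field_simps)
  then show ?thesis
    by (auto simp: eigenfunctional_def A_mat_def mat2_mult_nth intro!: bounded_linear_sub)
qed

lemma eigenfunctional_combine:
  assumes "eigenfunctional e \<phi>"
  shows "\<phi> (combine n k w x) = (\<Sum>i\<in>UNIV. (real (k i) / real n) ^ e * \<phi> (x i)) + \<phi> (d_vec M T Z n k w)"
proof -
  interpret bounded_linear \<phi> using assms by (simp add: eigenfunctional_def)
  show ?thesis using assms by (simp add: combine_def add sum eigenfunctional_def)
qed

lemma borel_measurable_eigenfunctional: "eigenfunctional e \<phi> \<Longrightarrow> \<phi> \<in> borel_measurable borel"
  by (intro borel_measurable_continuous_onI linear_continuous_on) (simp add: eigenfunctional_def)

lemma AE_X_law_bound: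
  assumes "bounded_linear \<phi>"
  shows "\<exists>c\<ge>0. AE x in X_law n. \<bar>\<phi> x :: real\<bar> \<le> c"
proof -
  obtain c where c: "AE \<omega> in M. \<bar>wiener_rv T Z n \<omega>\<bar> \<le> c \<and> \<bar>path_length_rv T Z n \<omega>\<bar> \<le> c"
    using AE_tree_vec_bound by blast
  obtain K where K: "K \<ge> 0" "\<And>x. norm (\<phi> x) \<le> norm x * K"
    using bounded_linear.nonneg_bounded[OF assms] by blast
  define C where "C = (c + \<bar>wiener_mean n\<bar>) / real n ^ 2 + (c + \<bar>path_length_mean n\<bar>) / real n"
  have "AE \<omega> in M. \<bar>\<phi> (X_vec M T Z n \<omega>)\<bar> \<le> \<bar>C\<bar> * K"
    using c
  proof eventually_elim
    case (elim \<omega>)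
    have "norm (X_vec M T Z n \<omega>) \<le> \<bar>X_vec M T Z n \<omega> $ 1\<bar> + \<bar>X_vec M T Z n \<omega> $ 2\<bar>"
      using norm_le_l1_cart[of "X_vec M T Z n \<omega>"] by (simp add: sum_2)
    also have "\<dots> \<le> C"
      unfolding X_vec_nth C_def abs_divide abs_power2 abs_of_nat using elim
      by (intro add_mono divide_right_mono) auto
    finally have "norm (X_vec M T Z n \<omega>) \<le> \<bar>C\<bar>" by simp
    then show ?case using K(2)[of "X_vec M T Z n \<omega>"] mult_right_mono[OF _ K(1)] by fastforce
  qed
  then have "AE x in X_law n. \<bar>\<phi> x\<bar> \<le> \<bar>C\<bar> * K"
    using borel_measurable_continuous_onI[OF linear_continuous_on[OF assms]]
    by (subst AE_distr_iff) measurable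
  then show ?thesis using K by (intro exI[of _ "\<bar>C\<bar> * K"]) auto
qed

lemma
  assumes "bounded_linear \<phi>"
  shows integrable_X_law: "integrable (X_law n) (\<lambda>x. \<phi> x :: real)"
    and integral_X_law: "(LINT x|X_law n. \<phi> x) = 0"
proof -
  interpret X: prob_space "X_law n" by (rule prob_space_X_law)
  have int: "integrable (X_law n) (\<lambda>x. \<psi> x :: real)" if \<psi>: "bounded_linear \<psi>" for \<psi>
  proof -
    obtain c where "AE x in X_law n. \<bar>\<psi> x\<bar> \<le> c" using AE_X_law_bound[OF \<psi>] by blast
    then show ?thesis
      using borel_measurable_continuous_onI[OF linear_continuous_on[OF \<psi>]]
      by (intro X.integrable_const_bound[where B = c]) simp_all
  qed
  show "integrable (X_law n) (\<lambda>x. \<phi> x)" by (rule int[OF assms])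
  have nth: "(LINT x|X_law n. x $ j) = (LINT \<omega>|M. X_vec M T Z n \<omega> $ j)" for j
    by (subst integral_distr) (auto intro: borel_measurable_nth)
  have "(LINT x|X_law n. x $ 1) = 0" "(LINT x|X_law n. x $ 2) = 0"
    unfolding nth X_vec_nth
    by (simp_all add: integrable_wiener_rv integrable_path_length_rv prob_space)
  then have mean0: "(LINT x|X_law n. x $ j) = 0" for j
    using exhaust_2[of j] by auto
  interpret bounded_linear \<phi> by fact
  have expand: "\<phi> x = x $ 1 * \<phi> (axis 1 1) + x $ 2 * \<phi> (axis 2 1)" for x
    by (subst vec2_eq_axis) (simp add: add scaleR)
  have "(LINT x|X_law n. \<phi> x) = (LINT x|X_law n. x $ 1 * \<phi> (axis 1 1) + x $ 2 * \<phi> (axis 2 1))"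
    by (rule Bochner_Integration.integral_cong[OF refl expand])
  also have "\<dots> = (LINT x|X_law n. x $ 1) * \<phi> (axis 1 1) + (LINT x|X_law n. x $ 2) * \<phi> (axis 2 1)"
    using int[OF bounded_linear_vec_nth] by simp
  finally show "(LINT x|X_law n. \<phi> x) = 0"
    using mean0 by simp
qed

abbreviation split_space :: "nat \<Rightarrow> (('b \<Rightarrow> nat) \<times> (real^'b)) measure" where
  "split_space n \<equiv> measure_pmf (sizes_chain n) \<Otimes>\<^sub>M distr M borel (Z [])"

lemma prob_space_split: "prob_space (split_space n)"
  by (intro prob_space_pair prob_space_weight measure_pmf.prob_space_axioms)

definition good_split :: "nat \<Rightarrow> ('b \<Rightarrow> nat) \<Rightarrow> real^'b \<Rightarrow> bool" where
  "good_split n k w \<longleftrightarrow> k \<in> set_pmf (sizes_chain n) \<and> (\<forall>i. 0 \<le> w $ i \<and> w $ i \<le> \<kappa>)"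

lemma measurable_on_split:
  assumes "\<And>k. f k \<in> borel_measurable borel"
  shows "(\<lambda>(k, w). f k w) \<in> borel_measurable (split_space n)"
proof -
  have "(\<lambda>x. f (fst x) (snd x)) \<in> borel_measurable (split_space n)"
  proof (rule measurable_compose_countable'[where I = UNIV and g = fst and f = "\<lambda>k x. f k (snd x)"])
    show "(\<lambda>x. f k (snd x)) \<in> borel_measurable (split_space n)" for k
      by (rule measurable_compose[OF measurable_snd]) (simp add: assms)
    show "fst \<in> measurable (split_space n) (count_space UNIV)"
      using measurable_fst[of "measure_pmf (sizes_chain n)" "distr M borel (Z [])"] by simp
  qed simp
  then show ?thesis by (simp add: case_prod_beta)
qed

lemma AE_split: "AE (k, w) in split_space n. good_split n k w"
proof -
  interpret W: prob_space "distr M borel (Z [])" by (rule prob_space_weight)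
  interpret KW: pair_sigma_finite "measure_pmf (sizes_chain n :: ('b \<Rightarrow> nat) pmf)" "distr M borel (Z [])" ..
  show ?thesis
  proof (rule KW.AE_pair_measure)
    have [measurable]: "good_split n k \<in> measurable borel (count_space UNIV)" for k
      unfolding good_split_def by measurable
    have "{x \<in> space (split_space n). (\<lambda>(k, w). indicator {w. good_split n k w} w :: real) x = 1}
        \<in> sets (split_space n)"
      by (intro borel_measurable_eq measurable_on_split borel_measurable_const) measurable
    then show "{x \<in> space (split_space n). case x of (k, w) \<Rightarrow> good_split n k w} \<in> sets (split_space n)"
      by (simp add: indicator_def case_prod_beta)
    show "AE k in measure_pmf (sizes_chain n). AE w in distr M borel (Z []).
        case (k, w) of (k, w) \<Rightarrow> good_split n k w"
      using AE_entry by (intro AE_pmfI) (simp add: good_split_def)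
  qed
qed

lemma measurable_toll:
  assumes "eigenfunctional e \<phi>"
  shows "(\<lambda>(k, w). \<phi> (d_vec M T Z n k w)) \<in> borel_measurable (split_space m)"
  by (intro measurable_on_split measurable_compose[OF measurable_d_vec]
      borel_measurable_eigenfunctional[OF assms])

lemma d_vec_bound_fixed:
  "\<exists>c\<ge>0. \<forall>k w. good_split m k w \<longrightarrow> norm (d_vec M T Z n k w) \<le> c"
proof -
  let ?B = "cbox 0 (\<chi> i. \<kappa>) :: (real^'b) set"
  have "bounded (\<Union>k\<in>set_pmf (sizes_chain m). d_vec M T Z n k ` ?B)"
    by (intro bounded_UN finite_support_sizes_chain ballI compact_imp_bounded
        compact_continuous_image continuous_d_vec compact_cbox)
  then obtain c where "\<And>k w. k \<in> set_pmf (sizes_chain m) \<Longrightarrow> w \<in> ?B \<Longrightarrow> norm (d_vec M T Z n k w) \<le> c"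
    unfolding bounded_iff by blast
  then show ?thesis
    by (intro exI[of _ "\<bar>c\<bar>"]) (auto simp: good_split_def mem_box_cart intro: order_trans[OF _ abs_ge_self])
qed

text \<open>
  Since all rescaled vectors are centred, so are the tolls.  The recursion is available for
  nonnegative integrands, so the bounded functional is shifted by a constant \<open>C\<close>.
\<close>

lemma
  fixes n :: nat
  assumes \<phi>: "eigenfunctional e \<phi>"
  shows integrable_toll: "integrable (split_space n) (\<lambda>(k, w). \<phi> (d_vec M T Z (Suc n) k w))"
    and integral_toll: "(LINT (k, w)|split_space n. \<phi> (d_vec M T Z (Suc n) k w)) = 0"
proof -
  let ?d = "\<lambda>k w. \<phi> (d_vec M T Z (Suc n) k w)" and ?w = "distr M borel (Z [])"
  interpret S: prob_space "split_space n" by (rule prob_space_split)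
  interpret W: prob_space ?w by (rule prob_space_weight)
  interpret X: prob_space "X_law m" for m by (rule prob_space_X_law)
  have lin: "bounded_linear \<phi>" using \<phi> by (simp add: eigenfunctional_def)
  note \<phi>_meas [measurable] = borel_measurable_eigenfunctional[OF \<phi>]
  obtain K where K: "K \<ge> 0" "\<And>x. norm (\<phi> x) \<le> norm x * K"
    using bounded_linear.nonneg_bounded[OF lin] by blast
  obtain c0 where c0: "c0 \<ge> 0" "\<And>k w. good_split n k w \<Longrightarrow> norm (d_vec M T Z (Suc n) k w) \<le> c0"
    using d_vec_bound_fixed by blast
  define c where "c = c0 * K"
  have c: "\<bar>?d k w\<bar> \<le> c" if "good_split n k w" for k w
    unfolding c_def using K(2)[of "d_vec M T Z (Suc n) k w"] mult_right_mono[OF c0(2)[OF that] K(1)]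
    by simp
  show int: "integrable (split_space n) (\<lambda>(k, w). ?d k w)"
    using AE_split[of n] c
    by (intro S.integrable_const_bound[where B = c] measurable_toll[OF \<phi>])
       (auto elim!: eventually_mono)
  obtain b where b: "\<And>m. 0 \<le> b m" "\<And>m. AE x in X_law m. \<bar>\<phi> x\<bar> \<le> b m"
    using AE_X_law_bound[OF lin] by metis
  \<comment> \<open>bounds the functional on the vector of the tree and on the combination of those of the subtrees\<close>
  define C where "C = b (Suc n) + c + (\<Sum>i\<in>(UNIV :: 'b set). \<Sum>m\<le>n. b m)"
  have c_nonneg: "c \<ge> 0" using c0 K by (simp add: c_def)
  have b_sum: "0 \<le> (\<Sum>i\<in>(UNIV :: 'b set). \<Sum>m\<le>n. b m)"
    by (intro sum_nonneg) (rule b(1))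
  have C: "0 \<le> C" "b (Suc n) \<le> C" "c + (\<Sum>i\<in>(UNIV :: 'b set). \<Sum>m\<le>n. b m) \<le> C"
    using b(1)[of "Suc n"] c_nonneg b_sum unfolding C_def by linarith+
  have C': "c \<le> C" using C(3) b_sum by linarith
  have inner: "(\<integral>\<^sup>+x. ennreal (\<phi> (combine (Suc n) k w x) + C) \<partial>subtrees_X_law k)
      = ennreal (?d k w + C)" if g: "good_split n k w" for k w
  proof -
    interpret P: prob_space "subtrees_X_law k" by (intro prob_space_PiM prob_space_X_law)
    define a where "a i = (real (k i) / real (Suc n)) ^ e" for i
    have kn: "k i \<le> n" for i using sizes_chain_le g by (auto simp: good_split_def)
    have a: "0 \<le> a i" "a i \<le> 1" for i
      using kn[of i] by (auto simp: a_def intro!: power_le_one)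
    have comp: "distr (subtrees_X_law k) (X_law (k i)) (\<lambda>x. x i) = X_law (k i)" for i
      by (rule distr_PiM_component) (auto intro: prob_space_X_law)
    have proj: "(\<lambda>x. x i) \<in> measurable (subtrees_X_law k) (X_law (k i))" for i
      by (rule measurable_component_singleton) simp
    have int_x: "integrable (subtrees_X_law k) (\<lambda>x. \<phi> (x i))" for i
      using integrable_X_law[OF lin, of "k i"]
      by (subst (asm) comp[symmetric]) (rule integrable_distr[OF proj])
    have mean_x: "(LINT x|subtrees_X_law k. \<phi> (x i)) = 0" for i
      using integral_X_law[OF lin, of "k i"]
      by (subst (asm) comp[symmetric], subst (asm) integral_distr[OF proj]) auto
    have "AE x in subtrees_X_law k. \<forall>i. \<bar>\<phi> (x i)\<bar> \<le> b (k i)"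
      by (intro AE_all_countable[THEN iffD2] allI AE_PiM_component[OF prob_space_X_law _ b(2)]) simp
    then have "AE x in subtrees_X_law k. 0 \<le> (\<Sum>i\<in>UNIV. a i * \<phi> (x i)) + ?d k w + C"
    proof eventually_elim
      case (elim x)
      have "\<bar>a i * \<phi> (x i)\<bar> \<le> (\<Sum>m\<le>n. b m)" for i
      proof -
        have "\<bar>a i * \<phi> (x i)\<bar> \<le> 1 * b (k i)"
          unfolding abs_mult using a[of i] elim by (intro mult_mono) auto
        also have "\<dots> \<le> (\<Sum>m\<le>n. b m)"
          using kn[of i] b(1) by (simp add: member_le_sum)
        finally show ?thesis .
      qed
      then have "\<bar>\<Sum>i\<in>UNIV. a i * \<phi> (x i)\<bar> \<le> (\<Sum>i\<in>(UNIV :: 'b set). \<Sum>m\<le>n. b m)"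
        by (intro order_trans[OF sum_abs] sum_mono)
      then show ?case using c[OF g] C(3) by linarith
    qed
    then have "(\<integral>\<^sup>+x. ennreal ((\<Sum>i\<in>UNIV. a i * \<phi> (x i)) + ?d k w + C) \<partial>subtrees_X_law k)
        = ennreal (LINT x|subtrees_X_law k. (\<Sum>i\<in>UNIV. a i * \<phi> (x i)) + ?d k w + C)"
      using int_x by (intro nn_integral_eq_integral) auto
    also have "(LINT x|subtrees_X_law k. (\<Sum>i\<in>UNIV. a i * \<phi> (x i)) + ?d k w + C) = ?d k w + C"
      using int_x by (simp add: mean_x P.prob_space)
    finally show ?thesis by (simp add: eigenfunctional_combine[OF \<phi>] a_def)
  qed
  have "ennreal C = (\<integral>\<^sup>+x. ennreal (\<phi> x + C) \<partial>X_law (Suc n))"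
  proof -
    have "AE x in X_law (Suc n). 0 \<le> \<phi> x + C"
      using b(2)[of "Suc n"] by eventually_elim (use C in linarith)
    then have "(\<integral>\<^sup>+x. ennreal (\<phi> x + C) \<partial>X_law (Suc n)) = ennreal (LINT x|X_law (Suc n). \<phi> x + C)"
      using integrable_X_law[OF lin] by (intro nn_integral_eq_integral) auto
    also have "(LINT x|X_law (Suc n). \<phi> x + C) = C"
      using integrable_X_law[OF lin, of "Suc n"] integral_X_law[OF lin, of "Suc n"] X.prob_space[of "Suc n"] by simp
    finally show ?thesis by simp
  qed
  also have "\<dots> = (\<integral>\<^sup>+k. \<integral>\<^sup>+w. \<integral>\<^sup>+x. ennreal (\<phi> (combine (Suc n) k w x) + C)
    \<partial>subtrees_X_law k \<partial>?w \<partial>measure_pmf (sizes_chain n))"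
    by (rule X_law_recursion) measurable
  also have "\<dots> = (\<integral>\<^sup>+k. \<integral>\<^sup>+w. ennreal (?d k w + C) \<partial>?w \<partial>measure_pmf (sizes_chain n))"
  proof (intro nn_integral_cong_AE AE_pmfI)
    fix k :: "'b \<Rightarrow> nat" assume "k \<in> set_pmf (sizes_chain n)"
    then show "AE w in ?w. (\<integral>\<^sup>+x. ennreal (\<phi> (combine (Suc n) k w x) + C) \<partial>subtrees_X_law k)
        = ennreal (?d k w + C)"
      using AE_entry by (auto elim!: eventually_mono simp: inner good_split_def)
  qed
  also have "\<dots> = (\<integral>\<^sup>+x. ennreal ((\<lambda>(k, w). ?d k w) x + C) \<partial>split_space n)"
    using W.nn_integral_fst[of "\<lambda>x. ennreal ((\<lambda>(k, w). ?d k w) x + C)" "measure_pmf (sizes_chain n)"]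
      measurable_toll[OF \<phi>, of "Suc n" n] by simp
  also have "\<dots> = ennreal (LINT x|split_space n. (\<lambda>(k, w). ?d k w) x + C)"
    using int AE_split[of n] c C'
    by (intro nn_integral_eq_integral) (auto elim!: eventually_mono dest!: c)
  also have "(LINT x|split_space n. (\<lambda>(k, w). ?d k w) x + C)
      = (LINT (k, w)|split_space n. ?d k w) + C"
    using int by (simp add: S.prob_space)
  finally have "ennreal C = ennreal ((LINT (k, w)|split_space n. ?d k w) + C)" .
  moreover have "0 \<le> (LINT (k, w)|split_space n. ?d k w) + C"
  proof -
    have "AE x in split_space n. - c \<le> (\<lambda>(k, w). ?d k w) x"
      using AE_split[of n]
    proof eventually_elim
      case (elim x)
      then show ?case using c[of "fst x" "snd x"] by (auto simp: case_prod_beta)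
    qed
    then have "- c \<le> (LINT (k, w)|split_space n. ?d k w)"
      by (rule S.integral_ge_const[OF int])
    then show ?thesis using C' by linarith
  qed
  ultimately show "(LINT (k, w)|split_space n. ?d k w) = 0"
    using C(1) by (simp add: ennreal_inj)
qed

section \<open>Uniform bounds on the tolls\<close>

lemma good_split_sum:
  assumes "good_split n k w"
  shows "(\<Sum>i\<in>UNIV. k i) = n" "0 \<le> w $ i" "w $ i \<le> \<kappa>" "k i \<le> n"
  using assms sum_sizes_chain sizes_chain_le by (auto simp: good_split_def)

text \<open>The mean depth sum is additive over the subtrees up to a linear error.\<close>

lemma path_length_toll_bound:
  assumes "good_split n k w"
  shows "\<bar>d_vec M T Z (Suc n) k w $ 2\<bar> \<le> entry_mean * B\<^sup>2 + \<kappa>"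
proof -
  let ?p = "mean_depth_sum TYPE('b)"
  note k = good_split_sum[OF assms]
  have "\<bar>(\<Sum>i\<in>UNIV. ?p (k i)) - ?p (Suc n)\<bar> \<le> B\<^sup>2 * real (Suc n)"
    unfolding B_eq by (rule mean_depth_sum_split[OF arity k(1)])
  then have "\<bar>entry_mean * ((\<Sum>i\<in>UNIV. ?p (k i)) - ?p (Suc n))\<bar> \<le> entry_mean * (B\<^sup>2 * real (Suc n))"
    using entry_mean_nonneg by (simp only: abs_mult abs_of_nonneg mult_left_mono)
  moreover have "0 \<le> (\<Sum>i\<in>UNIV. w $ i * real (k i))"
    using k by (intro sum_nonneg mult_nonneg_nonneg) auto
  moreover have "(\<Sum>i\<in>UNIV. w $ i * real (k i)) \<le> (\<Sum>i\<in>UNIV. \<kappa> * real (k i))"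
    using k by (intro sum_mono mult_right_mono) auto
  moreover have "(\<Sum>i\<in>UNIV. \<kappa> * real (k i)) \<le> \<kappa> * real (Suc n)"
    using k(1) kappa_nonneg
    by (simp add: sum_distrib_left[symmetric] mult_left_mono flip: of_nat_sum)
  moreover have "(\<Sum>i\<in>UNIV. path_length_mean (k i) + w $ i * real (k i)) - path_length_mean (Suc n)
      = entry_mean * ((\<Sum>i\<in>UNIV. ?p (k i)) - ?p (Suc n)) + (\<Sum>i\<in>UNIV. w $ i * real (k i))"
    by (simp add: path_length_mean_eq sum.distrib sum_distrib_left right_diff_distrib)
  ultimately have "\<bar>(\<Sum>i\<in>UNIV. path_length_mean (k i) + w $ i * real (k i)) - path_length_mean (Suc n)\<bar>
      \<le> (entry_mean * B\<^sup>2 + \<kappa>) * real (Suc n)"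
    by (simp add: algebra_simps del: of_nat_Suc)
  then show ?thesis
    unfolding d_vec_nth abs_divide by (simp add: pos_divide_le_eq del: of_nat_Suc)
qed

definition spread_constant :: real where "spread_constant = 2 * sqrt 2 * B"

lemma spread_constant_pos: "spread_constant > 0"
proof -
  have "B > 0" by (simp add: B_eq)
  then show ?thesis by (simp add: spread_constant_def)
qed

lemma laplace_split_space:
  assumes "y > 0"
  shows "(LINT x|split_space n. exp (- y * split_spread (Suc n) (fst x))) \<le> spread_constant / sqrt y"
proof -
  interpret W: prob_space "distr M borel (Z [])" by (rule prob_space_weight)
  have "(LINT x|split_space n. exp (- y * split_spread (Suc n) (fst x)))
      = (LINT k|distr (split_space n) (measure_pmf (sizes_chain n)) fst. exp (- y * split_spread (Suc n) k))"
    by (subst integral_distr) simp_all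
  also have "distr (split_space n) (measure_pmf (sizes_chain n)) fst = measure_pmf (sizes_chain n)"
    by (rule W.distr_pair_fst)
  also have "(LINT k|measure_pmf (sizes_chain n :: ('b \<Rightarrow> nat) pmf). exp (- y * split_spread (Suc n) k))
      \<le> spread_constant / sqrt y"
    using laplace_split_spread[OF arity assms, of n] by (simp add: spread_constant_def B_eq[symmetric])
  finally show ?thesis .
qed

lemma measurable_split_spread: "(\<lambda>x. split_spread m (fst x)) \<in> borel_measurable (split_space n)"
  by (rule measurable_compose[OF measurable_fst]) simp

lemma integrable_split_spread: "integrable (split_space n) (\<lambda>x. split_spread (Suc n) (fst x))"
proof -
  interpret S: prob_space "split_space n" by (rule prob_space_split)
  show ?thesis
  proof (rule S.integrable_const_bound[where B = 1])
    show "AE x in split_space n. norm (split_spread (Suc n) (fst x)) \<le> 1"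
      using AE_split[of n]
    proof eventually_elim
      case (elim x)
      then show ?case
        using split_spread_nonneg[OF good_split_sum(1), of n "fst x" "snd x"] split_spread_le_1
        by (simp add: case_prod_beta)
    qed
  qed (rule measurable_split_spread)
qed

text \<open>
  Since \<open>1 - y G \<le> exp (- y G)\<close>, a Laplace transform of at most \<open>1 / 2\<close> at \<open>y\<close> forces the mean
  of \<open>G\<close> to be at least \<open>1 / (2 y)\<close>.
\<close>

lemma mean_split_spread:
  "(LINT x|split_space n. split_spread (Suc n) (fst x)) \<ge> 1 / (8 * spread_constant\<^sup>2)"
proof -
  interpret S: prob_space "split_space n" by (rule prob_space_split)
  define y where "y = 4 * spread_constant\<^sup>2"
  let ?G = "\<lambda>x. split_spread (Suc n) (fst x)"
  have y: "y > 0" and sqrt_y: "sqrt y = 2 * spread_constant"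
    using spread_constant_pos by (simp_all add: y_def real_sqrt_mult)
  have int: "integrable (split_space n) (\<lambda>x. exp (- y * ?G x))"
  proof (rule S.integrable_const_bound[where B = 1])
    show "AE x in split_space n. norm (exp (- y * ?G x)) \<le> 1"
      using AE_split[of n]
    proof eventually_elim
      case (elim x)
      then show ?case
        using split_spread_nonneg[OF good_split_sum(1), of n "fst x" "snd x"] y
        by (simp add: case_prod_beta)
    qed
  qed (use measurable_split_spread in measurable)
  have "1 - y * (LINT x|split_space n. ?G x) = (LINT x|split_space n. 1 - y * ?G x)"
    using integrable_split_spread by (simp add: S.prob_space)
  also have "\<dots> \<le> (LINT x|split_space n. exp (- y * ?G x))"
    using integrable_split_spread int
  proof (intro integral_mono)
    show "1 - y * ?G x \<le> exp (- y * ?G x)" for x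
      using exp_ge_add_one_self[of "- y * ?G x"] by simp
  qed simp_all
  also have "\<dots> \<le> 1 / 2"
    using laplace_split_space[OF y, of n] spread_constant_pos by (simp add: sqrt_y)
  finally have "1 / 2 \<le> y * (LINT x|split_space n. ?G x)" by simp
  then show ?thesis
    using y spread_constant_pos by (simp add: y_def field_simps)
qed

text \<open>
  An edge with \<open>s\<close> of the \<open>n\<close> nodes below it is used by \<open>s\<close> paths from the root and by
  \<open>s (n - s)\<close> paths between nodes.  Hence \<open>n P\<^sub>n - W\<^sub>n\<close>, whose mean is defined here, sums the
  weights of the edges multiplied by \<open>s\<^sup>2\<close>.
\<close>

definition square_mean :: "nat \<Rightarrow> real" where
  "square_mean n = real n * path_length_mean n - wiener_mean n"

text \<open>The second eigenfunctional turns the toll into that of the sum over squared sizes.\<close>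

lemma square_toll:
  "d_vec M T Z (Suc n) k w $ 2 - d_vec M T Z (Suc n) k w $ 1
     = ((\<Sum>i\<in>UNIV. square_mean (k i) + w $ i * real (k i) ^ 2) - square_mean (Suc n)) / real (Suc n) ^ 2"
proof -
  define N where "N = real (Suc n)"
  have N: "N > 0" by (simp add: N_def)
  let ?a = "(\<Sum>i\<in>UNIV. path_length_mean (k i) + w $ i * real (k i)) - path_length_mean (Suc n)"
  let ?b = "(\<Sum>i\<in>UNIV. wiener_mean (k i) + (N - real (k i)) * path_length_mean (k i)
     + w $ i * real (k i) * (N - real (k i))) - wiener_mean (Suc n)"
  have "d_vec M T Z (Suc n) k w $ 2 - d_vec M T Z (Suc n) k w $ 1 = ?a / N - ?b / N ^ 2"
    by (simp only: d_vec_nth N_def)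
  also have "\<dots> = (N * ?a - ?b) / N ^ 2"
    using N by (simp add: diff_divide_distrib power2_eq_square)
  also have "N * ?a - ?b = (\<Sum>i\<in>UNIV. N * (path_length_mean (k i) + w $ i * real (k i))
      - (wiener_mean (k i) + (N - real (k i)) * path_length_mean (k i)
         + w $ i * real (k i) * (N - real (k i)))) - (N * path_length_mean (Suc n) - wiener_mean (Suc n))"
    by (simp only: right_diff_distrib sum_distrib_left sum_subtractf)
  also have "(\<Sum>i\<in>UNIV. N * (path_length_mean (k i) + w $ i * real (k i))
      - (wiener_mean (k i) + (N - real (k i)) * path_length_mean (k i)
         + w $ i * real (k i) * (N - real (k i))))
    = (\<Sum>i\<in>UNIV. square_mean (k i) + w $ i * real (k i) ^ 2)"
    by (intro sum.cong refl) (simp add: square_mean_def power2_eq_square algebra_simps)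
  finally show ?thesis by (simp only: N_def square_mean_def)
qed

text \<open>The solution \<open>c\<close> of \<open>c (1 - 1 / (8 s\<^sup>2)) + \<kappa> = c\<close> for \<open>s\<close> the spread constant.\<close>

definition square_constant :: real where "square_constant = 8 * \<kappa> * spread_constant\<^sup>2"

text \<open>
  The centred toll expresses the mean at \<open>n\<close> by the means at the subtree sizes.  A quadratic bound
  reproduces itself, because the expected loss in the sum of squares absorbs the root term.
\<close>

lemma square_mean_bound: "0 \<le> square_mean n \<and> square_mean n \<le> square_constant * real n ^ 2"
proof (induction n rule: less_induct)
  case (less n)
  show ?case
  proof (cases n)
    case 0
    then show ?thesis by (simp add: square_mean_def means_0)
  next
    case (Suc m)
    interpret S: prob_space "split_space m" by (rule prob_space_split)
    define c where "c = square_constant"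
    have c: "c \<ge> 0" using kappa_nonneg by (simp add: c_def square_constant_def)
    define N where "N = real n ^ 2"
    have N: "N > 0" by (simp add: N_def Suc)
    let ?G = "\<lambda>x. split_spread n (fst x)"
    define h where "h = (\<lambda>(k :: 'b \<Rightarrow> nat, w). \<Sum>i\<in>UNIV. square_mean (k i) + w $ i * real (k i) ^ 2)"
    have toll: "(\<lambda>(k, w). d_vec M T Z n k w $ 2 - d_vec M T Z n k w $ 1) = (\<lambda>x. (h x - square_mean n) / N)"
      by (simp add: fun_eq_iff Suc square_toll h_def N_def)
    have "integrable (split_space m) (\<lambda>x. (h x - square_mean n) / N)"
      and mean: "(LINT x|split_space m. (h x - square_mean n) / N) = 0"
      unfolding toll[symmetric] unfolding Suc
      by (rule integrable_toll[OF eigenfunctional_2], rule integral_toll[OF eigenfunctional_2])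
    then have "integrable (split_space m) (\<lambda>x. (h x - square_mean n) / N * N + square_mean n)"
      by (intro Bochner_Integration.integrable_add integrable_mult_left) auto
    then have int: "integrable (split_space m) h" using N by simp
    have "(LINT x|split_space m. h x) = square_mean n"
      using mean int N by (simp add: S.prob_space)
    moreover have bounds: "AE x in split_space m. 0 \<le> h x \<and> h x \<le> c * N * (1 - ?G x) + \<kappa> * N"
      using AE_split[of m]
    proof eventually_elim
      case (elim x)
      obtain k w where x: "x = (k, w)" by (cases x)
      then have g: "good_split m k w" using elim by simp
      note k = good_split_sum[OF g]
      have IH: "0 \<le> square_mean (k i)" "square_mean (k i) \<le> c * real (k i) ^ 2" for i
        using less.IH[of "k i"] k(4)[of i] by (auto simp: Suc c_def)
      have "h x \<le> (\<Sum>i\<in>UNIV. c * real (k i) ^ 2 + \<kappa> * real (k i) ^ 2)"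
        unfolding h_def x using IH k by (auto intro!: sum_mono add_mono mult_right_mono)
      also have "\<dots> = c * (N * (1 - split_spread n k)) + \<kappa> * (N * (1 - split_spread n k))"
        using sum_squares_split[of k m] by (simp add: sum.distrib sum_distrib_left[symmetric] N_def Suc)
      also have "\<kappa> * (N * (1 - split_spread n k)) \<le> \<kappa> * (N * 1)"
        using kappa_nonneg N split_spread_nonneg[OF k(1)] by (intro mult_left_mono) (auto simp: Suc)
      finally have "h x \<le> c * N * (1 - ?G x) + \<kappa> * N" by (simp add: x mult.assoc)
      moreover have "0 \<le> h x"
        unfolding h_def x using IH k by (auto intro!: sum_nonneg add_nonneg_nonneg mult_nonneg_nonneg)
      ultimately show ?case by simp
    qed
    have "0 \<le> (LINT x|split_space m. h x)"
      by (rule integral_nonneg_AE) (use bounds in \<open>auto elim!: eventually_mono\<close>)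
    moreover have "(LINT x|split_space m. h x) \<le> c * N"
    proof -
      have G: "integrable (split_space m) ?G" using integrable_split_spread[of m] by (simp add: Suc)
      have "(LINT x|split_space m. h x) \<le> (LINT x|split_space m. c * N * (1 - ?G x) + \<kappa> * N)"
      proof (rule integral_mono_AE[OF int])
        show "AE x in split_space m. h x \<le> c * N * (1 - ?G x) + \<kappa> * N"
          using bounds by eventually_elim simp
      qed (use G in simp)
      also have "\<dots> = c * N * (1 - (LINT x|split_space m. ?G x)) + \<kappa> * N"
        using G by (simp add: S.prob_space)
      also have "\<dots> \<le> c * N * (1 - 1 / (8 * spread_constant\<^sup>2)) + \<kappa> * N"
        using mean_split_spread[of m] c N by (intro add_right_mono mult_left_mono) (auto simp: Suc)
      also have "\<dots> = c * N"
        using spread_constant_pos by (simp add: c_def square_constant_def field_simps)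
      finally show ?thesis .
    qed
    ultimately show ?thesis by (simp add: c_def N_def)
  qed
qed

lemma square_toll_bound:
  assumes "good_split n k w"
  shows "\<bar>d_vec M T Z (Suc n) k w $ 2 - d_vec M T Z (Suc n) k w $ 1\<bar> \<le> square_constant + \<kappa>"
proof -
  note k = good_split_sum[OF assms]
  define N where "N = real (Suc n) ^ 2"
  have N: "N > 0" by (simp add: N_def)
  have c: "0 \<le> square_constant" using kappa_nonneg by (simp add: square_constant_def)
  let ?h = "\<Sum>i\<in>UNIV. square_mean (k i) + w $ i * real (k i) ^ 2"
  have "?h \<le> (\<Sum>i\<in>UNIV. square_constant * real (k i) ^ 2 + \<kappa> * real (k i) ^ 2)"
    using square_mean_bound k by (intro sum_mono add_mono mult_right_mono) auto
  also have "\<dots> = (square_constant + \<kappa>) * (\<Sum>i\<in>UNIV. real (k i) ^ 2)"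
    by (simp add: sum_distrib_left distrib_right)
  also have "\<dots> \<le> (square_constant + \<kappa>) * (N * 1)"
    unfolding sum_squares_split[of k n] N_def
    using c kappa_nonneg split_spread_nonneg[OF k(1)] by (intro mult_left_mono) auto
  finally have "?h \<le> (square_constant + \<kappa>) * N" by simp
  moreover have "0 \<le> ?h"
    using square_mean_bound k by (intro sum_nonneg add_nonneg_nonneg mult_nonneg_nonneg) auto
  moreover have "0 \<le> square_mean (Suc n)" "square_mean (Suc n) \<le> square_constant * N"
    using square_mean_bound[of "Suc n"] by (auto simp: N_def)
  moreover have "0 \<le> \<kappa> * N" using kappa_nonneg N by simp
  ultimately have "\<bar>?h - square_mean (Suc n)\<bar> \<le> (square_constant + \<kappa>) * N"
    by (simp add: distrib_right)
  then show ?thesis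
    unfolding square_toll abs_divide using N by (simp add: pos_divide_le_eq N_def del: of_nat_Suc)
qed

text \<open>The summand 1 makes the bound positive also for vanishing weights.\<close>

definition toll_bound :: real where
  "toll_bound = entry_mean * B\<^sup>2 + square_constant + \<kappa> + 1"

lemma toll_bound_pos: "toll_bound > 0"
  using entry_mean_nonneg kappa_nonneg
  by (simp add: toll_bound_def square_constant_def add_nonneg_pos)

lemma toll_bounds:
  assumes "good_split n k w"
  shows "\<bar>d_vec M T Z (Suc n) k w $ 2\<bar> \<le> toll_bound"
    "\<bar>d_vec M T Z (Suc n) k w $ 2 - d_vec M T Z (Suc n) k w $ 1\<bar> \<le> toll_bound"
    "norm (d_vec M T Z (Suc n) k w) \<le> 3 * toll_bound"
proof -
  have nn: "0 \<le> entry_mean * B\<^sup>2" "0 \<le> square_constant"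
    using entry_mean_nonneg kappa_nonneg by (simp_all add: square_constant_def)
  show *: "\<bar>d_vec M T Z (Suc n) k w $ 2\<bar> \<le> toll_bound"
    "\<bar>d_vec M T Z (Suc n) k w $ 2 - d_vec M T Z (Suc n) k w $ 1\<bar> \<le> toll_bound"
    using path_length_toll_bound[OF assms] square_toll_bound[OF assms] nn
    by (auto simp: toll_bound_def)
  have "norm (d_vec M T Z (Suc n) k w) \<le> \<bar>d_vec M T Z (Suc n) k w $ 1\<bar> + \<bar>d_vec M T Z (Suc n) k w $ 2\<bar>"
    using norm_le_l1_cart[of "d_vec M T Z (Suc n) k w"] by (simp add: sum_2)
  then show "norm (d_vec M T Z (Suc n) k w) \<le> 3 * toll_bound" using * by linarith
qed

lemma AE_d_vec_bound:
  assumes "n \<ge> 1"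
  shows "AE \<omega> in M. norm (d_vec M T Z n (sizes_rv T n \<omega>) (Z [] \<omega>)) \<le> 3 * toll_bound"
proof -
  obtain m where m: "n = Suc m" using assms by (cases n) auto
  show ?thesis
    using AE_T[of n] AE_good_weights
  proof eventually_elim
    case (elim \<omega>)
    have "sizes_rv T n \<omega> \<in> subtree_sizes ` set_pmf (bary_tree (Suc m))"
      using elim(1) by (auto simp: sizes_rv_def m)
    then have "good_split m (sizes_rv T n \<omega>) (Z [] \<omega>)"
      using elim(2) by (simp add: good_split_def good_weights_def flip: subtree_sizes_bary_tree)
    then show ?case unfolding m by (rule toll_bounds(3))
  qed
qed

section \<open>Exponential moments\<close>

text \<open>The constant of the toll compensation with \<open>c\<close> the spread constant and \<open>D\<close> the toll bound.\<close>

definition cumulant_constant :: "real \<Rightarrow> real" where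
  "cumulant_constant L = spread_constant\<^sup>2 * exp (4 * L * toll_bound) * toll_bound / (2 * L)"

text \<open>
  The hypothesis for the subtrees turns the exponent \<open>K l\<^sup>2\<close> into \<open>K l\<^sup>2\<close> times the sum of the
  squared eigenvalues, which is at most \<open>K l\<^sup>2 (1 - G)\<close> for the spread \<open>G\<close> of the split.  What
  remains is the compensation of the toll by \<open>G\<close>.
\<close>

theorem exponential_moment:
  assumes \<phi>: "eigenfunctional e \<phi>" and e: "e \<ge> 1" and L: "L > 0"
    and toll: "\<And>n k w. good_split n k w \<Longrightarrow> \<bar>\<phi> (d_vec M T Z (Suc n) k w)\<bar> \<le> toll_bound"
    and "\<bar>l\<bar> \<le> L"
  shows "(\<integral>\<^sup>+x. ennreal (exp (l * \<phi> x)) \<partial>X_law n) \<le> ennreal (exp (cumulant_constant L * l\<^sup>2))"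
  using \<open>\<bar>l\<bar> \<le> L\<close>
proof (induction n arbitrary: l rule: less_induct)
  case (less n)
  define K where "K = cumulant_constant L"
  note \<phi>_meas [measurable] = borel_measurable_eigenfunctional[OF \<phi>]
  show ?case
  proof (cases n)
    case 0
    interpret bounded_linear \<phi> using \<phi> by (simp add: eigenfunctional_def)
    have "X_vec M T Z 0 \<omega> = 0" for \<omega> by (simp add: vec2_eq_iff X_vec_nth)
    then have "(\<integral>\<^sup>+x. ennreal (exp (l * \<phi> x)) \<partial>X_law 0) = 1"
      by (subst nn_integral_distr) (simp_all add: zero emeasure_space_1)
    moreover have "0 \<le> K * l\<^sup>2"
      using toll_bound_pos L by (simp add: K_def cumulant_constant_def)
    ultimately show ?thesis by (simp add: 0 K_def)
  next
    case (Suc m)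
    let ?w = "distr M borel (Z [])" and ?d = "\<lambda>k w. \<phi> (d_vec M T Z n k w)"
    interpret S: prob_space "split_space m" by (rule prob_space_split)
    interpret W: prob_space ?w by (rule prob_space_weight)
    interpret X: prob_space "X_law j" for j by (rule prob_space_X_law)
    have inner: "(\<integral>\<^sup>+x. ennreal (exp (l * \<phi> (combine n k w x))) \<partial>subtrees_X_law k)
        \<le> ennreal (exp (K * l\<^sup>2)) * ennreal (exp (l * ?d k w - K * l\<^sup>2 * split_spread n k))"
      if g: "good_split m k w" for k w
    proof -
      interpret XP: product_prob_space "\<lambda>i. X_law (k i)" UNIV ..
      define a where "a i = (real (k i) / real n) ^ e" for i
      have kn: "k i < n" for i using good_split_sum(4)[OF g, of i] by (simp add: Suc)
      have q: "0 \<le> real (k i) / real n" "real (k i) / real n \<le> 1" for i using kn[of i] by auto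
      have a: "0 \<le> a i" "a i \<le> 1" "(a i)\<^sup>2 \<le> (real (k i) / real n)\<^sup>2" for i
      proof -
        show "0 \<le> a i" "a i \<le> 1" using q[of i] by (auto simp: a_def intro!: power_le_one)
        have "a i \<le> (real (k i) / real n) ^ 1"
          unfolding a_def by (rule power_decreasing[OF e q])
        then show "(a i)\<^sup>2 \<le> (real (k i) / real n)\<^sup>2"
          using \<open>0 \<le> a i\<close> by (intro power_mono) auto
      qed
      have "(\<integral>\<^sup>+x. ennreal (exp (l * \<phi> (combine n k w x))) \<partial>subtrees_X_law k)
          = (\<integral>\<^sup>+x. ennreal (exp (l * ?d k w)) * (\<Prod>i\<in>UNIV. ennreal (exp (l * a i * \<phi> (x i))))
              \<partial>subtrees_X_law k)"
      proof (rule nn_integral_cong)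
        fix x
        have "l * \<phi> (combine n k w x) = l * ?d k w + (\<Sum>i\<in>UNIV. l * a i * \<phi> (x i))"
          by (simp add: eigenfunctional_combine[OF \<phi>] a_def distrib_left sum_distrib_left mult.assoc)
        then have "exp (l * \<phi> (combine n k w x)) = exp (l * ?d k w) * (\<Prod>i\<in>UNIV. exp (l * a i * \<phi> (x i)))"
          by (simp only: exp_add exp_sum[OF finite])
        then show "ennreal (exp (l * \<phi> (combine n k w x)))
            = ennreal (exp (l * ?d k w)) * (\<Prod>i\<in>UNIV. ennreal (exp (l * a i * \<phi> (x i))))"
          by (simp add: ennreal_mult prod_ennreal prod_nonneg)
      qed
      also have "\<dots> = ennreal (exp (l * ?d k w)) *
          (\<integral>\<^sup>+x. (\<Prod>i\<in>UNIV. ennreal (exp (l * a i * \<phi> (x i)))) \<partial>subtrees_X_law k)"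
      proof (rule nn_integral_cmult)
        have "(\<lambda>x. x i) \<in> borel_measurable (subtrees_X_law k)" for i
          using measurable_component_singleton[of i UNIV "\<lambda>i. X_law (k i)"] by simp
        from measurable_compose[OF this \<phi>_meas]
        show "(\<lambda>x. \<Prod>i\<in>UNIV. ennreal (exp (l * a i * \<phi> (x i)))) \<in> borel_measurable (subtrees_X_law k)"
          by (intro borel_measurable_prod_ennreal measurable_compose[OF _ measurable_ennreal]
              borel_measurable_exp borel_measurable_times) simp_all
      qed
      also have "(\<integral>\<^sup>+x. (\<Prod>i\<in>UNIV. ennreal (exp (l * a i * \<phi> (x i)))) \<partial>subtrees_X_law k)
          = (\<Prod>i\<in>UNIV. \<integral>\<^sup>+x. ennreal (exp (l * a i * \<phi> x)) \<partial>X_law (k i))"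
        by (rule XP.product_nn_integral_prod) simp_all
      also have "\<dots> \<le> (\<Prod>i\<in>UNIV. ennreal (exp (K * (l * a i)\<^sup>2)))"
      proof (intro prod_mono_ennreal)
        fix i
        have "\<bar>l * a i\<bar> \<le> L * 1"
          unfolding abs_mult using less.prems a[of i] by (intro mult_mono) auto
        then show "(\<integral>\<^sup>+x. ennreal (exp (l * a i * \<phi> x)) \<partial>X_law (k i)) \<le> ennreal (exp (K * (l * a i)\<^sup>2))"
          unfolding K_def by (intro less.IH kn) simp
      qed
      also have "(\<Prod>i\<in>UNIV. ennreal (exp (K * (l * a i)\<^sup>2))) = ennreal (exp (K * l\<^sup>2 * (\<Sum>i\<in>UNIV. (a i)\<^sup>2)))"
        by (simp add: prod_ennreal sum_distrib_left power_mult_distrib mult.assoc flip: exp_sum)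
      also have "\<dots> \<le> ennreal (exp (K * l\<^sup>2 * (1 - split_spread n k)))"
      proof -
        have "(\<Sum>i\<in>UNIV. (a i)\<^sup>2) \<le> 1 - split_spread n k"
          unfolding split_spread_def using a by (simp add: sum_mono)
        moreover have "0 \<le> K * l\<^sup>2"
          using toll_bound_pos L by (simp add: K_def cumulant_constant_def)
        ultimately show ?thesis by (intro ennreal_leI) (simp add: mult_left_mono)
      qed
      finally have "(\<integral>\<^sup>+x. ennreal (exp (l * \<phi> (combine n k w x))) \<partial>subtrees_X_law k)
          \<le> ennreal (exp (l * ?d k w)) * ennreal (exp (K * l\<^sup>2 * (1 - split_spread n k)))"
        by (simp add: mult_left_mono)
      also have "\<dots> = ennreal (exp (K * l\<^sup>2)) * ennreal (exp (l * ?d k w - K * l\<^sup>2 * split_spread n k))"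
        by (simp add: algebra_simps flip: ennreal_mult exp_add)
      finally show ?thesis .
    qed
    have meas: "(\<lambda>x. ?d (fst x) (snd x)) \<in> borel_measurable (split_space m)"
      using measurable_toll[OF \<phi>, of n m] by (simp add: case_prod_unfold)
    note [measurable] = meas measurable_split_spread[of n m]
    have "(\<integral>\<^sup>+x. ennreal (exp (l * \<phi> x)) \<partial>X_law n)
        = (\<integral>\<^sup>+k. \<integral>\<^sup>+w. \<integral>\<^sup>+x. ennreal (exp (l * \<phi> (combine n k w x)))
            \<partial>subtrees_X_law k \<partial>?w \<partial>measure_pmf (sizes_chain m))"
      unfolding Suc by (rule X_law_recursion) measurable
    also have "\<dots> \<le> (\<integral>\<^sup>+k. \<integral>\<^sup>+w. ennreal (exp (K * l\<^sup>2)) *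
        ennreal (exp (l * ?d k w - K * l\<^sup>2 * split_spread n k)) \<partial>?w \<partial>measure_pmf (sizes_chain m))"
    proof (intro nn_integral_mono_AE AE_pmfI)
      fix k :: "'b \<Rightarrow> nat" assume k: "k \<in> set_pmf (sizes_chain m)"
      show "AE w in ?w. (\<integral>\<^sup>+x. ennreal (exp (l * \<phi> (combine n k w x))) \<partial>subtrees_X_law k)
          \<le> ennreal (exp (K * l\<^sup>2)) * ennreal (exp (l * ?d k w - K * l\<^sup>2 * split_spread n k))"
        using AE_entry
      proof eventually_elim
        case (elim w)
        then show ?case using k by (intro inner) (simp add: good_split_def)
      qed
    qed
    also have "\<dots> = (\<integral>\<^sup>+x. ennreal (exp (K * l\<^sup>2)) *
        ennreal (exp (l * ?d (fst x) (snd x) - K * l\<^sup>2 * split_spread n (fst x))) \<partial>split_space m)"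
      by (subst W.nn_integral_fst[symmetric]) simp_all
    also have "\<dots> = ennreal (exp (K * l\<^sup>2)) *
        (\<integral>\<^sup>+x. ennreal (exp (l * ?d (fst x) (snd x) - K * l\<^sup>2 * split_spread n (fst x))) \<partial>split_space m)"
      by (rule nn_integral_cmult) measurable
    also have "\<dots> \<le> ennreal (exp (K * l\<^sup>2)) * 1"
    proof (rule mult_left_mono)
      have "(\<integral>\<^sup>+x. ennreal (exp (l * ?d (fst x) (snd x) - spread_constant\<^sup>2 * exp (4 * L * toll_bound) * toll_bound
          / (2 * L) * l\<^sup>2 * split_spread n (fst x))) \<partial>split_space m) \<le> 1"
      proof (rule toll_compensation)
        show "prob_space (split_space m)" by (rule prob_space_split)
        show "AE x in split_space m. \<bar>?d (fst x) (snd x)\<bar> \<le> toll_bound"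
          using AE_split[of m] by eventually_elim (simp add: case_prod_beta Suc toll)
        show "(LINT x|split_space m. ?d (fst x) (snd x)) = 0"
          using integral_toll[OF \<phi>, of m] by (simp add: Suc case_prod_unfold)
        show "AE x in split_space m. 0 \<le> split_spread n (fst x)"
          using AE_split[of m]
        proof eventually_elim
          case (elim x)
          then show ?case
            using split_spread_nonneg[OF good_split_sum(1), of m "fst x" "snd x"]
            by (simp add: case_prod_beta Suc)
        qed
        show "(LINT x|split_space m. exp (- y * split_spread n (fst x))) \<le> spread_constant / sqrt y"
          if "y > 0" for y
          using laplace_split_space[OF that, of m] by (simp add: Suc)
        show "\<bar>l\<bar> \<le> L" by (rule less.prems)
      qed (use toll_bound_pos spread_constant_pos L in \<open>auto intro: meas measurable_split_spread\<close>)
      then show "(\<integral>\<^sup>+x. ennreal (exp (l * ?d (fst x) (snd x) - K * l\<^sup>2 * split_spread n (fst x))) \<partial>split_space m) \<le> 1"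
        by (simp add: K_def cumulant_constant_def)
    qed simp
    finally show ?thesis by (simp add: K_def)
  qed
qed

text \<open>
  Multiplied by \<open>exp (8 D l)\<close>, this bounds four times the cumulant constant at
  \<open>L = 2 l + 1 / D\<close>, where \<open>D\<close> is the toll bound.
\<close>

definition mgf_constant :: real where
  "mgf_constant = 2 * spread_constant\<^sup>2 * exp 4 * toll_bound\<^sup>2"

text \<open>
  The path length is itself an eigenfunctional; the Wiener index is a difference of two of them,
  and the exponential of a sum is at most the mean of the exponentials of the doubled terms.
\<close>

lemma exponential_moment_components:
  assumes l: "l > 0" and s: "s = 1 \<or> s = - 1"
  shows "(\<integral>\<^sup>+x. ennreal (exp (l * (s * x $ j))) \<partial>X_law n)
    \<le> ennreal (exp (mgf_constant * l\<^sup>2 * exp (8 * toll_bound * l)))"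
proof -
  \<comment> \<open>the second summand keeps the factor \<open>1 / L\<close> of the cumulant constant bounded for small \<open>l\<close>\<close>
  define L where "L = 2 * l + 1 / toll_bound"
  let ?B = "exp (mgf_constant * l\<^sup>2 * exp (8 * toll_bound * l))"
  have D: "toll_bound > 0" by (rule toll_bound_pos)
  have L: "L > 0" "2 * l \<le> L" using l D by (auto simp: L_def add_pos_pos)
  have K: "cumulant_constant L * 4 \<le> mgf_constant * exp (8 * toll_bound * l)" "cumulant_constant L \<ge> 0"
  proof -
    have "4 * L * toll_bound = 4 + 8 * toll_bound * l" using D by (simp add: L_def field_simps)
    then have "cumulant_constant L * 4
        = 2 * spread_constant\<^sup>2 * exp 4 * exp (8 * toll_bound * l) * (toll_bound * (1 / L))"
      by (simp add: cumulant_constant_def exp_add)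
    also have "\<dots> \<le> 2 * spread_constant\<^sup>2 * exp 4 * exp (8 * toll_bound * l) * (toll_bound * toll_bound)"
      using D l L(1) by (intro mult_left_mono) (auto simp: L_def field_simps)
    finally show "cumulant_constant L * 4 \<le> mgf_constant * exp (8 * toll_bound * l)"
      by (simp add: mgf_constant_def power2_eq_square mult_ac)
    show "cumulant_constant L \<ge> 0" using D L by (simp add: cumulant_constant_def)
  qed
  have scalar: "(\<integral>\<^sup>+x. ennreal (exp (r * \<phi> x)) \<partial>X_law n) \<le> ennreal ?B"
    if "eigenfunctional e \<phi>" "e \<ge> 1" "\<bar>r\<bar> \<le> 2 * l"
      "\<And>n k w. good_split n k w \<Longrightarrow> \<bar>\<phi> (d_vec M T Z (Suc n) k w)\<bar> \<le> toll_bound" for e \<phi> r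
  proof -
    have "(\<integral>\<^sup>+x. ennreal (exp (r * \<phi> x)) \<partial>X_law n) \<le> ennreal (exp (cumulant_constant L * r\<^sup>2))"
      using that L by (intro exponential_moment) auto
    also have "r\<^sup>2 \<le> (2 * l)\<^sup>2" using that(3) l abs_le_square_iff[of r "2 * l"] by simp
    then have "cumulant_constant L * r\<^sup>2 \<le> cumulant_constant L * (2 * l)\<^sup>2"
      using K(2) by (rule mult_left_mono)
    also have "\<dots> = cumulant_constant L * 4 * l\<^sup>2" by (simp add: power_mult_distrib)
    also have "\<dots> \<le> mgf_constant * exp (8 * toll_bound * l) * l\<^sup>2"
      using K(1) by (rule mult_right_mono) simp
    finally show ?thesis by (simp add: mult_ac ennreal_leI)
  qed
  note two = scalar[OF eigenfunctional_1 _ _ toll_bounds(1)]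
    and diff = scalar[OF eigenfunctional_2 _ _ toll_bounds(2)]
  note [measurable] = borel_measurable_nth
  consider "j = 1" | "j = 2" using exhaust_2[of j] by blast
  then show ?thesis
  proof cases
    case 2
    have "(\<integral>\<^sup>+x. ennreal (exp ((l * s) * x $ 2)) \<partial>X_law n) \<le> ennreal ?B"
      using l s by (intro two) auto
    then show ?thesis by (simp add: 2 mult.assoc)
  next
    case 1
    let ?u = "\<lambda>x :: real^2. exp ((2 * l * s) * x $ 2)" and ?v = "\<lambda>x :: real^2. exp ((- 2 * l * s) * (x $ 2 - x $ 1))"
    have "(\<integral>\<^sup>+x. ennreal (exp (l * (s * x $ 1))) \<partial>X_law n)
        \<le> (\<integral>\<^sup>+x. ennreal (1 / 2) * (ennreal (?u x) + ennreal (?v x)) \<partial>X_law n)"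
    proof (rule nn_integral_mono)
      fix x :: "real^2"
      let ?p = "l * s * x $ 2" and ?q = "- l * s * (x $ 2 - x $ 1)"
      have "0 \<le> (exp ?p - exp ?q)\<^sup>2" by simp
      also have "\<dots> = exp (2 * ?p) + exp (2 * ?q) - 2 * exp (?p + ?q)"
        by (simp only: power2_diff exp_double exp_add mult.assoc)
      also have "?p + ?q = l * (s * x $ 1)" by (simp add: algebra_simps)
      also have "2 * ?p = (2 * l * s) * x $ 2" by simp
      also have "2 * ?q = (- 2 * l * s) * (x $ 2 - x $ 1)" by simp
      finally have "exp (l * (s * x $ 1)) \<le> 1 / 2 * (?u x + ?v x)" by simp
      then have "ennreal (exp (l * (s * x $ 1))) \<le> ennreal (1 / 2 * (?u x + ?v x))"
        by (rule ennreal_leI)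
      also have "\<dots> = ennreal (1 / 2) * ennreal (?u x + ?v x)"
        by (rule ennreal_mult) (simp_all add: add_nonneg_nonneg)
      also have "ennreal (?u x + ?v x) = ennreal (?u x) + ennreal (?v x)"
        by (rule ennreal_plus) simp_all
      finally show "ennreal (exp (l * (s * x $ 1))) \<le> ennreal (1 / 2) * (ennreal (?u x) + ennreal (?v x))" .
    qed
    also have "\<dots> = ennreal (1 / 2) * ((\<integral>\<^sup>+x. ennreal (?u x) \<partial>X_law n) + (\<integral>\<^sup>+x. ennreal (?v x) \<partial>X_law n))"
      by (subst nn_integral_cmult, measurable, subst nn_integral_add) measurable
    also have "\<dots> \<le> ennreal (1 / 2) * (ennreal ?B + ennreal ?B)"
      using l s by (intro mult_left_mono add_mono two diff) auto
    also have "\<dots> = ennreal ?B"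
    proof -
      have "ennreal ?B + ennreal ?B = ennreal (?B + ?B)"
        by (rule ennreal_plus[symmetric]) simp_all
      moreover have "ennreal (1 / 2) * ennreal (?B + ?B) = ennreal (1 / 2 * (?B + ?B))"
        by (rule ennreal_mult[symmetric]) simp_all
      ultimately show ?thesis by simp
    qed
    finally show ?thesis by (simp add: 1)
  qed
qed

section \<open>Tail bounds\<close>

text \<open>
  Replacing \<open>l\<close> by \<open>l / D\<close> makes both constants of the cumulant bound as small as desired when
  \<open>D\<close> is large.
\<close>

theorem tail_bounds:
  "\<exists>D>0. 3 * toll_bound \<le> D \<and> (\<forall>t>0. \<forall>n j s. s = 1 \<or> s = - 1 \<longrightarrow>
     prob {\<omega> \<in> space M. s * X_vec M T Z n \<omega> $ j > t} \<le> tail_bound D t)"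
proof -
  obtain \<epsilon> where \<epsilon>: "\<epsilon> > 0" and dominate: "\<And>D t. D > 0 \<Longrightarrow> t > 0 \<Longrightarrow>
      \<exists>l>0. exp (\<epsilon> * l\<^sup>2 * exp (\<epsilon> * l) - l * (t / D)) \<le> tail_bound D t"
    using tail_bound_dominates by metis
  define D where "D = 3 * toll_bound + 8 * toll_bound / \<epsilon> + mgf_constant / \<epsilon> + 1"
  have b: "toll_bound > 0" by (rule toll_bound_pos)
  have c: "mgf_constant \<ge> 0" by (simp add: mgf_constant_def)
  have parts: "0 \<le> 8 * toll_bound / \<epsilon>" "0 \<le> mgf_constant / \<epsilon>" using b c \<epsilon> by auto
  have D: "D \<ge> 1" "3 * toll_bound \<le> D" "8 * toll_bound / \<epsilon> \<le> D" "mgf_constant / \<epsilon> \<le> D"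
    using b parts unfolding D_def by linarith+
  have "prob {\<omega> \<in> space M. s * X_vec M T Z n \<omega> $ j > t} \<le> tail_bound D t"
    if t: "t > 0" and s: "s = 1 \<or> s = - 1" for t s and n :: nat and j
  proof -
    obtain l' where l': "l' > 0"
      "exp (\<epsilon> * l'\<^sup>2 * exp (\<epsilon> * l') - l' * (t / D)) \<le> tail_bound D t"
      using dominate[of D t] D t by auto
    define l where "l = l' / D"
    have l: "l > 0" using l' D by (simp add: l_def)
    let ?A = "{\<omega> \<in> space M. s * X_vec M T Z n \<omega> $ j > t}"
    note [measurable] = borel_measurable_nth
    have X_meas [measurable]: "(\<lambda>\<omega>. X_vec M T Z n \<omega> $ j) \<in> borel_measurable M"
      by (rule measurable_compose[OF measurable_X_vec borel_measurable_nth])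
    have A: "?A \<in> sets M" by measurable
    have "ennreal (prob ?A) = (\<integral>\<^sup>+\<omega>. indicator ?A \<omega> \<partial>M)"
      using A by (simp add: emeasure_eq_measure)
    also have "\<dots> \<le> (\<integral>\<^sup>+\<omega>. ennreal (exp (- l * t)) * ennreal (exp (l * (s * X_vec M T Z n \<omega> $ j))) \<partial>M)"
    proof (rule nn_integral_mono)
      fix \<omega>
      have "ennreal 1 \<le> ennreal (exp (- l * t) * exp (l * (s * X_vec M T Z n \<omega> $ j)))" if "\<omega> \<in> ?A"
        using that l by (intro ennreal_leI) (simp add: mult_left_mono flip: exp_add)
      then show "indicator ?A \<omega> \<le> ennreal (exp (- l * t)) * ennreal (exp (l * (s * X_vec M T Z n \<omega> $ j)))"
        by (auto simp: indicator_def ennreal_mult)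
    qed
    also have "\<dots> = ennreal (exp (- l * t)) * (\<integral>\<^sup>+\<omega>. ennreal (exp (l * (s * X_vec M T Z n \<omega> $ j))) \<partial>M)"
      by (rule nn_integral_cmult) measurable
    also have "(\<integral>\<^sup>+\<omega>. ennreal (exp (l * (s * X_vec M T Z n \<omega> $ j))) \<partial>M)
        = (\<integral>\<^sup>+x. ennreal (exp (l * (s * x $ j))) \<partial>X_law n)"
      by (subst nn_integral_distr) measurable
    also have "ennreal (exp (- l * t)) * \<dots>
        \<le> ennreal (exp (- l * t)) * ennreal (exp (mgf_constant * l\<^sup>2 * exp (8 * toll_bound * l)))"
      by (intro mult_left_mono exponential_moment_components l s) simp
    also have "\<dots> = ennreal (exp (mgf_constant * l\<^sup>2 * exp (8 * toll_bound * l) - l * t))"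
      by (simp flip: ennreal_mult exp_add)
    also have "\<dots> \<le> ennreal (exp (\<epsilon> * l'\<^sup>2 * exp (\<epsilon> * l') - l' * (t / D)))"
    proof (rule ennreal_leI, subst exp_le_cancel_iff, rule diff_mono, rule mult_mono)
      have "mgf_constant * l\<^sup>2 = mgf_constant / D\<^sup>2 * l'\<^sup>2" by (simp add: l_def power_divide)
      also have "mgf_constant / D\<^sup>2 \<le> \<epsilon>"
      proof -
        have "mgf_constant \<le> \<epsilon> * D" using D(4) \<epsilon> by (simp add: pos_divide_le_eq mult.commute)
        also have "\<dots> \<le> \<epsilon> * D\<^sup>2" using \<epsilon> D(1) by (intro mult_left_mono) (auto simp: power2_eq_square)
        finally show ?thesis using D(1) by (simp add: pos_divide_le_eq)
      qed
      finally show "mgf_constant * l\<^sup>2 \<le> \<epsilon> * l'\<^sup>2" by (simp add: mult_right_mono)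
      have "8 * toll_bound \<le> \<epsilon> * D" using D(3) \<epsilon> by (simp add: pos_divide_le_eq mult.commute)
      then have "8 * toll_bound * l \<le> \<epsilon> * D * l" using l by (intro mult_right_mono) auto
      also have "\<epsilon> * D * l = \<epsilon> * l'" using D(1) by (simp add: l_def)
      finally show "exp (8 * toll_bound * l) \<le> exp (\<epsilon> * l')" by simp
      show "l' * (t / D) \<le> l * t" by (simp add: l_def)
    qed (use \<epsilon> in auto)
    also have "\<dots> \<le> ennreal (tail_bound D t)" by (rule ennreal_leI[OF l'(2)])
    finally show ?thesis
      by (subst (asm) ennreal_le_iff) (auto intro: order_trans[OF _ l'(2)])
  qed
  then show ?thesis using D(1,2) by (intro exI[of _ D]) auto
qed

end

theorem theorem1p2:
  fixes M :: "'a measure"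
    and T :: "nat \<Rightarrow> 'a \<Rightarrow> 'b::finite list set"
    and Z :: "'b list \<Rightarrow> 'a \<Rightarrow> real^'b"
  assumes "prob_space M"
    and "CARD('b) \<ge> 2"
    and "\<And>n. distr M (count_space UNIV) (T n) = measure_pmf (bary_tree n)"
    and "prob_space.indep_vars M (\<lambda>_. borel) Z UNIV"
    and "\<And>u. distr M borel (Z u) = distr M borel (Z [])"
    and "\<And>n. prob_space.indep_set M
      (sets (vimage_algebra (space M) (T n) (count_space UNIV)))
      (sets (vimage_algebra (space M) (\<lambda>\<omega> u. Z u \<omega>) (\<Pi>\<^sub>M u\<in>UNIV. borel)))"
    and "\<And>i j. distr M borel (\<lambda>\<omega>. Z [] \<omega> $ i) = distr M borel (\<lambda>\<omega>. Z [] \<omega> $ j)"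
    and "AE \<omega> in M. \<forall>i. 0 \<le> Z [] \<omega> $ i"
    and "\<exists>K. AE \<omega> in M. norm (Z [] \<omega>) \<le> K"
  shows "(\<forall>n\<ge>2. distr M borel (X_vec M T Z n) = recursion_law M T Z n) \<and>
    (\<exists>D>0.
      (\<forall>n\<ge>1. AE \<omega> in M. norm (d_vec M T Z n (sizes_rv T n \<omega>) (Z [] \<omega>)) \<le> D) \<and>
      (\<forall>t>0. \<forall>n\<ge>1.
        \<P>(\<omega> in M. (wiener_rv T Z n \<omega> - (LINT \<omega>'|M. wiener_rv T Z n \<omega>')) / real n ^ 2 > t) \<le> tail_bound D t \<and>
        \<P>(\<omega> in M. (path_length_rv T Z n \<omega> - (LINT \<omega>'|M. path_length_rv T Z n \<omega>')) / real n > t) \<le> tail_bound D t \<and>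
        (\<forall>j. \<P>(\<omega> in M. X_vec M T Z n \<omega> $ j < - t) \<le> tail_bound D t)))"
proof -
  obtain K where K: "AE \<omega> in M. norm (Z [] \<omega>) \<le> K" using assms(9) by blast
  interpret prob_space M by (rule assms(1))
  have "random_weighted_tree_axioms M T Z K (real CARD('b))"
  proof (rule random_weighted_tree_axioms.intro)
    show "real CARD('b) = real CARD('b)" by (rule refl)
  qed (rule assms(2) assms(3) assms(4) assms(5) assms(6) assms(7) assms(8) K)+
  then interpret random_weighted_tree M T Z K "real CARD('b)"
    by (rule random_weighted_tree.intro[OF assms(1)])
  obtain D where D: "D > 0" "3 * toll_bound \<le> D" and
    tail: "\<forall>t>0. \<forall>n j s. s = 1 \<or> s = - 1 \<longrightarrow>
      prob {\<omega> \<in> space M. s * X_vec M T Z n \<omega> $ j > t} \<le> tail_bound D t"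
    using tail_bounds by (elim exE conjE)
  have rec: "distr M borel (X_vec M T Z n) = recursion_law M T Z n" if "n \<ge> 2" for n
    using X_law_eq_recursion_law[of "n - 1"] that by simp
  have d: "AE \<omega> in M. norm (d_vec M T Z n (sizes_rv T n \<omega>) (Z [] \<omega>)) \<le> D" if "n \<ge> 1" for n
    using AE_d_vec_bound[OF that] by eventually_elim (use D in linarith)
  have right: "prob {\<omega> \<in> space M. X_vec M T Z n \<omega> $ j > t} \<le> tail_bound D t" if "t > 0" for t n j
    using tail[rule_format, OF that, of 1 n j] by simp
  have left: "prob {\<omega> \<in> space M. X_vec M T Z n \<omega> $ j < - t} \<le> tail_bound D t" if "t > 0" for t n j
    using tail[rule_format, OF that, of "- 1" n j] by (simp add: less_minus_iff)
  show ?thesis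
    using rec d D(1) left right[of _ _ 1, unfolded X_vec_nth] right[of _ _ 2, unfolded X_vec_nth]
    by (intro conjI exI[of _ D] allI impI) auto
qed

end
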